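(* Let $\mathfrak{B}\in\mathfrak{L}^{\mathtt w}$ be a linear differential behavior with input cardinality $\mathtt m=\mathtt m(\mathfrak{B})$, and let $\Sigma\in\mathbb{R}^{\mathtt w\times\mathtt w}$ be symmetric and nonsingular with $\mathtt m(\mathfrak{B})\leqslant\sigma_+(\Sigma)$, in the form $$\Sigma=\begin{bmatrix} I_{\mathtt m}&0&0\\ 0&I_{\mathtt q}&0\\ 0&0&-I_{\mathtt p}\end{bmatrix},\qquad J_{pq}:=\begin{bmatrix} I_{\mathtt q}&0\\ 0&-I_{\mathtt p}\end{bmatrix},\qquad \mathtt w=\mathtt m+\mathtt q+\mathtt p .$$ Assume that the set $\Lambda_{un}\subset\mathbb{C}$ of uncontrollable modes of $\mathfrak{B}$ satisfies $\Lambda_{un}\cap(-\Lambda_{un})=\emptyset$. Let the controllable part $\mathfrak{B}_{cont}$ of $\mathfrak{B}$ have an observable image representation $w=M(\frac{d}{dt})\ell$, with $M$ partitioned as $$M(\xi)=\begin{bmatrix} W_1(\xi) \\ W_2(\xi) \end{bmatrix},\qquad W_1\in\mathbb{R}^{\mathtt m\times\mathtt m}[\xi],\quad W_2\in\mathbb{R}^{(\mathtt p+\mathtt q)\times\mathtt m}[\xi],$$ where $W_1$ is nonsingular (as a polynomial matrix) and $G(\xi):=W_2(\xi)W_1(\xi)^{-1}$ is proper. Let $D:=\lim_{\omega\to\infty}G(j\omega)$ and assume that $I_{\mathtt m}+D^TJ_{pq}D>0$. Then $\mathfrak{B}$ is $\Sigma$-dissipative if and only if $\mathfrak{B}_{cont}$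 is $\Sigma$-dissipative.
   Context: A linear differential behavior with $\mathtt w$ variables is a set $\mathfrak{B}=\{w\in C^\infty(\mathbb{R},\mathbb{R}^{\mathtt w}) : R(\frac{d}{dt})w=0\}$ for some polynomial matrix $R(\xi)$ with real coefficients and $\mathtt w$ columns (a kernel representation of $\mathfrak{B}$; $R$ may be taken of full row rank). $\mathfrak{L}^{\mathtt w}$ is the set of all such behaviors. The input cardinality is $\mathtt m(\mathfrak{B}):=\mathtt w-\operatorname{rank}R$ (rank as a polynomial matrix). $\mathfrak{B}$ is controllable if for all $w_1,w_2\in\mathfrak{B}$ there exist $w_3\in\mathfrak{B}$ and $\tau>0$ with $w_3(t)=w_1(t)$ for $t\le 0$ and $w_3(t)=w_2(t)$ for $t\ge\tau$. The controllable part $\mathfrak{B}_{cont}$ is the largest controllable behavior contained in $\mathfrak{B}$; it has the same input cardinality as $\mathfrak{B}$. A controllable behavior admits an image representation $\{w: \exists\,\ell\in C^\infty(\mathbb{R},\mathbb{R}^{\mathtt m}),\ w=M(\frac{d}{dt})\ell\}$; it is called observable if $M(\lambda)$ has full column rank for every $\lambda\in\mathbb{C}$. The set $\Lambda_{un}$ of uncontrollable modes is the set of $\lambda\in\mathbb{C}$ at which $R(\lambda)$ loses rank, i.e. $\operatorname{rank}R(\lambda)<\operatorname{rank}R$. A quadratic differential form (QDF) induced by $\Psi(\zeta,\eta)=\sum_{j,k}\Psi_{jk}\zeta^j\eta^k\in\mathbb{R}^{\mathtt w\times\mathtt w}[\zeta,\eta]$ is the map $Q_\Psi(w)=\sum_{j,k}(\frac{d^jw}{dt^j})^T\Psi_{jk}\frac{d^kw}{dt^k}$.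 A behavior $\mathfrak{B}$ is $\Sigma$-dissipative if there exists a QDF $Q_\Psi$ (a storage function) such that $\frac{d}{dt}Q_\Psi(w)\leqslant w^T\Sigma w$ (pointwise in time) for all $w\in\mathfrak{B}$. $\sigma_+(\Sigma)$ denotes the number of positive eigenvalues of $\Sigma$. The input/output partition $w=(w_1,w_2)$ has $w_1$ the first $\mathtt m$ components, and $G$ is the transfer matrix from $w_1$ to $w_2$. *)

theory Defs
  imports
    "HOL-Analysis.Derivative"
    "HOL-Computational_Algebra.Computational_Algebra"
    "HOL-Computational_Algebra.Field_as_Ring"
    "Jordan_Normal_Form.DL_Rank"
    "Jordan_Normal_Form.Char_Poly"
    "Jordan_Normal_Form.Gauss_Jordan_Elimination"
begin

unbundle no vec_syntax
unbundle no inner_syntax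

text \<open>Block sizes may be zero, so vectors and matrices are those of
  Jordan_Normal_Form, with explicit dimensions. A trajectory with \<open>n\<close> variables is a function
  \<open>real \<Rightarrow> real vec\<close> all of whose values have dimension \<open>n\<close>.\<close>

definition smooth :: "(real \<Rightarrow> real) \<Rightarrow> bool" where
  "smooth f \<longleftrightarrow> (\<forall>k t. (deriv ^^ k) f differentiable (at t))"

definition smooth_trajectories :: "nat \<Rightarrow> (real \<Rightarrow> real vec) set" where
  "smooth_trajectories n =
     {w. (\<forall>t. w t \<in> carrier_vec n) \<and> (\<forall>i<n. smooth (\<lambda>t. w t $ i))}"

definition nth_deriv :: "nat \<Rightarrow> (real \<Rightarrow> real vec) \<Rightarrow> real \<Rightarrow> real vec" where
  "nth_deriv k w t = vec (dim_vec (w t)) (\<lambda>i. (deriv ^^ k) (\<lambda>s. w s $ i) t)"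

definition diff_op :: "real poly mat \<Rightarrow> (real \<Rightarrow> real vec) \<Rightarrow> real \<Rightarrow> real vec" where
  "diff_op R w t = vec (dim_row R) (\<lambda>i. \<Sum>j<dim_col R.
     \<Sum>k\<le>degree (R $$ (i, j)). coeff (R $$ (i, j)) k * (deriv ^^ k) (\<lambda>s. w s $ j) t)"

definition kernel_behavior :: "real poly mat \<Rightarrow> (real \<Rightarrow> real vec) set" where
  "kernel_behavior R =
     {w \<in> smooth_trajectories (dim_col R). \<forall>t. diff_op R w t = 0\<^sub>v (dim_row R)}"

definition image_behavior :: "real poly mat \<Rightarrow> (real \<Rightarrow> real vec) set" where
  "image_behavior M = diff_op M ` smooth_trajectories (dim_col M)"

definition linear_behaviors :: "nat \<Rightarrow> (real \<Rightarrow> real vec) set set" where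
  "linear_behaviors n = {kernel_behavior R | R. dim_col R = n}"

definition controllable :: "(real \<Rightarrow> real vec) set \<Rightarrow> bool" where
  "controllable B \<longleftrightarrow> (\<forall>w1\<in>B. \<forall>w2\<in>B. \<exists>w3\<in>B. \<exists>\<tau>>0.
     (\<forall>t\<le>0. w3 t = w1 t) \<and> (\<forall>t\<ge>\<tau>. w3 t = w2 t))"

definition is_controllable_part ::
    "nat \<Rightarrow> (real \<Rightarrow> real vec) set \<Rightarrow> (real \<Rightarrow> real vec) set \<Rightarrow> bool" where
  "is_controllable_part n B C \<longleftrightarrow>
     C \<in> linear_behaviors n \<and> C \<subseteq> B \<and> controllable C \<and>
     (\<forall>C'\<in>linear_behaviors n. C' \<subseteq> B \<and> controllable C' \<longrightarrow> C' \<subseteq> C)"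

definition poly_rank :: "real poly mat \<Rightarrow> nat" where
  "poly_rank R = vec_space.rank (dim_row R) (map_mat to_fract R)"

definition eval_mat :: "real poly mat \<Rightarrow> complex \<Rightarrow> complex mat" where
  "eval_mat R z = map_mat (\<lambda>p. poly (map_poly of_real p) z) R"

definition rank_at :: "real poly mat \<Rightarrow> complex \<Rightarrow> nat" where
  "rank_at R z = vec_space.rank (dim_row R) (eval_mat R z)"

text \<open>The next two notions are attached to a behavior through a kernel representation; they do
  not depend on which one is chosen. The matrix is not required to have full row rank.\<close>

definition input_cardinality :: "real poly mat \<Rightarrow> nat" where
  "input_cardinality R = dim_col R - poly_rank R"

definition uncontrollable_modes :: "real poly mat \<Rightarrow> complex set" where
  "uncontrollable_modes R = {z. rank_at R z < poly_rank R}"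

definition observable_image :: "real poly mat \<Rightarrow> bool" where
  "observable_image M \<longleftrightarrow> (\<forall>z. rank_at M z = dim_col M)"

text \<open>A two-variable polynomial in \<open>\<zeta>, \<eta>\<close> is a polynomial in \<open>\<zeta>\<close> (outer) whose coefficients are
  polynomials in \<open>\<eta>\<close> (inner); \<open>coeff_mat \<Psi> j k\<close> is the coefficient matrix of \<open>\<zeta> ^ j * \<eta> ^ k\<close>.\<close>

definition coeff_mat :: "real poly poly mat \<Rightarrow> nat \<Rightarrow> nat \<Rightarrow> real mat" where
  "coeff_mat \<Psi> j k = map_mat (\<lambda>p. coeff (coeff p j) k) \<Psi>"

definition coeff_support :: "real poly poly mat \<Rightarrow> (nat \<times> nat) set" where
  "coeff_support \<Psi> = {(j, k). coeff_mat \<Psi> j k \<noteq> 0\<^sub>m (dim_row \<Psi>) (dim_col \<Psi>)}"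

lemma finite_coeff_support: "finite (coeff_support \<Psi>)"
proof -
  let ?I = "{..<dim_row \<Psi>} \<times> {..<dim_col \<Psi>}"
  let ?S = "\<lambda>p::real poly poly. SIGMA j:{..degree p}. {..degree (coeff p j)}"
  have "coeff_support \<Psi> \<subseteq> (\<Union>ab\<in>?I. ?S (\<Psi> $$ ab))"
  proof (clarify)
    fix j k assume "(j, k) \<in> coeff_support \<Psi>"
    then have "coeff_mat \<Psi> j k \<noteq> 0\<^sub>m (dim_row \<Psi>) (dim_col \<Psi>)"
      by (simp add: coeff_support_def)
    then obtain a b where ab: "a < dim_row \<Psi>" "b < dim_col \<Psi>"
      and nz: "coeff (coeff (\<Psi> $$ (a, b)) j) k \<noteq> 0"
      unfolding coeff_mat_def by (metis (no_types, lifting)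
          eq_matI index_map_mat index_zero_mat)
    have "k \<le> degree (coeff (\<Psi> $$ (a, b)) j)" using nz by (rule le_degree)
    moreover have "j \<le> degree (\<Psi> $$ (a, b))" using nz by (intro le_degree) auto
    ultimately have "(j, k) \<in> ?S (\<Psi> $$ (a, b))" by simp
    then show "(j, k) \<in> (\<Union>ab\<in>?I. ?S (\<Psi> $$ ab))" using ab by blast
  qed
  then show ?thesis by (rule finite_subset) auto
qed

definition qdf :: "real poly poly mat \<Rightarrow> (real \<Rightarrow> real vec) \<Rightarrow> real \<Rightarrow> real" where
  "qdf \<Psi> w t = (\<Sum>(j, k)\<in>coeff_support \<Psi>.
     nth_deriv j w t \<bullet> (coeff_mat \<Psi> j k *\<^sub>v nth_deriv k w t))"

definition dissipative :: "nat \<Rightarrow> real mat \<Rightarrow> (real \<Rightarrow> real vec) set \<Rightarrow> bool" where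
  "dissipative n \<Sigma> B \<longleftrightarrow> (\<exists>\<Psi>\<in>carrier_mat n n. \<forall>w\<in>B. \<forall>t.
     deriv (qdf \<Psi> w) t \<le> w t \<bullet> (\<Sigma> *\<^sub>v w t))"

definition positive_definite :: "real mat \<Rightarrow> bool" where
  "positive_definite A \<longleftrightarrow> transpose_mat A = A \<and>
     (\<forall>v\<in>carrier_vec (dim_row A). v \<noteq> 0\<^sub>v (dim_row A) \<longrightarrow> 0 < v \<bullet> (A *\<^sub>v v))"

definition num_pos_eigenvalues :: "real mat \<Rightarrow> nat" where
  "num_pos_eigenvalues A = (\<Sum>x | eigenvalue A x \<and> 0 < x. Polynomial.order x (char_poly A))"

definition transfer_matrix :: "real poly mat \<Rightarrow> real poly mat \<Rightarrow> real poly fract mat" where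
  "transfer_matrix W1 W2 = map_mat to_fract W2 * the (mat_inverse (map_mat to_fract W1))"

text \<open>\<open>quot_of_fract\<close> is the pair of numerator and denominator in lowest terms.\<close>

definition proper_fract :: "real poly fract \<Rightarrow> bool" where
  "proper_fract x \<longleftrightarrow> degree (fst (quot_of_fract x)) \<le> degree (snd (quot_of_fract x))"

definition proper_mat :: "real poly fract mat \<Rightarrow> bool" where
  "proper_mat G \<longleftrightarrow> (\<forall>i<dim_row G. \<forall>j<dim_col G. proper_fract (G $$ (i, j)))"

definition eval_fract :: "real poly fract \<Rightarrow> complex \<Rightarrow> complex" where
  "eval_fract x z = poly (map_poly of_real (fst (quot_of_fract x))) z /
     poly (map_poly of_real (snd (quot_of_fract x))) z"

definition has_limit_on_imaginary_axis :: "real poly fract mat \<Rightarrow> real mat \<Rightarrow> bool" where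
  "has_limit_on_imaginary_axis G D \<longleftrightarrow> D \<in> carrier_mat (dim_row G) (dim_col G) \<and>
     (\<forall>i<dim_row G. \<forall>j<dim_col G.
        ((\<lambda>\<omega>::real. eval_fract (G $$ (i, j)) (\<i> * of_real \<omega>)) \<longlongrightarrow> of_real (D $$ (i, j))) at_top)"

end

theory Submission
  imports Defs
begin

text \<open>Only the implication from the controllable part to the whole behavior needs work. Write
  \<open>P\<^sup>*(\<xi>) = P(-\<xi>)\<^sup>T\<close> (with conjugated coefficients). Dissipativity of the image of \<open>M\<close>, tested on
  sinusoids, says that \<open>\<Phi> = M\<^sup>*\<Sigma>M\<close> is positive semidefinite on the imaginary axis, and the condition on
  \<open>D\<close> makes \<open>\<Phi>\<close> nonsingular. In a spectral factorization \<open>\<Phi> = H\<^sup>*H\<close> each zero of \<open>det H\<^sup>*\<close> can be chosen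
  between a zero of \<open>det \<Phi>\<close> and its mirror image; as no uncontrollable mode has an uncontrollable mirror
  image, \<open>det H\<^sup>*\<close> can be kept away from all uncontrollable modes.

  Let \<open>SM = I\<close> and \<open>P = I - MS\<close>, so that \<open>RP = R\<close>. Away from the uncontrollable modes \<open>P\<close> factors through
  \<open>R\<close>, up to a scalar. Bezout's identity therefore solves \<open>M\<^sup>*\<Sigma>P = H\<^sup>*E + YR\<close>, and, since
  the mirrored uncontrollable modes are not uncontrollable, also
  \<open>P\<^sup>*(\<Sigma> - E\<^sup>*E)P = U\<^sup>*R + R\<^sup>*U\<close>. With \<open>L = HS + E\<close> these combine to
  \<open>\<Sigma> = L\<^sup>*L + V\<^sup>*R + R\<^sup>*V\<close>, which by integration by parts turns the supply rate into \<open>|Lw|\<^sup>2\<close> plus the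
  derivative of a quadratic differential form along every \<open>w\<close> with \<open>Rw = 0\<close>.

  All polynomial matrices are handled in the variable \<open>x\<close> with \<open>\<xi> = ix\<close>: the imaginary axis becomes the
  real line and \<open>P\<^sup>*\<close> becomes the transpose with coefficientwise conjugation.\<close>

section \<open>Para-Hermitian polynomial matrices\<close>

text \<open>The obstacle is polynomiality: completing the square with rational functions is easy but
  gives no differential form. There are two divisions. Dividing \<open>M\<^sup>*\<Sigma>P\<close> by
  \<open>H\<^sup>*\<close> fails only at zeros of \<open>det H\<^sup>*\<close>, and a multiple of
  \<open>R\<close> can absorb the error wherever \<open>P\<close> factors through \<open>R\<close>;
  so no point may be bad for both, which dictates the zeros that \<open>H\<^sup>*\<close> must
  avoid. The block that remains on the range of \<open>P\<close> is divided by \<open>R\<close> on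
  the right and by \<open>R\<^sup>*\<close> on the left, which fails only if a point and its mirror
  image are both bad. In each case the admissible scalars form an ideal of polynomials in one
  variable, so conditions at single points suffice.

  Real coefficients turn the hypothesis on modes into this form: the bad points are closed under
  conjugation, so the mirror image \<open>-\<lambda>\<close> may be replaced by
  \<open>- cnj \<lambda>\<close>, which is plain conjugation of \<open>x\<close>. The price of
  \<open>x\<close> is complex coefficients. After the return to \<xi>, the coefficientwise real part
  of the final identity is an identity over the reals with twice as many squares.\<close>

interpretation cnj_hom: comm_ring_hom cnj
  by unfold_locales auto
interpretation cnjp: map_poly_comm_ring_hom cnj ..
abbreviation cnjp :: "complex poly \<Rightarrow> complex poly" where "cnjp \<equiv> map_poly cnj"

lemma coeff_cnjp [simp]: "coeff (cnjp p) k = cnj (coeff p k)"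
  by (simp add: coeff_map_poly)

lemma cnjp_cnjp [simp]: "cnjp (cnjp p) = p"
  by (rule poly_eqI) simp

lemma degree_cnjp [simp]: "degree (cnjp p) = degree p"
  by (simp add: degree_map_poly)

lemma cnjp_eq_0_iff [simp]: "cnjp p = 0 \<longleftrightarrow> p = 0"
  by (metis cnjp_cnjp map_poly_0)

lemma poly_cnjp: "poly (cnjp p) z = cnj (poly p (cnj z))"
  by (induction p) (auto simp: map_poly_pCons)

text \<open>The value at \<open>z\<close> is the conjugate transpose of the value at
  \<open>cnj z\<close>; at real points this is the ordinary conjugate transpose.\<close>

definition cadj :: "complex poly mat \<Rightarrow> complex poly mat" where
  "cadj A = map_mat cnjp (transpose_mat A)"

lemma cadj_dim [simp]: "dim_row (cadj A) = dim_col A" "dim_col (cadj A) = dim_row A"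
  by (auto simp: cadj_def)

lemma cadj_carrier [simp]: "cadj A \<in> carrier_mat n k \<longleftrightarrow> A \<in> carrier_mat k n"
  by (auto simp: cadj_def)

lemma cadj_index: "i < dim_col A \<Longrightarrow> j < dim_row A \<Longrightarrow> cadj A $$ (i, j) = cnjp (A $$ (j, i))"
  by (simp add: cadj_def)

lemma cadj_cadj [simp]: "cadj (cadj A) = A"
  by (rule eq_matI) (auto simp: cadj_index)

lemma cadj_mult: "dim_col A = dim_row B \<Longrightarrow> cadj (A * B) = cadj B * cadj A"
proof (rule eq_matI)
  fix i j assume d: "dim_col A = dim_row B" and ij: "i < dim_row (cadj B * cadj A)" "j < dim_col (cadj B * cadj A)"
  then show "cadj (A * B) $$ (i, j) = (cadj B * cadj A) $$ (i, j)"
    by (auto simp: cadj_index scalar_prod_def cnjp.hom_sum cnjp.hom_mult mult.commute intro!: sum.cong)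
qed auto

lemma cadj_smult: "cadj (k \<cdot>\<^sub>m A) = cnjp k \<cdot>\<^sub>m cadj A"
  by (rule eq_matI) (auto simp: cadj_index cnjp.hom_mult)

lemma cadj_add: "dim_row A = dim_row B \<Longrightarrow> dim_col A = dim_col B \<Longrightarrow> cadj (A + B) = cadj A + cadj B"
  by (rule eq_matI) (auto simp: cadj_index cnjp.hom_add)

lemma cadj_minus: "dim_row A = dim_row B \<Longrightarrow> dim_col A = dim_col B \<Longrightarrow> cadj (A - B) = cadj A - cadj B"
  by (rule eq_matI) (auto simp: cadj_index cnjp.hom_minus)

lemma cadj_one [simp]: "cadj (1\<^sub>m n) = 1\<^sub>m n"
  by (rule eq_matI) (auto simp: cadj_index)

lemma det_cadj: "A \<in> carrier_mat n n \<Longrightarrow> Determinant.det (cadj A) = cnjp (Determinant.det A)"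
  by (simp add: cadj_def cnjp.hom_det det_transpose)

lemma mat_assoc: "dim_col A = dim_row B \<Longrightarrow> dim_col B = dim_row C \<Longrightarrow>
    (A * B) * C = A * (B * (C :: 'a :: semiring_0 mat))"
  by (metis assoc_mult_mat carrier_matI)

lemma mat_smult_left: "dim_col A = dim_row B \<Longrightarrow> (k \<cdot>\<^sub>m A) * B = k \<cdot>\<^sub>m (A * (B :: 'a :: comm_ring_1 mat))"
  by (metis carrier_matI mult_smult_assoc_mat)

lemma mat_smult_right: "dim_col A = dim_row B \<Longrightarrow> A * (k \<cdot>\<^sub>m B) = k \<cdot>\<^sub>m (A * (B :: 'a :: comm_ring_1 mat))"
  by (metis carrier_matI mult_smult_distrib)

lemma mat_smult_smult: "k \<cdot>\<^sub>m (l \<cdot>\<^sub>m A) = (k * l) \<cdot>\<^sub>m (A :: 'a :: comm_ring_1 mat)"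
  by (rule eq_matI) (auto simp: mult_ac)

definition nonneg_poly :: "complex poly \<Rightarrow> bool" where
  "nonneg_poly q \<longleftrightarrow> (\<forall>x::real. Im (poly q (of_real x)) = 0 \<and> 0 \<le> Re (poly q (of_real x)))"

text \<open>Polynomial test vectors give the same condition as constant ones, since only their
  values at real points matter, but they make invariance under polynomial congruences
  immediate.\<close>

definition psd_poly_mat :: "nat \<Rightarrow> complex poly mat \<Rightarrow> bool" where
  "psd_poly_mat m \<Phi> \<longleftrightarrow> \<Phi> \<in> carrier_mat m m \<and> cadj \<Phi> = \<Phi> \<and>
     (\<forall>u\<in>carrier_mat m 1. nonneg_poly ((cadj u * \<Phi> * u) $$ (0, 0)))"

lemma psd_congruence:
  assumes "psd_poly_mat m \<Phi>" and A: "A \<in> carrier_mat m m"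
  shows "psd_poly_mat m (cadj A * \<Phi> * A)"
proof -
  have \<Phi>: "\<Phi> \<in> carrier_mat m m" "cadj \<Phi> = \<Phi>"
    and nn: "\<And>u. u \<in> carrier_mat m 1 \<Longrightarrow> nonneg_poly ((cadj u * \<Phi> * u) $$ (0, 0))"
    using assms by (auto simp: psd_poly_mat_def)
  have cA: "cadj A \<in> carrier_mat m m" using A by simp
  have "nonneg_poly ((cadj u * (cadj A * \<Phi> * A) * u) $$ (0, 0))" if u: "u \<in> carrier_mat m 1" for u
  proof -
    have cu: "cadj u \<in> carrier_mat 1 m" using u by simp
    have "cadj u * (cadj A * \<Phi> * A) * u = cadj (A * u) * \<Phi> * (A * u)"
      using A u \<Phi>(1) by (simp add: cadj_mult mat_assoc del: assoc_mult_mat)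
    then show ?thesis using nn[of "A * u"] A u by auto
  qed
  moreover have "cadj (cadj A * \<Phi> * A) = cadj A * \<Phi> * A"
    using A \<Phi> cA by (simp add: cadj_mult)
  ultimately show ?thesis using A \<Phi> cA by (auto simp: psd_poly_mat_def)
qed

text \<open>The zeros are controlled for \<open>cadj H\<close> rather than \<open>H\<close>, because
  \<open>cadj H\<close> is the factor that has to be divided out later. The two determinants have
  conjugate zeros.\<close>

definition spectral_factor :: "nat \<Rightarrow> complex set \<Rightarrow> complex poly mat \<Rightarrow> complex poly mat \<Rightarrow> bool" where
  "spectral_factor m \<Omega> \<Phi> H \<longleftrightarrow> H \<in> carrier_mat m m \<and> \<Phi> = cadj H * H \<and>
     (\<forall>z\<in>\<Omega>. poly (Determinant.det (cadj H)) z \<noteq> 0)"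

lemma const_det_inverse:
  assumes A: "A \<in> carrier_mat m m" and d: "Determinant.det A = [:c:]" "c \<noteq> (0::complex)"
  obtains B where "B \<in> carrier_mat m m" "A * B = 1\<^sub>m m" "B * A = 1\<^sub>m m"
proof
  let ?B = "[:1 / c:] \<cdot>\<^sub>m adj_mat A"
  have i: "[:1 / c:] * [:c:] = 1" using d(2) by (simp add: one_pCons)
  have s: "[:1 / c:] \<cdot>\<^sub>m ([:c:] \<cdot>\<^sub>m 1\<^sub>m m) = 1\<^sub>m m"
    by (rule eq_matI) (use d(2) in \<open>auto simp: one_pCons\<close>)
  show "?B \<in> carrier_mat m m" using adj_mat[OF A] by simp
  show "A * ?B = 1\<^sub>m m"
    using mult_smult_distrib[OF A adj_mat(1)[OF A], of "[:1 / c:]"] adj_mat(2)[OF A] s d by simp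
  show "?B * A = 1\<^sub>m m"
    using mult_smult_assoc_mat[OF adj_mat(1)[OF A] A, of "[:1 / c:]"] adj_mat(3)[OF A] s d by simp
qed

text \<open>A factor of the transformed matrix times the inverse of \<open>A\<close> is a factor of
  \<Phi>. Since \<open>det A\<close> is a nonzero constant, this inverse is polynomial and
  multiplication by it leaves the zeros of the determinant unchanged.\<close>

lemma spectral_factor_congruence:
  assumes \<Phi>: "\<Phi> \<in> carrier_mat m m" and A: "A \<in> carrier_mat m m"
    and d: "Determinant.det A = [:c:]" "c \<noteq> 0"
    and sf: "spectral_factor m \<Omega> (cadj A * \<Phi> * A) H"
  shows "\<exists>H'. spectral_factor m \<Omega> \<Phi> H'"
proof -
  obtain B where B: "B \<in> carrier_mat m m" and AB: "A * B = 1\<^sub>m m" and BA: "B * A = 1\<^sub>m m"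
    using const_det_inverse[OF A d] by blast
  have H: "H \<in> carrier_mat m m" "cadj A * \<Phi> * A = cadj H * H"
    "\<And>z. z \<in> \<Omega> \<Longrightarrow> poly (Determinant.det (cadj H)) z \<noteq> 0"
    using sf by (auto simp: spectral_factor_def)
  have cBA: "cadj B * cadj A = 1\<^sub>m m" using arg_cong[OF AB, of cadj] A B by (simp add: cadj_mult)
  have c: "cadj A \<in> carrier_mat m m" "cadj B \<in> carrier_mat m m" "cadj H \<in> carrier_mat m m"
    using A B H by auto
  have "cadj (H * B) * (H * B) = cadj B * (cadj H * H) * B"
    using B H c by (simp add: cadj_mult mat_assoc del: assoc_mult_mat)
  also have "\<dots> = cadj B * (cadj A * \<Phi> * A) * B" using H by simp
  also have "\<dots> = cadj B * cadj A * \<Phi> * (A * B)"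
    using A B c \<Phi> by (simp add: mat_assoc del: assoc_mult_mat)
  also have "\<dots> = \<Phi>" using \<Phi> by (simp add: AB cBA)
  finally have 1: "\<Phi> = cadj (H * B) * (H * B)" by simp
  have "Determinant.det (cadj B) * Determinant.det (cadj A) = 1"
    using det_mult[OF c(2) c(1)] cBA by simp
  then have nz: "poly (Determinant.det (cadj B)) z \<noteq> 0" for z
    by (metis mult_zero_left poly_1 poly_mult zero_neq_one)
  have "poly (Determinant.det (cadj (H * B))) z \<noteq> 0" if "z \<in> \<Omega>" for z
    using H(3)[OF that] nz[of z] det_mult[OF c(2) c(3)] B H by (simp add: cadj_mult)
  then show ?thesis using 1 H(1) B
    by (intro exI[of _ "H * B"]) (auto simp: spectral_factor_def)
qed

text \<open>Congruence with this matrix changes only row and column \<open>i\<close>; the matrix is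
  unimodular as soon as \<open>u i\<close> is a nonzero constant.\<close>

definition elem_col :: "nat \<Rightarrow> nat \<Rightarrow> (nat \<Rightarrow> complex poly) \<Rightarrow> complex poly mat" where
  "elem_col m i u = mat m m (\<lambda>(r, c). if c = i then u r else if r = c then 1 else 0)"

lemma elem_col_carrier [simp]: "elem_col m i u \<in> carrier_mat m m"
  by (simp add: elem_col_def)

lemma elem_col_dims [simp]: "dim_row (elem_col m i u) = m" "dim_col (elem_col m i u) = m"
  by (simp_all add: elem_col_def)

lemma mat_diag_dims [simp]: "dim_row (mat_diag m f) = m" "dim_col (mat_diag m f) = m"
  by (simp_all add: mat_diag_def)

lemma det_elem_col: assumes "i < m" shows "Determinant.det (elem_col m i u) = u i"
proof -
  \<comment> \<open>The replaced column is the identity applied to \<open>u\<close>, which is the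
    situation of Cramer's rule.\<close>
  have "elem_col m i u = replace_col (1\<^sub>m m) (1\<^sub>m m *\<^sub>v vec m u) i"
    by (rule eq_matI) (auto simp: elem_col_def replace_col_def)
  then show ?thesis using cramer_lemma_mat[OF one_carrier_mat, of "vec m u" m i] assms by simp
qed

section \<open>Spectral factorization\<close>

text \<open>One-sided continuity recovers the value at an excluded point; a reflection reduces
  limits from the left to this case.\<close>

lemma nonneg_poly_at_right:
  assumes "\<And>x. x > x0 \<Longrightarrow> Im (poly q (of_real x)) = 0 \<and> 0 \<le> Re (poly q (of_real x))"
  shows "Im (poly q (of_real x0)) = 0 \<and> 0 \<le> Re (poly q (of_real x0))"
proof -
  have c: "((\<lambda>x::real. poly q (of_real x)) \<longlongrightarrow> poly q (of_real x0)) (at_right x0)"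
    by (intro tendsto_intros)
  have e: "eventually (\<lambda>x. Im (poly q (of_real x)) = 0 \<and> 0 \<le> Re (poly q (of_real x))) (at_right x0)"
    using assms by (auto simp: eventually_at_right_field intro: exI[of _ "x0 + 1"])
  have "((\<lambda>x::real. Im (poly q (of_real x))) \<longlongrightarrow> 0) (at_right x0)"
    by (rule tendsto_eventually) (use e in eventually_elim, auto)
  then have "Im (poly q (of_real x0)) = 0"
    using tendsto_unique[OF _ tendsto_Im[OF c]] by simp
  moreover have "0 \<le> Re (poly q (of_real x0))"
    by (rule tendsto_lowerbound[OF tendsto_Re[OF c]]) (use e in \<open>auto elim: eventually_mono\<close>)
  ultimately show ?thesis by simp
qed

text \<open>After one factor \<open>x - x0\<close> is removed, the quotient is nonnegative to the
  right of \<open>x0\<close> and nonpositive to the left, so it vanishes at \<open>x0\<close> as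
  well.\<close>

lemma nonneg_poly_double_root:
  assumes q: "nonneg_poly q" and r: "poly q (of_real x0) = 0"
  shows "[:- of_real x0, 1:] * [:- of_real x0, 1:] dvd q"
proof -
  obtain s where s: "q = [:- of_real x0, 1:] * s" using r poly_eq_0_iff_dvd by (metis dvdE)
  have v: "poly q (of_real x) = of_real (x - x0) * poly s (of_real x)" for x by (simp add: s algebra_simps)
  have sg: "(x - x0) * Im (poly s (of_real x)) = 0 \<and> 0 \<le> (x - x0) * Re (poly s (of_real x))" for x
    using q unfolding nonneg_poly_def v by simp
  have "Im (poly s (of_real x0)) = 0 \<and> 0 \<le> Re (poly s (of_real x0))"
  proof (rule nonneg_poly_at_right)
    fix x assume "x0 < x"
    then show "Im (poly s (of_real x)) = 0 \<and> 0 \<le> Re (poly s (of_real x))"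
      using sg[of x] by (simp add: zero_le_mult_iff)
  qed
  \<comment> \<open>The negative of \<open>s\<close> reflected at \<open>x0\<close>: the sign of
    \<open>s\<close> to the left becomes a sign of \<open>s'\<close> to the right.\<close>
  moreover define s' where "s' = pcompose (- s) [:2 * of_real x0, -1:]"
  have s': "poly s' (of_real x) = - poly s (of_real (2 * x0 - x))" for x
    by (simp add: s'_def poly_pcompose algebra_simps)
  have "Im (poly s' (of_real x0)) = 0 \<and> 0 \<le> Re (poly s' (of_real x0))"
  proof (rule nonneg_poly_at_right)
    fix x assume "x0 < x"
    then show "Im (poly s' (of_real x)) = 0 \<and> 0 \<le> Re (poly s' (of_real x))"
      using sg[of "2 * x0 - x"] unfolding s' by (simp add: zero_le_mult_iff)
  qed
  ultimately have "poly s (of_real x0) = 0" unfolding s' by (auto simp: complex_eq_iff)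
  then show ?thesis unfolding s using poly_eq_0_iff_dvd by (metis dvd_refl mult_dvd_mono)
qed

text \<open>On the real line the removed factor is the squared distance to \<open>\<mu>\<close>. If
  \<open>\<mu>\<close> is real, the value at \<open>\<mu>\<close> itself comes from a limit.\<close>

lemma nonneg_poly_cancel:
  assumes "nonneg_poly (cnjp [:-\<mu>, 1:] * [:-\<mu>, 1:] * q)"
  shows "nonneg_poly q"
proof -
  have pos: "Im (poly q (of_real x)) = 0 \<and> 0 \<le> Re (poly q (of_real x))" if "of_real x \<noteq> \<mu>" for x
  proof -
    have "poly (cnjp [:-\<mu>, 1:] * [:-\<mu>, 1:] * q) (of_real x) =
        of_real ((cmod (of_real x - \<mu>))\<^sup>2) * poly q (of_real x)"
      unfolding complex_norm_square by (simp add: poly_cnjp algebra_simps)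
    moreover have "(cmod (of_real x - \<mu>))\<^sup>2 > 0" using that by simp
    ultimately obtain \<rho> where \<rho>: "poly (cnjp [:-\<mu>, 1:] * [:-\<mu>, 1:] * q) (of_real x) = of_real \<rho> * poly q (of_real x)"
      "\<rho> > 0" by blast
    have "Im (of_real \<rho> * poly q (of_real x)) = 0 \<and> 0 \<le> Re (of_real \<rho> * poly q (of_real x))"
      using assms unfolding nonneg_poly_def by (metis \<rho>(1))
    then show ?thesis using \<rho>(2) by (auto simp: zero_le_mult_iff)
  qed
  show ?thesis unfolding nonneg_poly_def
  proof
    fix x :: real
    show "Im (poly q (of_real x)) = 0 \<and> 0 \<le> Re (poly q (of_real x))"
    proof (cases "of_real x = \<mu>")
      case True
      then show ?thesis by (metis nonneg_poly_at_right of_real_eq_iff order_less_irrefl pos)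
    qed (use pos in blast)
  qed
qed

section \<open>Extraction of linear factors from a positive semidefinite matrix\<close>

lemma qform_index:
  assumes \<Phi>: "\<Phi> \<in> carrier_mat m m"
  shows "(cadj (mat m 1 (\<lambda>(r, _). f r)) * \<Phi> * mat m 1 (\<lambda>(r, _). f r)) $$ (0, 0) =
    (\<Sum>r<m. \<Sum>c<m. cnjp (f r) * \<Phi> $$ (r, c) * f c)"
proof -
  have "(cadj (mat m 1 (\<lambda>(r, _). f r)) * \<Phi> * mat m 1 (\<lambda>(r, _). f r)) $$ (0, 0) =
    (\<Sum>c<m. (\<Sum>r<m. cnjp (f r) * \<Phi> $$ (r, c)) * f c)"
    using \<Phi> by (simp add: scalar_prod_def cadj_index atLeast0LessThan)
  also have "\<dots> = (\<Sum>r<m. \<Sum>c<m. cnjp (f r) * \<Phi> $$ (r, c) * f c)"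
    by (subst sum.swap) (simp add: sum_distrib_right)
  finally show ?thesis .
qed

lemma psd_qform:
  assumes "psd_poly_mat m \<Phi>"
  shows "nonneg_poly (\<Sum>r<m. \<Sum>c<m. cnjp (f r) * \<Phi> $$ (r, c) * f c)"
proof -
  have "nonneg_poly ((cadj (mat m 1 (\<lambda>(r, _). f r)) * \<Phi> * mat m 1 (\<lambda>(r, _). f r)) $$ (0, 0))"
    using assms mat_carrier[of m 1 "\<lambda>(r, _). f r"] unfolding psd_poly_mat_def by blast
  then show ?thesis using qform_index[of \<Phi> m f] assms unfolding psd_poly_mat_def by simp
qed

lemma psd_diag:
  assumes "psd_poly_mat m \<Phi>" "i < m"
  shows "nonneg_poly (\<Phi> $$ (i, i))"
proof -
  have "(\<Sum>r<m. \<Sum>c<m. cnjp (if r = i then 1 else 0) * \<Phi> $$ (r, c) * (if c = i then 1 else 0)) =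
      \<Phi> $$ (i, i)"
    using assms(2) by (simp add: if_distrib[where f = "\<lambda>x. _ * x"] if_distrib[where f = cnjp]
      if_distrib[where f = "\<lambda>x. x * _"] sum.delta cong: if_cong)
  then show ?thesis using psd_qform[OF assms(1), of "\<lambda>r. if r = i then 1 else 0"] by simp
qed

lemma psd_hermitian:
  assumes "psd_poly_mat m \<Phi>" "r < m" "c < m"
  shows "cnjp (\<Phi> $$ (r, c)) = \<Phi> $$ (c, r)"
  using assms cadj_index[of c \<Phi> r] by (auto simp: psd_poly_mat_def)

text \<open>After a constant congruence, a kernel vector of \<open>\<Phi>(\<mu>)\<close> makes row and column \<open>i\<close> divisible by the
  linear factors of \<open>cnj \<mu>\<close> and \<open>\<mu>\<close>; for real \<open>\<mu>\<close> the diagonal entry has a double zero by positivity.\<close>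

lemma extract_root:
  assumes psd: "psd_poly_mat m \<Phi>" and root: "poly (Determinant.det \<Phi>) \<mu> = 0"
  obtains A c \<Phi>1 i where "A \<in> carrier_mat m m" "Determinant.det A = [:c:]" "c \<noteq> 0"
    "psd_poly_mat m \<Phi>1" "i < m"
    "cadj A * \<Phi> * A = cadj (mat_diag m (\<lambda>r. if r = i then [:-\<mu>, 1:] else 1)) * \<Phi>1 *
       mat_diag m (\<lambda>r. if r = i then [:-\<mu>, 1:] else 1)"
proof -
  have \<Phi>: "\<Phi> \<in> carrier_mat m m" using psd by (simp add: psd_poly_mat_def)
  have "Determinant.det (map_mat (\<lambda>p. poly p \<mu>) \<Phi>) = 0"
    using root comm_ring_hom.hom_det[OF poly_hom.comm_ring_hom_axioms] by metis
  then obtain v where v: "v \<in> carrier_vec m" "v \<noteq> 0\<^sub>v m" "map_mat (\<lambda>p. poly p \<mu>) \<Phi> *\<^sub>v v = 0\<^sub>v m"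
    using det_0_iff_vec_prod_zero_field[of "map_mat (\<lambda>p. poly p \<mu>) \<Phi>" m] \<Phi> by auto
  obtain i where i: "i < m" "v $ i \<noteq> 0" using v(1,2) by (metis carrier_vecD eq_vecI index_zero_vec)
  define A where "A = elem_col m i (\<lambda>r. [:v $ r:])"
  have A: "A \<in> carrier_mat m m" and dA: "Determinant.det A = [:v $ i:]"
    using i by (auto simp: A_def det_elem_col)
  define \<Psi> where "\<Psi> = cadj A * \<Phi> * A"
  have psd\<Psi>: "psd_poly_mat m \<Psi>" unfolding \<Psi>_def by (rule psd_congruence[OF psd A])
  have \<Psi>: "\<Psi> \<in> carrier_mat m m" using psd\<Psi> by (simp add: psd_poly_mat_def)
  define l where "l = [:-\<mu>, 1:]"
  have l0: "l \<noteq> 0" by (simp add: l_def)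
  have cl: "cnjp l = [:- cnj \<mu>, 1:]" by (simp add: l_def map_poly_pCons)
  have colA: "poly ((\<Phi> * A) $$ (k, i)) \<mu> = 0" if k: "k < m" for k
  proof -
    have "poly ((\<Phi> * A) $$ (k, i)) \<mu> = (\<Sum>l<m. poly (\<Phi> $$ (k, l)) \<mu> * v $ l)"
      using \<Phi> k i by (simp add: A_def elem_col_def scalar_prod_def poly_sum atLeast0LessThan mult.commute)
    also have "\<dots> = (map_mat (\<lambda>p. poly p \<mu>) \<Phi> *\<^sub>v v) $ k"
      using \<Phi> k v(1) by (simp add: scalar_prod_def atLeast0LessThan)
    finally show ?thesis using v(3) k by simp
  qed
  have zero: "poly (\<Psi> $$ (r, i)) \<mu> = 0" if r: "r < m" for r
  proof -
    have "\<Psi> = cadj A * (\<Phi> * A)" using A \<Phi> by (simp add: \<Psi>_def mat_assoc)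
    then have "\<Psi> $$ (r, i) = (\<Sum>k<m. cadj A $$ (r, k) * (\<Phi> * A) $$ (k, i))"
      using A \<Phi> r i by (simp add: scalar_prod_def atLeast0LessThan)
    then show ?thesis using colA by (simp add: poly_sum)
  qed
  have d1: "l dvd \<Psi> $$ (r, i)" if "r < m" for r
    using zero[OF that] by (simp add: l_def poly_eq_0_iff_dvd)
  have d2: "cnjp l dvd \<Psi> $$ (i, c)" if "c < m" for c
  proof -
    have "poly (\<Psi> $$ (i, c)) (cnj \<mu>) = 0"
      using zero[OF that] psd_hermitian[OF psd\<Psi> that i(1)] poly_cnjp[of "\<Psi> $$ (c, i)" "cnj \<mu>"] by simp
    then show ?thesis by (simp add: cl poly_eq_0_iff_dvd)
  qed
  have d3: "cnjp l * l dvd \<Psi> $$ (i, i)"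
  proof (cases "cnj \<mu> = \<mu>")
    case True
    then obtain x0 where x0: "\<mu> = of_real x0" by (metis Reals_cases Reals_cnj_iff)
    then show ?thesis
      using nonneg_poly_double_root[OF psd_diag[OF psd\<Psi> i(1)], of x0] zero[OF i(1)]
      by (simp add: cl) (simp add: l_def x0)
  next
    \<comment> \<open>For nonreal \<open>\<mu>\<close> the two linear factors are coprime, so their
      product divides the entry.\<close>
    case False
    obtain k where k: "\<Psi> $$ (i, i) = l * k" using d1[OF i(1)] by auto
    have "poly (\<Psi> $$ (i, i)) (cnj \<mu>) = 0" using d2[OF i(1)] by (simp add: cl poly_eq_0_iff_dvd)
    then have "poly k (cnj \<mu>) = 0" using False by (simp add: k l_def)
    then show ?thesis unfolding k by (metis cl dvd_refl mult.commute mult_dvd_mono poly_eq_0_iff_dvd)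
  qed
  define pf where "pf r = (if r = i then l else 1)" for r
  have pf0: "pf r \<noteq> 0" for r using l0 by (simp add: pf_def)
  define F where "F r c = \<Psi> $$ (r, c) div (cnjp (pf r) * pf c)" for r c
  have dv: "cnjp (pf r) * pf c dvd \<Psi> $$ (r, c)" if "r < m" "c < m" for r c
    using d1 d2 d3 that by (auto simp: pf_def)
  have F: "\<Psi> $$ (r, c) = cnjp (pf r) * F r c * pf c" if "r < m" "c < m" for r c
    using dvd_mult_div_cancel[OF dv[OF that]] by (simp add: F_def mult_ac)
  define \<Phi>1 where "\<Phi>1 = mat m m (\<lambda>(r, c). F r c)"
  have \<Phi>1: "\<Phi>1 \<in> carrier_mat m m" by (simp add: \<Phi>1_def)
  let ?T = "mat_diag m pf"
  have T: "?T \<in> carrier_mat m m" by simp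
  have cT: "cadj ?T = mat_diag m (\<lambda>r. cnjp (pf r))"
    by (rule eq_matI) (auto simp: cadj_index mat_diag_def)
  have eq: "\<Psi> = cadj ?T * \<Phi>1 * ?T"
    unfolding cT using \<Psi> \<Phi>1
    by (subst mat_diag_mult_left[OF \<Phi>1], subst mat_diag_mult_right[of _ m])
      (auto simp: \<Phi>1_def F intro!: eq_matI)
  have herm: "cadj \<Phi>1 = \<Phi>1"
  proof (rule eq_matI)
    fix r c assume rc: "r < dim_row \<Phi>1" "c < dim_col \<Phi>1"
    then have rm: "r < m" "c < m" by (auto simp: \<Phi>1_def)
    have "cnjp (pf r) * pf c * cnjp (F c r) = cnjp (pf r) * pf c * F r c"
      using psd_hermitian[OF psd\<Psi> rm(2,1)] F[OF rm] F[OF rm(2,1)]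
      by (simp add: cnjp.hom_mult mult_ac)
    then have "cnjp (F c r) = F r c" using pf0 by simp
    then show "cadj \<Phi>1 $$ (r, c) = \<Phi>1 $$ (r, c)" using rm by (simp add: cadj_index \<Phi>1_def)
  qed (auto simp: \<Phi>1_def)
  have nn: "nonneg_poly ((cadj u * \<Phi>1 * u) $$ (0, 0))" if u: "u \<in> carrier_mat m 1" for u
  proof -
    \<comment> \<open>All entries except the one at \<open>i\<close> are multiplied by
      \<open>l\<close>, so that \<open>?T\<close> maps \<open>u'\<close> to \<open>l\<close> times
      the arbitrary vector \<open>u\<close>. The form of \<open>\<Phi>1\<close> at \<open>u\<close>
      is then the form of \<open>\<Psi>\<close> at \<open>u'\<close> up to a factor that can be
      cancelled.\<close>
    define u' where "u' = mat m 1 (\<lambda>(r, _). (if r = i then 1 else l) * u $$ (r, 0))"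
    have u': "u' \<in> carrier_mat m 1" by (simp add: u'_def)
    have Tu: "?T * u' = l \<cdot>\<^sub>m u"
      using u by (subst mat_diag_mult_left[OF u'], intro eq_matI) (auto simp: u'_def pf_def)
    have cu: "cadj u \<in> carrier_mat 1 m" using u by simp
    have "cadj u' * \<Psi> * u' = cadj (?T * u') * \<Phi>1 * (?T * u')"
      using u' \<Phi>1 T by (simp add: eq cadj_mult mat_assoc del: assoc_mult_mat)
    also have "\<dots> = (cnjp l * l) \<cdot>\<^sub>m (cadj u * \<Phi>1 * u)"
      unfolding Tu cadj_smult using u \<Phi>1 by (simp add: mat_smult_left mat_smult_right mat_smult_smult mult.commute)
    finally have "(cadj u' * \<Psi> * u') $$ (0, 0) = cnjp l * l * (cadj u * \<Phi>1 * u) $$ (0, 0)"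
      using u cu by simp
    moreover have "nonneg_poly ((cadj u' * \<Psi> * u') $$ (0, 0))"
      using psd\<Psi> u' by (auto simp: psd_poly_mat_def)
    ultimately have "nonneg_poly (cnjp l * l * (cadj u * \<Phi>1 * u) $$ (0, 0))" by (simp only:)
    then show ?thesis unfolding l_def by (rule nonneg_poly_cancel)
  qed
  have "psd_poly_mat m \<Phi>1" using \<Phi>1 herm nn by (auto simp: psd_poly_mat_def)
  moreover have "cadj A * \<Phi> * A = cadj (mat_diag m (\<lambda>r. if r = i then [:-\<mu>, 1:] else 1)) * \<Phi>1 *
       mat_diag m (\<lambda>r. if r = i then [:-\<mu>, 1:] else 1)"
    using eq unfolding \<Psi>_def pf_def[abs_def] l_def .
  ultimately show ?thesis using that[OF A dA i(2) _ i(1)] by blast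
qed

lemma det_mat_diag_single:
  assumes "i < m"
  shows "Determinant.det (mat_diag m (\<lambda>r. if r = i then l else (1 :: complex poly))) = l"
proof -
  have "mat_diag m (\<lambda>r. if r = i then l else 1) = elem_col m i (\<lambda>r. if r = i then l else 0)"
    by (rule eq_matI) (auto simp: mat_diag_def elem_col_def)
  then show ?thesis using det_elem_col[OF assms] by simp
qed

text \<open>Induction on the degree of the determinant: splitting off a linear factor together with
  its conjugate lowers it by two, which leaves constant determinants as the base.\<close>

lemma spectral_factor_reduction:
  assumes base: "\<And>\<Phi>. psd_poly_mat m \<Phi> \<Longrightarrow> Determinant.det \<Phi> \<noteq> 0 \<Longrightarrow> degree (Determinant.det \<Phi>) = 0
      \<Longrightarrow> \<exists>H. spectral_factor m \<Omega> \<Phi> H"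
    and \<Omega>: "\<And>z. \<not> (z \<in> \<Omega> \<and> cnj z \<in> \<Omega>)"
    and psd: "psd_poly_mat m \<Phi>" and det: "Determinant.det \<Phi> \<noteq> 0"
  shows "\<exists>H. spectral_factor m \<Omega> \<Phi> H"
  using psd det
proof (induction "degree (Determinant.det \<Phi>)" arbitrary: \<Phi> rule: less_induct)
  case less
  have \<Phi>: "\<Phi> \<in> carrier_mat m m" "cadj \<Phi> = \<Phi>" using less.prems by (auto simp: psd_poly_mat_def)
  show ?case
  proof (cases "degree (Determinant.det \<Phi>) = 0")
    case True
    then show ?thesis using base less.prems by blast
  next
    case False
    then obtain \<mu>0 where \<mu>0: "poly (Determinant.det \<Phi>) \<mu>0 = 0"
      using fundamental_theorem_of_algebra[of "Determinant.det \<Phi>"] by (auto simp: constant_degree)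
    have "poly (Determinant.det \<Phi>) (cnj \<mu>0) = 0"
      using poly_cnjp[of "Determinant.det \<Phi>" "cnj \<mu>0"] \<mu>0 det_cadj[OF \<Phi>(1)] unfolding \<Phi>(2) by simp
    \<comment> \<open>The roots come in conjugate pairs, and extracting \<open>\<mu>\<close> gives
      \<open>det (cadj T)\<close> the root \<open>cnj \<mu>\<close>. Hence \<open>\<mu>\<close> is
      the member of the pair whose conjugate avoids \<open>\<Omega>\<close>.\<close>
    then obtain \<mu> where \<mu>: "poly (Determinant.det \<Phi>) \<mu> = 0" "cnj \<mu> \<notin> \<Omega>"
      using \<mu>0 \<Omega>[of \<mu>0] by (metis complex_cnj_cnj)
    obtain A c \<Phi>1 i where A: "A \<in> carrier_mat m m" "Determinant.det A = [:c:]" "c \<noteq> 0"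
      and \<Phi>1: "psd_poly_mat m \<Phi>1" and i: "i < m"
      and eq: "cadj A * \<Phi> * A = cadj (mat_diag m (\<lambda>r. if r = i then [:-\<mu>, 1:] else 1)) * \<Phi>1 *
       mat_diag m (\<lambda>r. if r = i then [:-\<mu>, 1:] else 1)"
      using extract_root[OF less.prems(1) \<mu>(1)] by metis
    define T where "T = mat_diag m (\<lambda>r. if r = i then [:-\<mu>, 1:] else 1)"
    have T: "T \<in> carrier_mat m m" "Determinant.det T = [:-\<mu>, 1:]"
      using i by (auto simp: T_def det_mat_diag_single)
    have \<Phi>1c: "\<Phi>1 \<in> carrier_mat m m" using \<Phi>1 by (simp add: psd_poly_mat_def)
    have dT: "Determinant.det (cadj T) = [:- cnj \<mu>, 1:]" using T by (simp add: det_cadj map_poly_pCons)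
    have "Determinant.det (cadj A * \<Phi> * A) = cnjp [:c:] * Determinant.det \<Phi> * [:c:]"
      using A \<Phi> det_mult[of "cadj A * \<Phi>" m A] det_mult[of "cadj A" m \<Phi>] by (simp add: det_cadj)
    moreover have "Determinant.det (cadj A * \<Phi> * A) = [:- cnj \<mu>, 1:] * Determinant.det \<Phi>1 * [:-\<mu>, 1:]"
      unfolding eq T_def[symmetric]
      using T \<Phi>1c det_mult[of "cadj T * \<Phi>1" m T] det_mult[of "cadj T" m \<Phi>1] dT by simp
    ultimately have de: "cnjp [:c:] * Determinant.det \<Phi> * [:c:] =
       [:- cnj \<mu>, 1:] * Determinant.det \<Phi>1 * [:-\<mu>, 1:]" by simp
    have d1: "Determinant.det \<Phi>1 \<noteq> 0" using de less.prems(2) A(3) by auto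
    have "degree (cnjp [:c:] * Determinant.det \<Phi> * [:c:]) = degree (Determinant.det \<Phi>)"
      using A(3) less.prems(2) by (simp add: map_poly_pCons)
    moreover have "degree ([:- cnj \<mu>, 1:] * Determinant.det \<Phi>1 * [:-\<mu>, 1:]) = degree (Determinant.det \<Phi>1) + 2"
      using d1 by (simp add: degree_mult_eq del: mult_pCons_left mult_pCons_right)
    ultimately have "degree (Determinant.det \<Phi>1) < degree (Determinant.det \<Phi>)" unfolding de by linarith
    then obtain H where H: "spectral_factor m \<Omega> \<Phi>1 H" using less.hyps \<Phi>1 d1 by blast
    have Hc: "H \<in> carrier_mat m m" and H1: "\<Phi>1 = cadj H * H" and
      Hz: "\<And>z. z \<in> \<Omega> \<Longrightarrow> poly (Determinant.det (cadj H)) z \<noteq> 0"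
      using H by (auto simp: spectral_factor_def)
    have "cadj A * \<Phi> * A = cadj (H * T) * (H * T)"
      unfolding eq T_def[symmetric] H1 using Hc T(1)
      by (simp add: cadj_mult mat_assoc del: assoc_mult_mat)
    moreover have "poly (Determinant.det (cadj (H * T))) z \<noteq> 0" if "z \<in> \<Omega>" for z
      using Hz[OF that] \<mu>(2) that Hc T(1) det_mult[of "cadj T" m "cadj H"] dT
      by (auto simp: cadj_mult)
    ultimately have "spectral_factor m \<Omega> (cadj A * \<Phi> * A) (H * T)"
      using Hc T by (auto simp: spectral_factor_def)
    then show ?thesis by (rule spectral_factor_congruence[OF \<Phi>(1) A])
  qed
qed

section \<open>Leading coefficients and degrees of the entries\<close>

lemma nonneg_real_poly_lead:
  fixes r :: "real poly"
  assumes "\<And>x. 0 \<le> poly r x" "r \<noteq> 0"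
  shows "0 < lead_coeff r"
proof (rule ccontr)
  assume "\<not> 0 < lead_coeff r"
  then have l: "0 < lead_coeff (- r)" using assms(2) by (simp add: less_le)
  then obtain n where "\<And>x. x \<ge> n \<Longrightarrow> lead_coeff (- r) \<le> poly (- r) x"
    using poly_pinfty_gt_lc by blast
  then have "lead_coeff (- r) \<le> poly (- r) n" by blast
  then show False using l assms(1)[of n] by simp
qed

text \<open>A polynomial with real values on the real line has real coefficients. Growth at plus
  infinity gives the sign of the leading coefficient; the same argument after replacing
  \<open>x\<close> by \<open>-x\<close> gives the parity of the degree.\<close>

lemma nonneg_poly_lead:
  assumes q: "nonneg_poly q" and q0: "q \<noteq> 0"
  shows "even (degree q)" "Im (lead_coeff q) = 0" "0 < Re (lead_coeff q)"
proof -
  have pr: "poly (map_poly Re q) x = Re (poly q (of_real x))" for x q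
    by (induction q) (auto simp: map_poly_pCons)
  have pi: "poly (map_poly Im q) x = Im (poly q (of_real x))" for x q
    by (induction q) (auto simp: map_poly_pCons)
  have "map_poly Im q = 0" using q pi by (auto simp: nonneg_poly_def poly_all_0_iff_0[symmetric])
  then have im: "Im (coeff q k) = 0" for k by (metis coeff_0 coeff_map_poly zero_complex.sel(2))
  then show "Im (lead_coeff q) = 0" by blast
  define r where "r = map_poly Re q"
  have dr: "degree r = degree q" unfolding r_def
    by (rule map_poly_degree_eq) (metis complex_eq_iff im leading_coeff_0_iff q0 zero_complex.sel)
  have lr: "lead_coeff r = Re (lead_coeff q)" unfolding dr by (simp add: r_def coeff_map_poly)
  have r0: "r \<noteq> 0" using dr lr im[of "degree q"] q0 by (metis complex_eq_iff leading_coeff_0_iff zero_complex.sel)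
  have nn: "0 \<le> poly r x" for x using q by (auto simp: r_def pr nonneg_poly_def)
  have l: "0 < lead_coeff r" by (rule nonneg_real_poly_lead[OF nn r0])
  then show "0 < Re (lead_coeff q)" by (simp add: lr)
  have "0 < lead_coeff (r \<circ>\<^sub>p [:0, -1:])"
    by (rule nonneg_real_poly_lead) (use nn r0 in \<open>auto simp: poly_pcompose pcompose_eq_0_iff\<close>)
  also have "lead_coeff (r \<circ>\<^sub>p [:0, -1:]) = lead_coeff r * (-1) ^ degree r"
    by (subst lead_coeff_comp) auto
  finally show "even (degree q)" using l dr by (cases "even (degree q)") auto
qed

lemma psd_qform2:
  assumes psd: "psd_poly_mat m \<Phi>" and ij: "i < m" "j < m" "i \<noteq> j"
  shows "nonneg_poly (cnjp \<alpha> * \<Phi> $$ (i, i) * \<alpha> + cnjp \<alpha> * \<Phi> $$ (i, j) * \<beta> +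
     cnjp \<beta> * cnjp (\<Phi> $$ (i, j)) * \<alpha> + cnjp \<beta> * \<Phi> $$ (j, j) * \<beta>)"
proof -
  define f where "f r = (if r = i then \<alpha> else if r = j then \<beta> else 0)" for r
  have s: "(\<Sum>c<m. g c) = g i + g j" if "\<And>c. c \<noteq> i \<Longrightarrow> c \<noteq> j \<Longrightarrow> g c = 0" for g :: "nat \<Rightarrow> complex poly"
    using sum.mono_neutral_right[of "{..<m}" "{i, j}" g] that ij by auto
  have "(\<Sum>r<m. \<Sum>c<m. cnjp (f r) * \<Phi> $$ (r, c) * f c) =
      cnjp \<alpha> * \<Phi> $$ (i, i) * \<alpha> + cnjp \<alpha> * \<Phi> $$ (i, j) * \<beta> +
     (cnjp \<beta> * \<Phi> $$ (j, i) * \<alpha> + cnjp \<beta> * \<Phi> $$ (j, j) * \<beta>)"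
    using ij by (simp add: s f_def)
  then show ?thesis using psd_qform[OF psd, of f] psd_hermitian[OF psd ij(1,2)] by (simp add: add_ac)
qed

lemma lead_coeff_mult_cnjp: "lead_coeff (b * cnjp b) = of_real ((cmod (lead_coeff b))\<^sup>2)"
  by (simp only: lead_coeff_mult degree_cnjp coeff_cnjp complex_norm_square)

text \<open>For nonzero \<open>b\<close> the negated product would have a negative leading
  coefficient.\<close>

lemma nonneg_poly_not_neg:
  assumes c: "nonneg_poly c" and n: "nonneg_poly (- (c * (b * cnjp b)))" and c0: "c \<noteq> 0"
  shows "b = 0"
proof (rule ccontr)
  assume b: "b \<noteq> 0"
  have "lead_coeff (- (c * (b * cnjp b))) = - (lead_coeff c * of_real ((cmod (lead_coeff b))\<^sup>2))"
    using lead_coeff_mult_cnjp[of b] by (simp only: lead_coeff_minus lead_coeff_mult[of c])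
  then have "Re (lead_coeff (- (c * (b * cnjp b)))) = - (Re (lead_coeff c) * (cmod (lead_coeff b))\<^sup>2)"
    by simp
  moreover have "Re (lead_coeff (- (c * (b * cnjp b)))) > 0"
    by (rule nonneg_poly_lead(3)[OF n]) (use b c0 in auto)
  moreover have "Re (lead_coeff c) * (cmod (lead_coeff b))\<^sup>2 > 0"
    using nonneg_poly_lead(3)[OF c c0] b by simp
  ultimately show False by linarith
qed

lemma psd_diag_cnjp:
  assumes "psd_poly_mat m \<Phi>" "i < m" shows "cnjp (\<Phi> $$ (i, i)) = \<Phi> $$ (i, i)"
  using psd_hermitian[OF assms(1,2,2)] .

text \<open>The value of the form at the vector with entries \<open>\<Phi> $$ (j, j)\<close> and
  \<open>- cnjp (\<Phi> $$ (i, j))\<close>, the usual completion of the square cleared of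
  denominators.\<close>

lemma psd_minor:
  assumes psd: "psd_poly_mat m \<Phi>" and ij: "i < m" "j < m" "i \<noteq> j"
  shows "nonneg_poly (\<Phi> $$ (j, j) * (\<Phi> $$ (i, i) * \<Phi> $$ (j, j) - \<Phi> $$ (i, j) * cnjp (\<Phi> $$ (i, j))))"
  using psd_qform2[OF psd ij, of "\<Phi> $$ (j, j)" "- cnjp (\<Phi> $$ (i, j))"] psd_diag_cnjp[OF psd ij(2)]
  by (simp add: algebra_simps cnjp.hom_uminus)

text \<open>With \<open>b\<close> the off-diagonal entry: if the other diagonal entry vanishes too,
  a test vector gives \<open>-2 b cnjp b\<close>; otherwise the two-by-two minor is
  \<open>- b cnjp b\<close>. Both force \<open>b = 0\<close>.\<close>

lemma psd_diag_zero:
  assumes psd: "psd_poly_mat m \<Phi>" and ij: "i < m" "j < m" and z: "\<Phi> $$ (i, i) = 0"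
  shows "\<Phi> $$ (i, j) = 0"
proof (cases "i = j")
  case False
  show ?thesis
  proof (cases "\<Phi> $$ (j, j) = 0")
    case True
    have "nonneg_poly (- (2 * (\<Phi> $$ (i, j) * cnjp (\<Phi> $$ (i, j)))))"
      using psd_qform2[OF psd ij False, of 1 "- cnjp (\<Phi> $$ (i, j))"] True z
      by (simp add: cnjp.hom_uminus algebra_simps)
    then have "nonneg_poly (- ([:2:] * (\<Phi> $$ (i, j) * cnjp (\<Phi> $$ (i, j)))))"
      by (simp only: numeral_poly)
    moreover have "nonneg_poly [:2:]" by (simp add: nonneg_poly_def)
    ultimately show ?thesis by (intro nonneg_poly_not_neg[of "[:2:]"]) auto
  next
    case nz: False
    show ?thesis using psd_minor[OF psd ij False] z
      by (intro nonneg_poly_not_neg[OF psd_diag[OF psd ij(2)] _ nz]) simp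
  qed
qed (use z in simp)

text \<open>If the off-diagonal entry had larger degree, it would supply the leading term of the
  two-by-two minor, with a negative coefficient.\<close>

lemma psd_offdiag_degree:
  assumes psd: "psd_poly_mat m \<Phi>" and ij: "i < m" "j < m"
    and nz: "\<Phi> $$ (i, i) \<noteq> 0" "\<Phi> $$ (j, j) \<noteq> 0"
  shows "2 * degree (\<Phi> $$ (i, j)) \<le> degree (\<Phi> $$ (i, i)) + degree (\<Phi> $$ (j, j))"
proof (cases "i = j")
  case False
  define a b c where "a = \<Phi> $$ (i, i)" "b = \<Phi> $$ (i, j)" "c = \<Phi> $$ (j, j)"
  show ?thesis
  proof (rule ccontr)
    assume "\<not> ?thesis"
    then have dg: "degree a + degree c < 2 * degree b" by (simp add: a_b_c_def)
    then have b0: "b \<noteq> 0" by auto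
    have ac0: "a \<noteq> 0" "c \<noteq> 0" using nz by (auto simp: a_b_c_def)
    have dlt: "degree (a * c) < degree (- (b * cnjp b))"
      using dg b0 ac0 by (simp add: degree_mult_eq)
    have "nonneg_poly (c * (a * c - b * cnjp b))" using psd_minor[OF psd ij False] by (simp add: a_b_c_def)
    moreover have l: "lead_coeff (a * c - b * cnjp b) = - of_real ((cmod (lead_coeff b))\<^sup>2)"
      using lead_coeff_add_le[OF dlt] lead_coeff_mult_cnjp[of b] by (simp only: lead_coeff_minus diff_conv_add_uminus)
    moreover have "lead_coeff (a * c - b * cnjp b) \<noteq> 0" unfolding l using b0 by simp
    then have "c * (a * c - b * cnjp b) \<noteq> 0" using ac0 by (metis leading_coeff_0_iff mult_eq_0_iff)
    ultimately have "0 < Re (lead_coeff c * (- of_real ((cmod (lead_coeff b))\<^sup>2)))"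
      using nonneg_poly_lead(3) by (metis lead_coeff_mult)
    moreover have "0 < Re (lead_coeff c) * (cmod (lead_coeff b))\<^sup>2"
      using nonneg_poly_lead(3)[OF psd_diag[OF psd ij(2)]] ac0 b0 by (simp add: a_b_c_def)
    ultimately show False by simp
  qed
qed simp

text \<open>A zero on the diagonal annihilates its whole column, and the determinant with
  it.\<close>

lemma psd_diag_nonzero:
  assumes psd: "psd_poly_mat m \<Phi>" and det: "Determinant.det \<Phi> \<noteq> 0" and i: "i < m"
  shows "\<Phi> $$ (i, i) \<noteq> 0"
proof
  assume z: "\<Phi> $$ (i, i) = 0"
  have \<Phi>: "\<Phi> \<in> carrier_mat m m" using psd by (simp add: psd_poly_mat_def)
  have "\<Phi> $$ (j, i) = 0" if "j < m" for j
    using psd_diag_zero[OF psd i that z] psd_hermitian[OF psd i that] by simp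
  then have "\<Phi> *\<^sub>v unit_vec m i = 0\<^sub>v m" using \<Phi> i by (intro eq_vecI) (auto simp: scalar_prod_right_unit)
  moreover have "unit_vec m i \<noteq> (0\<^sub>v m :: complex poly Matrix.vec)"
    using i by (metis index_unit_vec(1) index_zero_vec(1) zero_neq_one)
  ultimately have "Determinant.det \<Phi> = 0" using det_0_iff_vec_prod_zero[OF \<Phi>] unit_vec_carrier by metis
  then show False using det by simp
qed

section \<open>The matrix of leading coefficients and the reduction of degrees\<close>

lemma coeff_mult_bound:
  assumes "degree p \<le> a" "degree q \<le> b"
  shows "coeff (p * q) (a + b) = coeff p a * coeff q b"
proof -
  have "coeff (p * q) (a + b) = (\<Sum>i\<le>a + b. coeff p i * coeff q (a + b - i))" by (simp add: coeff_mult)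
  also have "\<dots> = (\<Sum>i\<in>{a}. coeff p i * coeff q (a + b - i))"
  proof (rule sum.mono_neutral_right, simp, simp, rule)
    fix i assume "i \<in> {..a + b} - {a}"
    then have "i > degree p \<or> a + b - i > degree q" using assms by auto
    then show "coeff p i * coeff q (a + b - i) = 0" by (auto simp: coeff_eq_0)
  qed
  finally show ?thesis by simp
qed

lemma coeff_prod_bound:
  fixes g :: "'b \<Rightarrow> 'a :: comm_semiring_1 poly"
  assumes "finite S" "\<And>i. i \<in> S \<Longrightarrow> degree (g i) \<le> b i"
  shows "degree (prod g S) \<le> sum b S \<and> coeff (prod g S) (sum b S) = (\<Prod>i\<in>S. coeff (g i) (b i))"
  using assms
proof (induction S rule: finite_induct)
  case (insert x S)
  have "degree (g x * prod g S) \<le> b x + sum b S"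
    using insert by (meson add_mono degree_mult_le dual_order.trans insertCI)
  then show ?case using insert coeff_mult_bound[of "g x" "b x" "prod g S" "sum b S"] by simp
qed simp

text \<open>Each permutation runs once through all rows and once through all columns, so every
  Leibniz product has the same degree bound, twice the sum of the weights. The coefficients at that
  degree assemble to the determinant of the leading coefficients.\<close>

lemma coeff_det_bound:
  fixes A :: "complex poly mat"
  assumes A: "A \<in> carrier_mat m m"
    and dg: "\<And>i j. i < m \<Longrightarrow> j < m \<Longrightarrow> degree (A $$ (i, j)) \<le> e i + e j"
  shows "coeff (Determinant.det A) (2 * (\<Sum>i<m. e i)) =
    Determinant.det (mat m m (\<lambda>(i, j). coeff (A $$ (i, j)) (e i + e j)))"
proof -
  let ?P = "{p. p permutes {0..<m}}"
  have "coeff (signof p * (\<Prod>i = 0..<m. A $$ (i, p i))) (2 * (\<Sum>i<m. e i)) =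
     signof p * (\<Prod>i = 0..<m. coeff (A $$ (i, p i)) (e i + e (p i)))" if p: "p \<in> ?P" for p
  proof -
    have pm: "p i < m" if "i < m" for i using p permutes_in_image[of p "{0..<m}" i] that by auto
    have s: "2 * (\<Sum>i<m. e i) = (\<Sum>i = 0..<m. e i + e (p i))"
      using p sum.permute[of p "{0..<m}" e] by (simp add: sum.distrib atLeast0LessThan mult_2 comp_def)
    have "coeff (\<Prod>i = 0..<m. A $$ (i, p i)) (\<Sum>i = 0..<m. e i + e (p i)) =
        (\<Prod>i = 0..<m. coeff (A $$ (i, p i)) (e i + e (p i)))"
      using coeff_prod_bound[of "{0..<m}" "\<lambda>i. A $$ (i, p i)" "\<lambda>i. e i + e (p i)"] dg pm by auto
    then show ?thesis unfolding s by (cases rule: sign_cases[of p]) auto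
  qed
  then have "coeff (Determinant.det A) (2 * (\<Sum>i<m. e i)) =
     (\<Sum>p\<in>?P. signof p * (\<Prod>i = 0..<m. coeff (A $$ (i, p i)) (e i + e (p i))))"
    unfolding det_def'[OF A] coeff_sum by (intro sum.cong) auto
  also have "\<dots> = Determinant.det (mat m m (\<lambda>(i, j). coeff (A $$ (i, j)) (e i + e j)))"
    unfolding det_def'[OF mat_carrier]
  proof (intro sum.cong refl arg_cong[where f = "(*) _"] prod.cong)
    fix p i assume "p \<in> ?P" "i \<in> {0..<m}"
    then show "coeff (A $$ (i, p i)) (e i + e (p i)) =
        mat m m (\<lambda>(i, j). coeff (A $$ (i, j)) (e i + e j)) $$ (i, p i)"
      using permutes_in_image[of p "{0..<m}" i] by auto
  qed
  finally show ?thesis .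
qed

lemma congruence_elem_col_diag:
  assumes \<Phi>: "\<Phi> \<in> carrier_mat m m" and i: "i < m" and k: "k < m"
  shows "(cadj (elem_col m i u) * \<Phi> * elem_col m i u) $$ (k, k) =
    (if k = i then \<Sum>r<m. \<Sum>c<m. cnjp (u r) * \<Phi> $$ (r, c) * u c else \<Phi> $$ (k, k))"
proof -
  let ?A = "elem_col m i u"
  define f where "f r = ?A $$ (r, k)" for r
  have "(cadj ?A * \<Phi> * ?A) $$ (k, k) = (\<Sum>c<m. (\<Sum>r<m. cnjp (f r) * \<Phi> $$ (r, c)) * f c)"
    using \<Phi> k by (simp add: scalar_prod_def cadj_index atLeast0LessThan f_def carrier_matD[OF elem_col_carrier])
  also have "\<dots> = (\<Sum>r<m. \<Sum>c<m. cnjp (f r) * \<Phi> $$ (r, c) * f c)"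
    by (subst sum.swap) (simp add: sum_distrib_right)
  finally have 1: "(cadj ?A * \<Phi> * ?A) $$ (k, k) = (\<Sum>r<m. \<Sum>c<m. cnjp (f r) * \<Phi> $$ (r, c) * f c)" .
  show ?thesis
  proof (cases "k = i")
    case True
    then have "f r = u r" if "r < m" for r using that k by (simp add: f_def elem_col_def)
    then show ?thesis using True 1 by (simp cong: sum.cong_simp)
  next
    case False
    then have "f r = (if r = k then 1 else 0)" if "r < m" for r
      using that k by (simp add: f_def elem_col_def)
    then have "(cadj ?A * \<Phi> * ?A) $$ (k, k) = (\<Sum>r<m. \<Sum>c<m. cnjp (if r = k then 1 else 0) * \<Phi> $$ (r, c) * (if c = k then 1 else 0))"
      unfolding 1 by (simp cong: sum.cong_simp)
    also have "\<dots> = \<Phi> $$ (k, k)" using k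
      by (simp add: if_distrib[where f = "\<lambda>x. _ * x"] if_distrib[where f = cnjp]
      if_distrib[where f = "\<lambda>x. x * _"] sum.delta cong: if_cong)
    finally show ?thesis using False by simp
  qed
qed

text \<open>The entries satisfy \<open>deg \<Phi>\<^sub>r\<^sub>c \<le> e\<^sub>r + e\<^sub>c\<close>, where \<open>2e\<^sub>k\<close> is the degree of the \<open>k\<close>-th diagonal entry. The
  matrix of coefficients of degree \<open>e\<^sub>r + e\<^sub>c\<close> is singular because \<open>det \<Phi>\<close> is constant, and a kernel vector
  \<open>v\<close>, with \<open>v\<^sub>k\<close> weighted by the power \<open>e\<^sub>i - e\<^sub>k\<close> of \<open>x\<close>, cancels the leading term of the \<open>i\<close>-th diagonal entry.\<close>

lemma degree_reduction_step:
  assumes psd: "psd_poly_mat m \<Phi>" and det: "Determinant.det \<Phi> = [:d:]" "d \<noteq> 0"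
    and pos: "0 < (\<Sum>k<m. degree (\<Phi> $$ (k, k)))"
  obtains A c where "A \<in> carrier_mat m m" "Determinant.det A = [:c:]" "c \<noteq> 0"
    "(\<Sum>k<m. degree ((cadj A * \<Phi> * A) $$ (k, k))) < (\<Sum>k<m. degree (\<Phi> $$ (k, k)))"
proof -
  have \<Phi>: "\<Phi> \<in> carrier_mat m m" using psd by (simp add: psd_poly_mat_def)
  have det0: "Determinant.det \<Phi> \<noteq> 0" using det by simp
  note nz = psd_diag_nonzero[OF psd det0]
  \<comment> \<open>Diagonal entries have even degree, so the halving is exact.\<close>
  define e where "e k = degree (\<Phi> $$ (k, k)) div 2" for k
  have e: "degree (\<Phi> $$ (k, k)) = 2 * e k" if "k < m" for k
    using nonneg_poly_lead(1)[OF psd_diag[OF psd that] nz[OF that]] by (simp add: e_def)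
  have dg: "degree (\<Phi> $$ (r, c)) \<le> e r + e c" if "r < m" "c < m" for r c
    using psd_offdiag_degree[OF psd that nz[OF that(1)] nz[OF that(2)]] e that by simp
  have pos': "0 < (\<Sum>k<m. e k)" using pos e by (simp add: sum_distrib_left[symmetric])
  define L where "L = mat m m (\<lambda>(r, c). coeff (\<Phi> $$ (r, c)) (e r + e c))"
  have "Determinant.det L = 0"
    using coeff_det_bound[OF \<Phi> dg] pos' unfolding L_def det by (simp add: coeff_pCons split: nat.splits)
  then obtain v where v: "v \<in> carrier_vec m" "v \<noteq> 0\<^sub>v m" "L *\<^sub>v v = 0\<^sub>v m"
    using det_0_iff_vec_prod_zero_field[of L m] by (auto simp: L_def)
  define I where "I = {k. k < m \<and> v $ k \<noteq> 0}"
  have "I \<noteq> {}" unfolding I_def using v(1,2) by (metis (mono_tags, lifting) carrier_vecD empty_Collect_eq eq_vecI index_zero_vec)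
  moreover have fin: "finite I" by (simp add: I_def)
  ultimately have "Max (e ` I) \<in> e ` I" by (intro Max_in) auto
  \<comment> \<open>An index of largest weight on the support of \<open>v\<close> keeps the
    subtractions \<open>e i - e k\<close> in \<open>u\<close> from being truncated.\<close>
  then obtain i where "i \<in> I" "e i = Max (e ` I)" by auto
  then have i: "i \<in> I" "\<And>k. k \<in> I \<Longrightarrow> e k \<le> e i" using fin by auto
  have im: "i < m" "v $ i \<noteq> 0" using i(1) by (auto simp: I_def)
  have ek: "e k \<le> e i" if "k < m" "v $ k \<noteq> 0" for k using i(2) that by (auto simp: I_def)
  define u where "u k = monom (v $ k) (e i - e k)" for k
  define A where "A = elem_col m i u"
  have A: "A \<in> carrier_mat m m" and dA: "Determinant.det A = [:v $ i:]"
    using im by (auto simp: A_def det_elem_col u_def monom_0)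
  define \<Phi>' where "\<Phi>' = cadj A * \<Phi> * A"
  have psd': "psd_poly_mat m \<Phi>'" unfolding \<Phi>'_def by (rule psd_congruence[OF psd A])
  have diag': "\<Phi>' $$ (k, k) = (if k = i then \<Sum>r<m. \<Sum>c<m. cnjp (u r) * \<Phi> $$ (r, c) * u c else \<Phi> $$ (k, k))"
    if "k < m" for k
    unfolding \<Phi>'_def A_def by (rule congruence_elem_col_diag[OF \<Phi> im(1) that])
  have cu: "cnjp (u r) = monom (cnj (v $ r)) (e i - e r)" for r
    by (rule poly_eqI) (auto simp: u_def)
  have trm: "degree (cnjp (u r) * \<Phi> $$ (r, c) * u c) \<le> 2 * e i \<and>
      coeff (cnjp (u r) * \<Phi> $$ (r, c) * u c) (2 * e i) = cnj (v $ r) * L $$ (r, c) * v $ c"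
    if rc: "r < m" "c < m" for r c
  proof (cases "v $ r = 0 \<or> v $ c = 0")
    case True
    then show ?thesis by (auto simp: u_def)
  next
    case False
    then have le: "e r \<le> e i" "e c \<le> e i" using ek rc by auto
    have d1: "degree (cnjp (u r)) \<le> e i - e r" "degree (u c) \<le> e i - e c"
      by (simp_all add: u_def degree_monom_le)
    have d2: "degree (cnjp (u r) * \<Phi> $$ (r, c)) \<le> (e i - e r) + (e r + e c)"
      using d1 dg[OF rc] by (meson add_mono degree_mult_le order_trans)
    have d3: "degree (cnjp (u r) * \<Phi> $$ (r, c) * u c) \<le> (e i - e r) + (e r + e c) + (e i - e c)"
      using d1 d2 by (meson add_mono degree_mult_le order_trans)
    have s: "(e i - e r) + (e r + e c) + (e i - e c) = 2 * e i" using le by simp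
    have "coeff (cnjp (u r) * \<Phi> $$ (r, c) * u c) (2 * e i) =
        coeff (cnjp (u r)) (e i - e r) * coeff (\<Phi> $$ (r, c)) (e r + e c) * coeff (u c) (e i - e c)"
      using coeff_mult_bound[OF d2 d1(2)] coeff_mult_bound[OF d1(1) dg[OF rc]] unfolding s by simp
    also have "\<dots> = cnj (v $ r) * L $$ (r, c) * v $ c" using rc by (simp add: u_def L_def)
    finally show ?thesis using d3 unfolding s by simp
  qed
  define q where "q = \<Phi>' $$ (i, i)"
  have q: "q = (\<Sum>r<m. \<Sum>c<m. cnjp (u r) * \<Phi> $$ (r, c) * u c)" using diag'[OF im(1)] by (simp add: q_def)
  have "degree q \<le> 2 * e i" unfolding q by (intro degree_sum_le) (use trm in auto)
  moreover have "coeff q (2 * e i) = 0"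
  proof -
    have "coeff q (2 * e i) = (\<Sum>r<m. \<Sum>c<m. cnj (v $ r) * L $$ (r, c) * v $ c)"
      unfolding q coeff_sum using trm by (intro sum.cong) auto
    also have "\<dots> = (\<Sum>r<m. cnj (v $ r) * (L *\<^sub>v v) $ r)"
      using v(1) by (intro sum.cong) (auto simp: L_def scalar_prod_def atLeast0LessThan sum_distrib_left mult_ac)
    also have "\<dots> = 0" using v(3) by simp
    finally show ?thesis .
  qed
  \<comment> \<open>A vanishing top coefficient lowers the degree only of a nonzero polynomial.
    Together with the bound this also excludes \<open>e i = 0\<close>.\<close>
  moreover have "q \<noteq> 0"
  proof -
    have "Determinant.det \<Phi>' = cnjp [:v $ i:] * Determinant.det \<Phi> * [:v $ i:]"
      unfolding \<Phi>'_def using A \<Phi> det_mult[of "cadj A * \<Phi>" m A] det_mult[of "cadj A" m \<Phi>] dA by (simp add: det_cadj)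
    then have "Determinant.det \<Phi>' \<noteq> 0" using det0 im by simp
    then show ?thesis using psd_diag_nonzero[OF psd' _ im(1)] by (simp add: q_def)
  qed
  ultimately have "degree q < 2 * e i"
    by (metis le_neq_implies_less leading_coeff_0_iff)
  then have "degree (\<Phi>' $$ (i, i)) < degree (\<Phi> $$ (i, i))" using e im by (simp add: q_def)
  moreover have "degree (\<Phi>' $$ (k, k)) \<le> degree (\<Phi> $$ (k, k))" if "k < m" for k
    using calculation diag'[OF that] by (cases "k = i") auto
  ultimately have "(\<Sum>k<m. degree (\<Phi>' $$ (k, k))) < (\<Sum>k<m. degree (\<Phi> $$ (k, k)))"
    using im by (intro sum_strict_mono_ex1) auto
  then show ?thesis using that[OF A dA im(2)] by (simp add: \<Phi>'_def)
qed

section \<open>Factorization when the determinant is constant\<close>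

lemma degree_0_const: "degree p = 0 \<longleftrightarrow> (\<exists>c. p = [:c:])"
  by (metis degree_0_id degree_pCons_0)

lemma degree_0_add: "degree p = 0 \<Longrightarrow> degree q = 0 \<Longrightarrow> degree (p + q) = 0"
  by (metis degree_add_le le_zero_eq)

lemma degree_0_mult: "degree p = 0 \<Longrightarrow> degree q = 0 \<Longrightarrow> degree (p * q) = 0"
  by (metis add_0 degree_mult_le le_zero_eq)

lemma diagonal_spectral_factor:
  assumes psd: "psd_poly_mat m \<Phi>" and det: "Determinant.det \<Phi> \<noteq> 0"
    and const: "\<And>r c. r < m \<Longrightarrow> c < m \<Longrightarrow> degree (\<Phi> $$ (r, c)) = 0"
    and diag: "\<And>r c. r < m \<Longrightarrow> c < m \<Longrightarrow> r \<noteq> c \<Longrightarrow> \<Phi> $$ (r, c) = 0"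
  shows "\<exists>H. spectral_factor m \<Omega> \<Phi> H"
proof -
  have \<Phi>: "\<Phi> \<in> carrier_mat m m" using psd by (simp add: psd_poly_mat_def)
  define a where "a k = Re (lead_coeff (\<Phi> $$ (k, k)))" for k
  have a: "\<Phi> $$ (k, k) = [:of_real (a k):]" "0 < a k" if k: "k < m" for k
  proof -
    note l = nonneg_poly_lead[OF psd_diag[OF psd k] psd_diag_nonzero[OF psd det k]]
    show "0 < a k" using l by (simp add: a_def)
    have "lead_coeff (\<Phi> $$ (k, k)) = of_real (a k)" using l by (simp add: a_def complex_eq_iff)
    then show "\<Phi> $$ (k, k) = [:of_real (a k):]" using const[OF k k] by (auto simp: degree_0_const)
  qed
  define H where "H = mat_diag m (\<lambda>k. [:complex_of_real (sqrt (a k)):])"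
  have H: "H \<in> carrier_mat m m" by (simp add: H_def)
  have cH: "cadj H = H" by (rule eq_matI) (auto simp: cadj_index H_def mat_diag_def map_poly_pCons)
  have eq: "\<Phi> = cadj H * H"
    unfolding cH unfolding H_def mat_diag_diag
  proof (rule eq_matI)
    fix r c assume "r < dim_row (mat_diag m (\<lambda>k. [:complex_of_real (sqrt (a k)):] * [:complex_of_real (sqrt (a k)):]))"
      "c < dim_col (mat_diag m (\<lambda>k. [:complex_of_real (sqrt (a k)):] * [:complex_of_real (sqrt (a k)):]))"
    then have rc: "r < m" "c < m" by (auto simp: mat_diag_def)
    show "\<Phi> $$ (r, c) = mat_diag m (\<lambda>k. [:complex_of_real (sqrt (a k)):] * [:complex_of_real (sqrt (a k)):]) $$ (r, c)"
      using rc a[OF rc(1)] diag[OF rc] by (auto simp: mat_diag_def simp flip: of_real_mult)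
  qed (use \<Phi> in \<open>auto simp: mat_diag_def\<close>)
  have "Determinant.det (cadj H) * Determinant.det H = Determinant.det \<Phi>"
    unfolding eq using H det_mult[of "cadj H" m H] by simp
  moreover have "degree (Determinant.det (cadj H)) = 0"
    using degree_det_le[of m "cadj H" 0] H by (auto simp: cadj_index H_def mat_diag_def)
  ultimately have "poly (Determinant.det (cadj H)) z \<noteq> 0" for z
    using det by (auto simp: degree_0_const)
  then show ?thesis using H eq by (auto simp: spectral_factor_def)
qed

text \<open>Hermitian Gaussian elimination, where \<open>k\<close> counts the pivots whose rows and
  columns are already cleared. No pivot search is needed: positivity and the nonzero determinant
  keep every diagonal entry nonzero.\<close>

lemma const_spectral_factor:
  assumes "psd_poly_mat m \<Phi>" and "Determinant.det \<Phi> \<noteq> 0"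
    and "\<And>r c. r < m \<Longrightarrow> c < m \<Longrightarrow> degree (\<Phi> $$ (r, c)) = 0"
    and "\<And>r c. r < m \<Longrightarrow> c < m \<Longrightarrow> r \<noteq> c \<Longrightarrow> r < k \<or> c < k \<Longrightarrow> \<Phi> $$ (r, c) = 0"
  shows "\<exists>H. spectral_factor m \<Omega> \<Phi> H"
  using assms
proof (induction "m - k" arbitrary: k \<Phi>)
  case 0
  then show ?case by (intro diagonal_spectral_factor) auto
next
  case (Suc n)
  note psd = Suc.prems(1) and det = Suc.prems(2) and const = Suc.prems(3) and stage = Suc.prems(4)
  have km: "k < m" using Suc.hyps(2) by simp
  have \<Phi>: "\<Phi> \<in> carrier_mat m m" using psd by (simp add: psd_poly_mat_def)
  obtain a where a: "\<Phi> $$ (k, k) = [:a:]" using const[OF km km] by (auto simp: degree_0_const)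
  have a0: "a \<noteq> 0" using psd_diag_nonzero[OF psd det km] a by simp
  \<comment> \<open>These multipliers clear row \<open>k\<close> to the right of the pivot. They
    stand above the diagonal of \<open>A\<close>, which is therefore unit triangular with
    determinant one.\<close>
  define f where "f c = (if c > k then - (\<Phi> $$ (k, c) * [:1 / a:]) else 0)" for c
  define A where "A = mat m m (\<lambda>(r, c). if r = c then 1 else if r = k then f c else 0)"
  have A: "A \<in> carrier_mat m m" by (simp add: A_def)
  have df: "degree (f c) = 0" if "c < m" for c
    using const[OF km that] by (auto simp: f_def degree_0_const)
  have detA: "Determinant.det A = [:1:]"
  proof -
    have "upper_triangular A" unfolding A_def by (auto simp: f_def)
    then have "Determinant.det A = prod_list (diag_mat A)" using A by (rule det_upper_triangular)
    also have "diag_mat A = replicate m 1" by (auto simp: diag_mat_def A_def intro!: nth_equalityI)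
    finally show ?thesis by (metis one_pCons power_one prod_list_replicate)
  qed
  define \<Phi>' where "\<Phi>' = cadj A * \<Phi> * A"
  have psd': "psd_poly_mat m \<Phi>'" unfolding \<Phi>'_def by (rule psd_congruence[OF psd A])
  have \<Phi>': "\<Phi>' \<in> carrier_mat m m" using psd' by (simp add: psd_poly_mat_def)
  have det': "Determinant.det \<Phi>' \<noteq> 0"
    unfolding \<Phi>'_def using A \<Phi> det_mult[of "cadj A * \<Phi>" m A] det_mult[of "cadj A" m \<Phi>] detA det
    by (simp add: det_cadj map_poly_pCons)
  have \<Phi>A: "(\<Phi> * A) $$ (r, c) = \<Phi> $$ (r, c) + (if c = k then 0 else \<Phi> $$ (r, k) * f c)"
    if "r < m" "c < m" for r c
  proof -
    have "(\<Phi> * A) $$ (r, c) = (\<Sum>l<m. \<Phi> $$ (r, l) * (if l = c then 1 else if l = k then f c else 0))"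
      using that \<Phi> by (simp add: A_def scalar_prod_def atLeast0LessThan)
    also have "\<dots> = (\<Sum>l<m. (if l = c then \<Phi> $$ (r, c) else 0) + (if l = k then if c = k then 0 else \<Phi> $$ (r, k) * f c else 0))"
      by (intro sum.cong) auto
    also have "\<dots> = \<Phi> $$ (r, c) + (if c = k then 0 else \<Phi> $$ (r, k) * f c)"
      using that km by (simp add: sum.distrib)
    finally show ?thesis .
  qed
  have ind: "\<Phi>' $$ (r, c) = (\<Phi> * A) $$ (r, c) + (if r = k then 0 else cnjp (f r) * (\<Phi> * A) $$ (k, c))"
    if rc: "r < m" "c < m" for r c
  proof -
    have "\<Phi>' = cadj A * (\<Phi> * A)" using A \<Phi> by (simp add: \<Phi>'_def mat_assoc)
    then have "\<Phi>' $$ (r, c) = (\<Sum>l<m. cnjp (A $$ (l, r)) * (\<Phi> * A) $$ (l, c))"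
      using rc \<Phi> A by (simp add: scalar_prod_def atLeast0LessThan cadj_index)
    also have "\<dots> = (\<Sum>l<m. (if l = r then (\<Phi> * A) $$ (r, c) else 0) + (if l = k then if r = k then 0 else cnjp (f r) * (\<Phi> * A) $$ (k, c) else 0))"
      using rc by (intro sum.cong) (auto simp: A_def)
    also have "\<dots> = (\<Phi> * A) $$ (r, c) + (if r = k then 0 else cnjp (f r) * (\<Phi> * A) $$ (k, c))"
      using rc km by (simp add: sum.distrib)
    finally show ?thesis .
  qed
  have const': "degree (\<Phi>' $$ (r, c)) = 0" if "r < m" "c < m" for r c
    using that km const[OF that] const[OF that(1) km] const[OF km that(2)] const[OF km km] df[OF that(1)] df[OF that(2)]
    by (auto simp: ind \<Phi>A intro!: degree_0_add degree_0_mult)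
  have up: "\<Phi>' $$ (r, c) = 0" if rc: "r < m" "c < m" "r < Suc k" "r \<noteq> c" for r c
  proof (cases "r = k")
    case True
    show ?thesis
    proof (cases "c > k")
      case True
      then show ?thesis using \<open>r = k\<close> rc a a0 by (simp add: ind \<Phi>A f_def)
    next
      case False
      then show ?thesis using \<open>r = k\<close> rc stage[of r c] by (auto simp: ind \<Phi>A f_def)
    qed
  next
    case False
    then show ?thesis using rc stage[of r c] stage[of r k] km by (auto simp: ind \<Phi>A f_def)
  qed
  have stage': "\<Phi>' $$ (r, c) = 0" if rc: "r < m" "c < m" "r \<noteq> c" "r < Suc k \<or> c < Suc k" for r c
  proof (cases "r < Suc k")
    case False
    then have "\<Phi>' $$ (c, r) = 0" using up[of c r] rc by auto
    then show ?thesis using psd_hermitian[OF psd' rc(2,1)] by simp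
  qed (use up rc in blast)
  have "n = m - Suc k" using Suc.hyps(2) by simp
  then obtain H where "spectral_factor m \<Omega> \<Phi>' H"
    using Suc.hyps(1)[OF _ psd' det' const' stage'] by blast
  then show ?case unfolding \<Phi>'_def by (rule spectral_factor_congruence[OF \<Phi> A detA one_neq_zero])
qed

text \<open>Induction on the sum of the diagonal degrees. Once it is zero, the degree bound for
  off-diagonal entries makes the whole matrix constant.\<close>

lemma unimodular_spectral_factor:
  assumes "psd_poly_mat m \<Phi>" and "Determinant.det \<Phi> = [:d:]" "d \<noteq> 0"
  shows "\<exists>H. spectral_factor m \<Omega> \<Phi> H"
  using assms
proof (induction "\<Sum>k<m. degree (\<Phi> $$ (k, k))" arbitrary: \<Phi> d rule: less_induct)
  case less
  note psd = less.prems(1) and det = less.prems(2,3)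
  have \<Phi>: "\<Phi> \<in> carrier_mat m m" using psd by (simp add: psd_poly_mat_def)
  show ?case
  proof (cases "(\<Sum>k<m. degree (\<Phi> $$ (k, k))) = 0")
    case True
    then have z: "degree (\<Phi> $$ (k, k)) = 0" if "k < m" for k using that by simp
    have z': "degree (\<Phi> $$ (r, c)) = 0" if "r < m" "c < m" for r c
      using psd_offdiag_degree[OF psd that] psd_diag_nonzero[OF psd] det z that by simp
    have det0: "Determinant.det \<Phi> \<noteq> 0" using det by simp
    show ?thesis by (rule const_spectral_factor[OF psd det0 z', where k = 0]) simp_all
  next
    case False
    then obtain A c where A: "A \<in> carrier_mat m m" "Determinant.det A = [:c:]" "c \<noteq> 0"
      and lt: "(\<Sum>k<m. degree ((cadj A * \<Phi> * A) $$ (k, k))) < (\<Sum>k<m. degree (\<Phi> $$ (k, k)))"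
      using degree_reduction_step[OF psd det] False by blast
    have "Determinant.det (cadj A * \<Phi> * A) = [:cnj c * d * c:]"
      using A \<Phi> det_mult[of "cadj A * \<Phi>" m A] det_mult[of "cadj A" m \<Phi>] det by (simp add: det_cadj map_poly_pCons)
    then obtain H where "spectral_factor m \<Omega> (cadj A * \<Phi> * A) H"
      using less.hyps[OF lt psd_congruence[OF psd A(1)]] A(3) det(2) by auto
    then show ?thesis by (rule spectral_factor_congruence[OF \<Phi> A])
  qed
qed

theorem spectral_factorization:
  assumes "psd_poly_mat m \<Phi>" "Determinant.det \<Phi> \<noteq> 0" "\<And>z. \<not> (z \<in> \<Omega> \<and> cnj z \<in> \<Omega>)"
  shows "\<exists>H. spectral_factor m \<Omega> \<Phi> H"
proof (rule spectral_factor_reduction[OF _ assms(3,1,2)])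
  fix \<Phi> assume psd: "psd_poly_mat m \<Phi>" and nz: "Determinant.det \<Phi> \<noteq> 0"
    and "degree (Determinant.det \<Phi>) = 0"
  then obtain d where d: "Determinant.det \<Phi> = [:d:]" by (auto simp: degree_0_const)
  show "\<exists>H. spectral_factor m \<Omega> \<Phi> H"
    by (rule unimodular_spectral_factor[OF psd d]) (use nz d in simp)
qed

section \<open>The dissipation identity\<close>

lemma mat_add_mult: "dim_row A = dim_row B \<Longrightarrow> dim_col A = dim_col B \<Longrightarrow> dim_col A = dim_row C \<Longrightarrow>
    (A + B) * C = A * C + B * (C :: 'a :: semiring_0 mat)"
  by (metis add_mult_distrib_mat carrier_matI)

lemma mat_mult_add: "dim_row B = dim_row C \<Longrightarrow> dim_col B = dim_col C \<Longrightarrow> dim_col A = dim_row B \<Longrightarrow>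
    A * (B + C) = A * B + A * (C :: 'a :: semiring_0 mat)"
  by (metis mult_add_distrib_mat carrier_matI)

lemma mat_minus_mult: "dim_row A = dim_row B \<Longrightarrow> dim_col A = dim_col B \<Longrightarrow> dim_col A = dim_row C \<Longrightarrow>
    (A - B) * C = A * C - B * (C :: 'a :: ring mat)"
  by (metis minus_mult_distrib_mat carrier_matI)

lemma mat_mult_minus: "dim_row B = dim_row C \<Longrightarrow> dim_col B = dim_col C \<Longrightarrow> dim_col A = dim_row B \<Longrightarrow>
    A * (B - C) = A * B - A * (C :: 'a :: ring mat)"
  by (metis mult_minus_distrib_mat carrier_matI)

lemma one_mat_mult: "n = dim_row A \<Longrightarrow> 1\<^sub>m n * A = (A :: 'a :: semiring_1 mat)"
  and mat_mult_one: "n = dim_col A \<Longrightarrow> A * 1\<^sub>m n = (A :: 'a :: semiring_1 mat)"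
  by (metis carrier_matI left_mult_one_mat) (metis carrier_matI right_mult_one_mat)

lemma one_smult_mat: "(1 :: 'a :: comm_ring_1) \<cdot>\<^sub>m A = A"
  by (rule eq_matI) auto

text \<open>A nonzero member of least degree divides all others, so its roots would be common zeros;
  it is therefore a nonzero constant. This is Bezout's identity in a form that only asks for one
  suitable member at each point.\<close>

lemma ideal_without_common_zero:
  fixes I :: "complex poly set"
  assumes add: "\<And>p q. p \<in> I \<Longrightarrow> q \<in> I \<Longrightarrow> p + q \<in> I"
    and mult: "\<And>a p. p \<in> I \<Longrightarrow> a * p \<in> I"
    and nz: "\<And>z. \<exists>p\<in>I. poly p z \<noteq> 0"
  shows "1 \<in> I"
proof -
  obtain p0 where "p0 \<in> I \<and> p0 \<noteq> 0" using nz[of 0] by force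
  then obtain h where h: "h \<in> I" "h \<noteq> 0" and least: "\<And>p. p \<in> I \<Longrightarrow> p \<noteq> 0 \<Longrightarrow> degree h \<le> degree p"
    using ex_has_least_nat[of "\<lambda>p. p \<in> I \<and> p \<noteq> 0" p0 degree] by blast
  have dvd: "h dvd p" if p: "p \<in> I" for p
  proof -
    have "p mod h = p + (- (p div h)) * h" by (simp add: minus_div_mult_eq_mod[symmetric])
    then have "p mod h \<in> I" using add[OF p mult[OF h(1)]] by (simp only:)
    then have "p mod h = 0" using least[of "p mod h"] degree_mod_less[OF h(2), of p] by force
    then show ?thesis by (simp add: dvd_eq_mod_eq_0)
  qed
  have "degree h = 0"
  proof (rule ccontr)
    assume "degree h \<noteq> 0"
    then obtain z where "poly h z = 0"
      using fundamental_theorem_of_algebra[of h] by (auto simp: constant_degree)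
    then show False using nz[of z] dvd by (metis dvd_trans poly_eq_0_iff_dvd)
  qed
  then obtain c where c: "h = [:c:]" by (auto simp: degree_0_const)
  have "[:1 / c:] * h = 1" using h(2) by (simp add: c one_pCons)
  then show ?thesis using mult[OF h(1), of "[:1 / c:]"] by simp
qed

section \<open>Polynomial left inverses from injectivity at points\<close>

abbreviation eval_at :: "complex \<Rightarrow> complex poly mat \<Rightarrow> complex mat" where
  "eval_at z A \<equiv> map_mat (\<lambda>p. poly p z) A"

lemma eval_at_mult: "dim_col A = dim_row B \<Longrightarrow> eval_at z (A * B) = eval_at z A * eval_at z B"
  by (rule eq_matI) (auto simp: scalar_prod_def poly_sum)

lemma eval_at_add: "dim_row A = dim_row B \<Longrightarrow> dim_col A = dim_col B \<Longrightarrow>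
    eval_at z (A + B) = eval_at z A + eval_at z B"
  by (rule eq_matI) auto

text \<open>Writing out \<open>v\<^sup>* A(z)\<^sup>* A(z) v\<close> as the squared length of
  \<open>A(z) v\<close>.\<close>

lemma gram_index:
  fixes A :: "complex poly mat" and v y :: "complex vec"
  assumes A: "A \<in> carrier_mat k n" and v: "v \<in> carrier_vec n" and y: "y = eval_at z A *\<^sub>v v"
  shows "(\<Sum>j<n. cnj (v $ j) * (\<Sum>i<k. cnj (poly (A $$ (i, j)) z) * y $ i)) = of_real (\<Sum>i<k. (cmod (y $ i))\<^sup>2)"
proof -
  have yi: "y $ i = (\<Sum>j<n. poly (A $$ (i, j)) z * v $ j)" if "i < k" for i
    using that A v unfolding y by (simp add: scalar_prod_def atLeast0LessThan)
  have "(\<Sum>j<n. cnj (v $ j) * (\<Sum>i<k. cnj (poly (A $$ (i, j)) z) * y $ i)) =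
      (\<Sum>i<k. (\<Sum>j<n. cnj (poly (A $$ (i, j)) z * v $ j)) * y $ i)"
    unfolding sum_distrib_left sum_distrib_right by (subst sum.swap) (simp add: mult_ac)
  also have "\<dots> = (\<Sum>i<k. cnj (y $ i) * y $ i)" by (intro sum.cong) (auto simp: yi)
  also have "\<dots> = of_real (\<Sum>i<k. (cmod (y $ i))\<^sup>2)"
    unfolding of_real_sum complex_norm_square by (simp add: mult.commute)
  finally show ?thesis .
qed

text \<open>The Gram matrix of the values at \<open>z\<close> supplies constant left multipliers; the adjugate then
  makes the left inverse polynomial up to a scalar factor that does not vanish at \<open>z\<close>.\<close>

lemma left_inverse_at:
  fixes A B :: "complex poly mat"
  assumes A: "A \<in> carrier_mat k n" and B: "B \<in> carrier_mat l n"
    and inj: "\<And>x. x \<in> carrier_vec n \<Longrightarrow> eval_at z A *\<^sub>v x = 0\<^sub>v k \<Longrightarrow> eval_at z B *\<^sub>v x = 0\<^sub>v l \<Longrightarrow> x = 0\<^sub>v n"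
  obtains Z1 Z2 d where "Z1 \<in> carrier_mat n k" "Z2 \<in> carrier_mat n l"
    "Z1 * A + Z2 * B = d \<cdot>\<^sub>m 1\<^sub>m n" "poly d z \<noteq> 0"
proof -
  define C where "C = mat n k (\<lambda>(j, i). [:cnj (poly (A $$ (i, j)) z):])"
  define D where "D = mat n l (\<lambda>(j, i). [:cnj (poly (B $$ (i, j)) z):])"
  have C: "C \<in> carrier_mat n k" and D: "D \<in> carrier_mat n l" by (auto simp: C_def D_def)
  define N where "N = C * A + D * B"
  have N: "N \<in> carrier_mat n n" using A B C D by (auto simp: N_def)
  have "Determinant.det (eval_at z N) \<noteq> 0"
  proof
    assume "Determinant.det (eval_at z N) = 0"
    then obtain v where v: "v \<in> carrier_vec n" "v \<noteq> 0\<^sub>v n" "eval_at z N *\<^sub>v v = 0\<^sub>v n"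
      using det_0_iff_vec_prod_zero_field[of "eval_at z N" n] N by auto
    define y where "y = eval_at z A *\<^sub>v v"
    define y' where "y' = eval_at z B *\<^sub>v v"
    have yc: "y \<in> carrier_vec k" "y' \<in> carrier_vec l" using A B v(1) by (auto simp: y_def y'_def intro!: mult_mat_vec_carrier[of _ _ n])
    have ev: "eval_at z A \<in> carrier_mat k n" "eval_at z B \<in> carrier_mat l n"
      "eval_at z C \<in> carrier_mat n k" "eval_at z D \<in> carrier_mat n l" using A B C D by auto
    have "eval_at z N = eval_at z C * eval_at z A + eval_at z D * eval_at z B"
      using A B C D by (simp add: N_def eval_at_add eval_at_mult)
    then have Nv: "eval_at z N *\<^sub>v v = eval_at z C *\<^sub>v y + eval_at z D *\<^sub>v y'"
      using add_mult_distrib_mat_vec[OF mult_carrier_mat[OF ev(3,1)] mult_carrier_mat[OF ev(4,2)] v(1)]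
        assoc_mult_mat_vec[OF ev(3,1) v(1)] assoc_mult_mat_vec[OF ev(4,2) v(1)] by (simp add: y_def y'_def)
    have idx: "(eval_at z C *\<^sub>v y + eval_at z D *\<^sub>v y') $ j =
       (\<Sum>i<k. cnj (poly (A $$ (i, j)) z) * y $ i) + (\<Sum>i<l. cnj (poly (B $$ (i, j)) z) * y' $ i)" if "j < n" for j
      using that yc by (simp add: C_def D_def scalar_prod_def atLeast0LessThan)
    have "(\<Sum>i<k. cnj (poly (A $$ (i, j)) z) * y $ i) + (\<Sum>i<l. cnj (poly (B $$ (i, j)) z) * y' $ i) = 0"
      if "j < n" for j using idx[OF that] that unfolding Nv[symmetric] v(3) by simp
    then have "(\<Sum>j<n. cnj (v $ j) * ((\<Sum>i<k. cnj (poly (A $$ (i, j)) z) * y $ i) +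
        (\<Sum>i<l. cnj (poly (B $$ (i, j)) z) * y' $ i))) = 0" by simp
    then have "of_real ((\<Sum>i<k. (cmod (y $ i))\<^sup>2) + (\<Sum>i<l. (cmod (y' $ i))\<^sup>2)) = (0::complex)"
      using gram_index[OF A v(1) y_def] gram_index[OF B v(1) y'_def]
      by (simp add: distrib_left sum.distrib)
    then have s: "(\<Sum>i<k. (cmod (y $ i))\<^sup>2) + (\<Sum>i<l. (cmod (y' $ i))\<^sup>2) = 0"
      by (simp only: of_real_eq_0_iff)
    have s1: "(\<Sum>i<k. (cmod (y $ i))\<^sup>2) \<ge> 0" "(\<Sum>i<l. (cmod (y' $ i))\<^sup>2) \<ge> 0" by (auto intro: sum_nonneg)
    have "(\<Sum>i<k. (cmod (y $ i))\<^sup>2) = 0" "(\<Sum>i<l. (cmod (y' $ i))\<^sup>2) = 0" using s s1 by linarith+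
    then have "y = 0\<^sub>v k" "y' = 0\<^sub>v l"
      using yc by (auto intro!: eq_vecI simp: sum_nonneg_eq_0_iff)
    then show False using inj[OF v(1)] v(2) by (simp add: y_def y'_def)
  qed
  then have d: "poly (Determinant.det N) z \<noteq> 0"
    using comm_ring_hom.hom_det[OF poly_hom.comm_ring_hom_axioms] by metis
  have J: "adj_mat N \<in> carrier_mat n n" using adj_mat(1)[OF N] .
  have "(adj_mat N * C) * A + (adj_mat N * D) * B = adj_mat N * N"
    using A B C D J by (simp add: N_def mat_assoc mat_mult_add del: assoc_mult_mat)
  then show ?thesis using that[of "adj_mat N * C" "adj_mat N * D" "Determinant.det N"] J C D d adj_mat(3)[OF N] by simp
qed

text \<open>At each point there is a left inverse up to a scalar polynomial that is nonzero there.
  These scalars form an ideal without common zero, so the scalar can be taken to be one.\<close>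

lemma polynomial_left_inverse:
  fixes A :: "complex poly mat"
  assumes A: "A \<in> carrier_mat k n"
    and inj: "\<And>z x. x \<in> carrier_vec n \<Longrightarrow> eval_at z A *\<^sub>v x = 0\<^sub>v k \<Longrightarrow> x = 0\<^sub>v n"
  obtains S where "S \<in> carrier_mat n k" "S * A = 1\<^sub>m n"
proof -
  define I where "I = {d. \<exists>Z\<in>carrier_mat n k. Z * A = d \<cdot>\<^sub>m 1\<^sub>m n}"
  have "1 \<in> I"
  proof (rule ideal_without_common_zero)
    fix p q assume "p \<in> I" "q \<in> I"
    then obtain Z1 Z2 where Z: "Z1 \<in> carrier_mat n k" "Z1 * A = p \<cdot>\<^sub>m 1\<^sub>m n"
      "Z2 \<in> carrier_mat n k" "Z2 * A = q \<cdot>\<^sub>m 1\<^sub>m n" by (auto simp: I_def)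
    have "(Z1 + Z2) * A = (p + q) \<cdot>\<^sub>m 1\<^sub>m n"
      using Z A by (simp add: mat_add_mult) (auto intro!: eq_matI)
    then show "p + q \<in> I" using Z by (auto simp: I_def)
  next
    fix a p assume "p \<in> I"
    then obtain Z where Z: "Z \<in> carrier_mat n k" "Z * A = p \<cdot>\<^sub>m 1\<^sub>m n" by (auto simp: I_def)
    have "(a \<cdot>\<^sub>m Z) * A = (a * p) \<cdot>\<^sub>m 1\<^sub>m n"
      using Z A by (simp add: mat_smult_left mat_smult_smult)
    then show "a * p \<in> I" using Z by (auto simp: I_def)
  next
    fix z
    \<comment> \<open>An empty second block: injectivity of \<open>A\<close> alone is available and
      suffices.\<close>
    have B: "(0\<^sub>m 0 n :: complex poly mat) \<in> carrier_mat 0 n" by simp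
    obtain Z1 Z2 d where Z: "Z1 \<in> carrier_mat n k" "Z2 \<in> carrier_mat n 0"
      "Z1 * A + Z2 * 0\<^sub>m 0 n = d \<cdot>\<^sub>m 1\<^sub>m n" "poly d z \<noteq> 0"
      using left_inverse_at[OF A B, of z] inj by metis
    have "Z2 * 0\<^sub>m 0 n = 0\<^sub>m n n" using Z(2) by (intro eq_matI) (auto simp: scalar_prod_def)
    then have "Z1 * A = d \<cdot>\<^sub>m 1\<^sub>m n" using Z A by simp
    then show "\<exists>p\<in>I. poly p z \<noteq> 0" using Z by (auto simp: I_def)
  qed
  then show ?thesis using that by (auto simp: I_def one_smult_mat)
qed

lemma mat_sum_rearrange:
  fixes A1 :: "'a :: ab_group_add mat"
  assumes "A1 \<in> carrier_mat n k" "B2 \<in> carrier_mat n k" "B3 \<in> carrier_mat n k" "B4 \<in> carrier_mat n k"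
    "C2 \<in> carrier_mat n k" "C3 \<in> carrier_mat n k" "D1 \<in> carrier_mat n k" "D2 \<in> carrier_mat n k"
  shows "A1 + (B3 + C3) + (B2 + C2 + (D1 + D2 + B4)) = (A1 + B3) + (B2 + B4) + ((C2 + D1) + (C3 + D2))"
  by (rule eq_matI) (use assms in \<open>simp_all add: add_ac\<close>)

text \<open>\<open>M * S\<close> and \<open>P\<close> are complementary projections that split
  \<open>\<Sigma>\<close> into four blocks. The block on the image of \<open>M\<close> is factored
  by \<open>H\<close>. The mixed blocks then determine \<open>E\<close> up to multiples of
  \<open>R\<close>, and the resulting \<open>cadj E * E\<close> has to be taken out of the last
  block before that block is divided by \<open>R\<close> and its adjoint.\<close>

lemma dissipation_identity:
  fixes R M \<Sigma> :: "complex poly mat"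
  assumes R: "R \<in> carrier_mat g n" and M: "M \<in> carrier_mat n m" and \<Sigma>: "\<Sigma> \<in> carrier_mat n n"
    and herm: "cadj \<Sigma> = \<Sigma>"
    and RM: "R * M = 0\<^sub>m g m"
    and inj: "\<And>z x. x \<in> carrier_vec m \<Longrightarrow> eval_at z M *\<^sub>v x = 0\<^sub>v n \<Longrightarrow> x = 0\<^sub>v m"
    and ker: "\<And>z x. z \<notin> \<Omega> \<Longrightarrow> x \<in> carrier_vec n \<Longrightarrow> eval_at z R *\<^sub>v x = 0\<^sub>v g \<Longrightarrow>
       \<exists>y\<in>carrier_vec m. x = eval_at z M *\<^sub>v y"
    and \<Omega>: "\<And>z. \<not> (z \<in> \<Omega> \<and> cnj z \<in> \<Omega>)"
    and psd: "psd_poly_mat m (cadj M * \<Sigma> * M)" and det: "Determinant.det (cadj M * \<Sigma> * M) \<noteq> 0"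
  obtains L V where "L \<in> carrier_mat m n" "V \<in> carrier_mat g n"
    "\<Sigma> = cadj L * L + (cadj V * R + cadj R * V)"
proof -
  obtain S where S: "S \<in> carrier_mat m n" and SM: "S * M = 1\<^sub>m m"
    using polynomial_left_inverse[OF M] inj by blast
  define P where "P = 1\<^sub>m n - M * S"
  have P: "P \<in> carrier_mat n n" using M S by (auto simp: P_def)
  note [simp] = mat_assoc mat_add_mult mat_mult_add mat_smult_left mat_smult_right
    one_mat_mult mat_mult_one cadj_mult cadj_add cadj_smult
  note [simp del] = assoc_mult_mat
  note dims = carrier_matD[OF R] carrier_matD[OF M] carrier_matD[OF \<Sigma>] carrier_matD[OF S] carrier_matD[OF P]
  have SP: "S * P = 0\<^sub>m m n"
  proof -
    have "S * P = S - (S * M) * S" unfolding P_def using dims by (simp add: mat_mult_minus)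
    then show ?thesis using SM S by auto
  qed
  have RP: "R * P = R"
  proof -
    have "R * P = R - (R * M) * S" unfolding P_def using dims by (simp add: mat_mult_minus)
    then show ?thesis using RM R S by auto
  qed
  have PP: "P * P = P"
  proof -
    have "P * P = P - M * (S * P)" unfolding P_def[of] using dims by (simp add: mat_minus_mult mat_mult_minus P_def)
    then show ?thesis using SP M P by auto
  qed
  have split: "M * S + P = 1\<^sub>m n" using M S by (auto simp: P_def)
  \<comment> \<open>\<open>P\<close> itself need not be a polynomial left multiple of
    \<open>R\<close>; this ideal measures the obstruction, and its common zeros all lie in
    \<open>\<Omega>\<close>.\<close>
  define I where "I = {d. \<exists>Z\<in>carrier_mat n g. Z * R = d \<cdot>\<^sub>m P}"
  have I_add: "p + q \<in> I" if pq: "p \<in> I" "q \<in> I" for p q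
  proof -
    obtain Z1 Z2 where Z: "Z1 \<in> carrier_mat n g" "Z1 * R = p \<cdot>\<^sub>m P"
      "Z2 \<in> carrier_mat n g" "Z2 * R = q \<cdot>\<^sub>m P" using pq by (auto simp: I_def)
    have "(Z1 + Z2) * R = (p + q) \<cdot>\<^sub>m P" using Z dims by (simp add: add_smult_distrib_right_mat[OF P])
    then show ?thesis using Z by (auto simp: I_def)
  qed
  have I_mult: "a * p \<in> I" if p: "p \<in> I" for a p
  proof -
    obtain Z where Z: "Z \<in> carrier_mat n g" "Z * R = p \<cdot>\<^sub>m P" using p by (auto simp: I_def)
    have "(a \<cdot>\<^sub>m Z) * R = (a * p) \<cdot>\<^sub>m P" using Z dims by (simp add: mat_smult_smult)
    then show ?thesis using Z by (auto simp: I_def)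
  qed
  \<comment> \<open>Outside \<open>\<Omega>\<close> the kernels of \<open>R(z)\<close> and
    \<open>S(z)\<close> meet only in zero, since a kernel vector of \<open>R(z)\<close> has the form
    \<open>M(z) y\<close> and \<open>S(z)\<close> recovers \<open>y\<close>. Multiplying the
    resulting left inverse by \<open>P\<close> removes the \<open>S\<close> part and leaves the
    \<open>R\<close> part unchanged.\<close>
  have I_nz: "\<exists>d\<in>I. poly d z \<noteq> 0" if z: "z \<notin> \<Omega>" for z
  proof -
    have "x = 0\<^sub>v n" if x: "x \<in> carrier_vec n" "eval_at z R *\<^sub>v x = 0\<^sub>v g" "eval_at z S *\<^sub>v x = 0\<^sub>v m" for x
    proof -
      obtain y where y: "y \<in> carrier_vec m" "x = eval_at z M *\<^sub>v y" using ker[OF z x(1,2)] by blast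
      have "eval_at z S *\<^sub>v x = eval_at z (S * M) *\<^sub>v y" using S M y by (simp add: eval_at_mult)
      also have "eval_at z (S * M) = 1\<^sub>m m" unfolding SM by (rule eq_matI) auto
      finally have "y = 0\<^sub>v m" using x(3) y(1) by simp
      then show ?thesis using y M by (auto intro!: eq_vecI)
    qed
    then obtain Z1 Z2 d where Z: "Z1 \<in> carrier_mat n g" "Z2 \<in> carrier_mat n m"
      "Z1 * R + Z2 * S = d \<cdot>\<^sub>m 1\<^sub>m n" "poly d z \<noteq> 0"
      using left_inverse_at[OF R S] by metis
    have "(Z1 * R + Z2 * S) * P = Z1 * R + Z2 * 0\<^sub>m m n" using Z(1,2) dims by (simp add: RP SP)
    also have "\<dots> = Z1 * R" using Z(1,2) R by simp
    finally have "Z1 * R = d \<cdot>\<^sub>m P" unfolding Z(3) using dims by simp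
    then show ?thesis using Z by (auto simp: I_def)
  qed
  \<comment> \<open>Real points equal their conjugates and hence lie outside
    \<open>\<Omega>\<close>, so the ideal is not empty.\<close>
  have zero_I: "0 \<in> I" using I_mult[of _ 0] I_nz \<Omega> by (metis mult_zero_left)
  obtain H where H: "H \<in> carrier_mat m m" and \<Phi>: "cadj M * \<Sigma> * M = cadj H * H"
    and Hz: "\<And>z. z \<in> \<Omega> \<Longrightarrow> poly (Determinant.det (cadj H)) z \<noteq> 0"
    using spectral_factorization[OF psd det \<Omega>] by (auto simp: spectral_factor_def)
  define h where "h = Determinant.det (cadj H)"
  \<comment> \<open>The determinant \<open>h\<close> serves the points of \<open>\<Omega>\<close>,
    the ideal \<open>I\<close> all others.\<close>
  have "1 \<in> {d + b * h | d b. d \<in> I}"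
  proof (rule ideal_without_common_zero)
    fix p q assume "p \<in> {d + b * h | d b. d \<in> I}" "q \<in> {d + b * h | d b. d \<in> I}"
    then obtain d b d' b' where "p = d + b * h" "q = d' + b' * h" "d \<in> I" "d' \<in> I" by blast
    then have "p + q = (d + d') + (b + b') * h" "d + d' \<in> I" by (auto simp: algebra_simps I_add)
    then show "p + q \<in> {d + b * h | d b. d \<in> I}" by blast
  next
    fix a p assume "p \<in> {d + b * h | d b. d \<in> I}"
    then obtain d b where "p = d + b * h" "d \<in> I" by blast
    then have "a * p = a * d + (a * b) * h" "a * d \<in> I" by (auto simp: algebra_simps I_mult)
    then show "a * p \<in> {d + b * h | d b. d \<in> I}" by blast
  next
    fix z
    show "\<exists>p\<in>{d + b * h | d b. d \<in> I}. poly p z \<noteq> 0"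
    proof (cases "z \<in> \<Omega>")
      case True
      then have "poly (0 + 1 * h) z \<noteq> 0" using Hz by (simp add: h_def)
      then show ?thesis using zero_I by blast
    next
      case False
      then obtain d where "d \<in> I" "poly (d + 0 * h) z \<noteq> 0" using I_nz by auto
      then show ?thesis by blast
    qed
  qed
  then obtain d b where db: "d \<in> I" "d + b * h = 1" by (smt (verit) mem_Collect_eq)
  obtain Z where Z: "Z \<in> carrier_mat n g" "Z * R = d \<cdot>\<^sub>m P" using db(1) by (auto simp: I_def)
  define X where "X = cadj M * (\<Sigma> * P)"
  have X: "X \<in> carrier_mat m n" using dims by (auto simp: X_def)
  have cH: "cadj H \<in> carrier_mat m m" using H by simp
  note adj = adj_mat[OF cH]
  \<comment> \<open>The adjugate inverts \<open>cadj H\<close> up to \<open>h\<close>, so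
    \<open>cadj H * E\<close> is the share \<open>b * h\<close> of \<open>X\<close>; the share
    \<open>d\<close> is a multiple of \<open>R\<close>.\<close>
  define E where "E = b \<cdot>\<^sub>m (adj_mat (cadj H) * X)"
  have E: "E \<in> carrier_mat m n" using X adj by (auto simp: E_def)
  note dims = dims carrier_matD[OF Z(1)] carrier_matD[OF X] carrier_matD[OF H] carrier_matD[OF E] carrier_matD[OF adj(1)]
  have XP: "X * P = X" using dims by (simp add: X_def PP)
  have EP: "E * P = E" using dims by (simp add: E_def XP)
  have HE: "cadj H * E = (b * h) \<cdot>\<^sub>m X"
  proof -
    have "cadj H * E = b \<cdot>\<^sub>m ((cadj H * adj_mat (cadj H)) * X)" using dims by (simp add: E_def)
    also have "\<dots> = (b * h) \<cdot>\<^sub>m X" unfolding adj(2) using dims by (simp add: h_def mat_smult_smult)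
    finally show ?thesis .
  qed
  define Y where "Y = X * Z"
  have Y: "Y \<in> carrier_mat m g" using X Z by (auto simp: Y_def)
  have YR: "Y * R = d \<cdot>\<^sub>m X" using dims by (simp add: Y_def Z(2) XP)
  have XE: "X = cadj H * E + Y * R"
  proof -
    have "X = (d + b * h) \<cdot>\<^sub>m X" by (simp add: db(2) one_smult_mat)
    also have "\<dots> = cadj H * E + Y * R" unfolding HE YR using X by (auto simp: algebra_simps)
    finally show ?thesis .
  qed
  \<comment> \<open>What the last block must still represent once the square of \<open>E\<close> has
    been taken out.\<close>
  define T where "T = \<Sigma> - cadj E * E"
  have T: "T \<in> carrier_mat n n" by (rule carrier_matI) (use dims in \<open>simp_all add: T_def\<close>)
  have cT: "cadj T = T" using dims by (simp add: T_def cadj_minus herm)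
  have \<Sigma>T: "\<Sigma> = T + cadj E * E" by (rule eq_matI) (use dims in \<open>simp_all add: T_def\<close>)
  define K where "K = cadj P * (T * P)"
  have K: "K \<in> carrier_mat n n" by (rule carrier_matI) (use dims in \<open>simp_all add: K_def\<close>)
  note dims = dims carrier_matD[OF T] carrier_matD[OF K] carrier_matD[OF Y]
  have cK: "cadj K = K" using dims by (simp add: K_def cT)
  \<comment> \<open>Members of \<open>I\<close> serve the points outside \<open>\<Omega>\<close>. At
    a point of \<open>\<Omega>\<close> the conjugate point lies outside, so a conjugated member is
    nonzero there.\<close>
  have "1 \<in> {d1 + cnjp d2 | d1 d2. d1 \<in> I \<and> d2 \<in> I}"
  proof (rule ideal_without_common_zero)
    fix p q assume "p \<in> {d1 + cnjp d2 | d1 d2. d1 \<in> I \<and> d2 \<in> I}" "q \<in> {d1 + cnjp d2 | d1 d2. d1 \<in> I \<and> d2 \<in> I}"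
    then obtain d1 d2 e1 e2 where "p = d1 + cnjp d2" "q = e1 + cnjp e2" "d1 \<in> I" "d2 \<in> I" "e1 \<in> I" "e2 \<in> I" by blast
    then have "p + q = (d1 + e1) + cnjp (d2 + e2)" "d1 + e1 \<in> I" "d2 + e2 \<in> I"
      by (auto simp: cnjp.hom_add I_add)
    then show "p + q \<in> {d1 + cnjp d2 | d1 d2. d1 \<in> I \<and> d2 \<in> I}" by blast
  next
    fix a p assume "p \<in> {d1 + cnjp d2 | d1 d2. d1 \<in> I \<and> d2 \<in> I}"
    then obtain d1 d2 where "p = d1 + cnjp d2" "d1 \<in> I" "d2 \<in> I" by blast
    then have "a * p = a * d1 + cnjp (cnjp a * d2)" "a * d1 \<in> I" "cnjp a * d2 \<in> I"
      using I_mult by (simp_all add: cnjp.hom_mult distrib_left)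
    then show "a * p \<in> {d1 + cnjp d2 | d1 d2. d1 \<in> I \<and> d2 \<in> I}" by blast
  next
    fix z
    show "\<exists>p\<in>{d1 + cnjp d2 | d1 d2. d1 \<in> I \<and> d2 \<in> I}. poly p z \<noteq> 0"
    proof (cases "z \<in> \<Omega>")
      case True
      then obtain d2 where "d2 \<in> I" "poly d2 (cnj z) \<noteq> 0" using I_nz \<Omega> by blast
      then have "d2 \<in> I" "poly (0 + cnjp d2) z \<noteq> 0" by (auto simp: poly_cnjp)
      then show ?thesis using zero_I by blast
    next
      case False
      then obtain d1 where "d1 \<in> I" "poly (d1 + cnjp 0) z \<noteq> 0" using I_nz by auto
      then show ?thesis using zero_I by blast
    qed
  qed
  then obtain d1 d2 where dd: "d1 \<in> I" "d2 \<in> I" "d1 + cnjp d2 = 1" by (smt (verit) mem_Collect_eq)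
  obtain Z1 where Z1: "Z1 \<in> carrier_mat n g" "Z1 * R = d1 \<cdot>\<^sub>m P" using dd(1) by (auto simp: I_def)
  obtain Z2 where Z2: "Z2 \<in> carrier_mat n g" "Z2 * R = d2 \<cdot>\<^sub>m P" using dd(2) by (auto simp: I_def)
  define U where "U = cadj P * (T * Z1)"
  define W where "W = cadj Z2 * (T * P)"
  have U: "U \<in> carrier_mat n g" by (rule carrier_matI) (use dims Z1 in \<open>simp_all add: U_def\<close>)
  have W: "W \<in> carrier_mat g n" by (rule carrier_matI) (use dims Z2 in \<open>simp_all add: W_def\<close>)
  note dims = dims carrier_matD[OF Z1(1)] carrier_matD[OF Z2(1)] carrier_matD[OF U] carrier_matD[OF W]
  have KUW: "K = U * R + cadj R * W"
  proof -
    have "U * R = d1 \<cdot>\<^sub>m K" using dims by (simp add: U_def K_def Z1(2))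
    moreover have "cadj R * W = cnjp d2 \<cdot>\<^sub>m K"
    proof -
      have "cadj R * W = cadj (Z2 * R) * (T * P)" using dims by (simp add: W_def)
      then show ?thesis unfolding Z2(2) using dims by (simp add: K_def)
    qed
    ultimately have "U * R + cadj R * W = (d1 + cnjp d2) \<cdot>\<^sub>m K"
      using add_smult_distrib_right_mat[OF K] by simp
    then show ?thesis by (simp add: dd(3) one_smult_mat)
  qed
  \<comment> \<open>\<open>K\<close> is self-adjoint, so averaging \<open>U * R + cadj R * W\<close>
    with its adjoint replaces the unrelated \<open>U\<close> and \<open>W\<close> by one matrix and
    its adjoint.\<close>
  define V2 where "V2 = [:1 / 2:] \<cdot>\<^sub>m (cadj U + W)"
  have V2: "V2 \<in> carrier_mat g n" by (rule carrier_matI) (use dims in \<open>simp_all add: V2_def\<close>)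
  note dims = dims carrier_matD[OF V2]
  have KV2: "K = cadj V2 * R + cadj R * V2"
  proof -
    have c: "cadj K = cadj R * cadj U + cadj W * R" using dims by (simp add: KUW)
    have h2: "cnjp [:1 / 2:] = [:1 / 2:]" by (simp add: map_poly_pCons)
    have "cadj V2 * R + cadj R * V2 = [:1 / 2:] \<cdot>\<^sub>m (U * R + cadj W * R) + [:1 / 2:] \<cdot>\<^sub>m (cadj R * cadj U + cadj R * W)"
      using dims by (simp add: V2_def h2)
    also have "\<dots> = [:1 / 2:] \<cdot>\<^sub>m ((U * R + cadj R * W) + (cadj R * cadj U + cadj W * R))"
      using dims by (intro eq_matI) (auto simp: algebra_simps simp del: index_mult_mat(1) simp flip: smult_add_right)
    also have "\<dots> = [:1 / 2:] \<cdot>\<^sub>m (K + K)" using c cK KUW by simp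
    also have "\<dots> = K" by (rule eq_matI) (auto simp: mult_2[symmetric] simp flip: smult_add_left simp del: mult_2)
    finally show ?thesis by simp
  qed
  define L where "L = H * S + E"
  define V where "V = cadj Y * S + V2"
  have L: "L \<in> carrier_mat m n" by (rule carrier_matI) (use dims in \<open>simp_all add: L_def\<close>)
  have V: "V \<in> carrier_mat g n" by (rule carrier_matI) (use dims in \<open>simp_all add: V_def\<close>)
  define A1 where "A1 = cadj S * (cadj H * (H * S))"
  define B2 where "B2 = cadj S * (cadj H * E)"
  define B3 where "B3 = cadj E * (H * S)"
  define B4 where "B4 = cadj E * E"
  define C2 where "C2 = cadj S * (Y * R)"
  define C3 where "C3 = cadj R * (cadj Y * S)"
  define D1 where "D1 = cadj V2 * R"
  define D2 where "D2 = cadj R * V2"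
  note defs = A1_def B2_def B3_def B4_def C2_def C3_def D1_def D2_def
  have car: "A1 \<in> carrier_mat n n" "B2 \<in> carrier_mat n n" "B3 \<in> carrier_mat n n" "B4 \<in> carrier_mat n n"
    "C2 \<in> carrier_mat n n" "C3 \<in> carrier_mat n n" "D1 \<in> carrier_mat n n" "D2 \<in> carrier_mat n n"
    unfolding defs carrier_mat_def using dims by simp_all
  have LL: "cadj L * L = (A1 + B3) + (B2 + B4)" unfolding L_def defs using dims by (simp)
  have VR: "cadj V * R = C2 + D1" unfolding V_def defs using dims by simp
  have RV: "cadj R * V = C3 + D2" unfolding V_def defs using dims by simp
  \<comment> \<open>Inserting the identity on both sides produces the four blocks.\<close>
  have "\<Sigma> = cadj (M * S + P) * (\<Sigma> * (M * S + P))" unfolding split using dims by simp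
  also have "\<dots> = (cadj S * ((cadj M * \<Sigma> * M) * S) + cadj (cadj S * X)) + (cadj S * X + cadj P * (\<Sigma> * P))"
    using dims by (simp add: X_def herm)
  also have "cadj S * ((cadj M * \<Sigma> * M) * S) = A1" unfolding \<Phi> A1_def using dims by simp
  also have "cadj S * X = B2 + C2" unfolding defs using dims by (subst XE) simp
  also have "cadj (B2 + C2) = B3 + C3" unfolding defs using dims by simp
  also have "cadj P * (\<Sigma> * P) = K + B4"
  proof -
    have "cadj P * (\<Sigma> * P) = K + cadj (E * P) * (E * P)" unfolding \<Sigma>T K_def using dims by simp
    then show ?thesis by (simp add: EP B4_def)
  qed
  also have "K = D1 + D2" unfolding defs by (rule KV2)
  also have "A1 + (B3 + C3) + (B2 + C2 + (D1 + D2 + B4)) = (A1 + B3) + (B2 + B4) + ((C2 + D1) + (C3 + D2))"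
    by (rule mat_sum_rearrange[OF car])
  finally have "\<Sigma> = cadj L * L + (cadj V * R + cadj R * V)" unfolding LL VR RV .
  then show ?thesis using that L V by blast
qed

section \<open>Two-variable polynomials and storage functions\<close>

lemma smooth_DERIV:
  assumes "smooth f"
  shows "((deriv ^^ k) f has_real_derivative (deriv ^^ Suc k) f t) (at t)"
  using assms unfolding smooth_def by (simp add: DERIV_deriv_iff_real_differentiable)

definition dop :: "real poly \<Rightarrow> (real \<Rightarrow> real) \<Rightarrow> real \<Rightarrow> real" where
  "dop p f t = (\<Sum>k\<le>degree p. coeff p k * (deriv ^^ k) f t)"

lemma dop_bound:
  assumes "degree p \<le> N"
  shows "dop p f t = (\<Sum>k\<le>N. coeff p k * (deriv ^^ k) f t)"
  unfolding dop_def by (rule sum.mono_neutral_left) (use assms in \<open>auto simp: coeff_eq_0\<close>)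

lemma dop_0 [simp]: "dop 0 f t = 0"
  by (simp add: dop_def)

lemma dop_add: "dop (p + q) f t = dop p f t + dop q f t"
proof -
  let ?N = "max (degree p) (degree q)"
  show ?thesis
    using dop_bound[of "p + q" ?N f t] dop_bound[of p ?N f t] dop_bound[of q ?N f t] degree_add_le_max[of p q]
    by (simp add: sum.distrib distrib_right)
qed

lemma dop_smult: "dop (Polynomial.smult c p) f t = c * dop p f t"
  using dop_bound[of "Polynomial.smult c p" "degree p" f t] degree_smult_le[of c p]
  by (simp add: dop_def sum_distrib_left mult_ac)

lemma dop_pCons: "dop (pCons a p) f t = a * f t + dop p (deriv f) t"
proof -
  have "dop (pCons a p) f t = (\<Sum>k\<le>Suc (degree p). coeff (pCons a p) k * (deriv ^^ k) f t)"
    by (rule dop_bound) (rule degree_pCons_le)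
  also have "\<dots> = a * f t + (\<Sum>k\<le>degree p. coeff p k * (deriv ^^ Suc k) f t)"
    by (subst sum.atMost_Suc_shift) simp
  finally show ?thesis by (simp add: dop_def funpow_swap1)
qed

lemma dop_DERIV:
  assumes "smooth f"
  shows "(dop p f has_real_derivative dop p (deriv f) t) (at t)"
proof -
  have "(dop p f has_real_derivative (\<Sum>k\<le>degree p. coeff p k * (deriv ^^ Suc k) f t)) (at t)"
    unfolding dop_def[abs_def] by (intro DERIV_sum DERIV_cmult smooth_DERIV[OF assms])
  then show ?thesis by (simp add: dop_def funpow_swap1)
qed

text \<open>The bilinear differential form of a two-variable polynomial, with the encoding of the
  statement: the outer variable \<open>\<zeta>\<close> differentiates \<open>f\<close>, the inner variable \<open>\<eta>\<close> differentiates \<open>g\<close>.\<close>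

definition bdf :: "real poly poly \<Rightarrow> (real \<Rightarrow> real) \<Rightarrow> (real \<Rightarrow> real) \<Rightarrow> real \<Rightarrow> real" where
  "bdf p f g t = (\<Sum>j\<le>degree p. (deriv ^^ j) f t * dop (coeff p j) g t)"

lemma bdf_bound:
  assumes "degree p \<le> N"
  shows "bdf p f g t = (\<Sum>j\<le>N. (deriv ^^ j) f t * dop (coeff p j) g t)"
  unfolding bdf_def by (rule sum.mono_neutral_left) (use assms in \<open>auto simp: coeff_eq_0\<close>)

lemma bdf_0 [simp]: "bdf 0 f g t = 0"
  by (simp add: bdf_def)

lemma bdf_add: "bdf (p + q) f g t = bdf p f g t + bdf q f g t"
proof -
  let ?N = "max (degree p) (degree q)"
  show ?thesis
    using bdf_bound[of "p + q" ?N f g t] bdf_bound[of p ?N f g t] bdf_bound[of q ?N f g t] degree_add_le_max[of p q]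
    by (simp add: sum.distrib distrib_left dop_add)
qed

lemma bdf_uminus: "bdf (- p) f g t = - bdf p f g t"
  using bdf_add[of "- p" p f g t] by simp

lemma bdf_diff: "bdf (p - q) f g t = bdf p f g t - bdf q f g t"
  using bdf_add[of p "- q" f g t] by (simp add: bdf_uminus)

lemma bdf_sum: "bdf (\<Sum>i\<in>A. p i) f g t = (\<Sum>i\<in>A. bdf (p i) f g t)"
  by (induction A rule: infinite_finite_induct) (auto simp: bdf_add)

lemma bdf_pCons: "bdf (pCons a p) f g t = f t * dop a g t + bdf p (deriv f) g t"
proof -
  have "bdf (pCons a p) f g t = (\<Sum>k\<le>Suc (degree p). (deriv ^^ k) f t * dop (coeff (pCons a p) k) g t)"
    by (rule bdf_bound) (rule degree_pCons_le)
  also have "\<dots> = f t * dop a g t + (\<Sum>k\<le>degree p. (deriv ^^ Suc k) f t * dop (coeff p k) g t)"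
    by (subst sum.atMost_Suc_shift) simp
  finally show ?thesis by (simp add: bdf_def funpow_swap1)
qed

lemma bdf_smult_eta: "bdf (Polynomial.smult [:0, 1:] p) f g t = bdf p f (deriv g) t"
proof -
  have "dop ([:0, 1:] * q) g t = dop q (deriv g) t" for q by (simp add: dop_pCons)
  then show ?thesis
    using bdf_bound[of "Polynomial.smult [:0, 1:] p" "degree p" f g t] degree_smult_le[of "[:0, 1:]" p]
    by (simp add: bdf_def)
qed

text \<open>The factor \<open>[:[:0, 1:], 1:]\<close> is \<zeta> + \<eta> in this encoding. The
  product rule becomes multiplication by it: \<zeta> differentiates \<open>f\<close> once more,
  \<eta> differentiates \<open>g\<close>.\<close>

lemma bdf_DERIV:
  assumes "smooth f" "smooth g"
  shows "(bdf p f g has_real_derivative bdf ([:[:0, 1:], 1:] * p) f g t) (at t)"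
proof -
  have "(bdf p f g has_real_derivative
      (\<Sum>j\<le>degree p. (deriv ^^ Suc j) f t * dop (coeff p j) g t + dop (coeff p j) (deriv g) t * (deriv ^^ j) f t)) (at t)"
    unfolding bdf_def[abs_def] by (intro DERIV_sum DERIV_mult smooth_DERIV dop_DERIV assms)
  moreover have "[:[:0, 1:], 1:] * p = Polynomial.smult [:0, 1:] p + pCons 0 p" by simp
  then have "bdf ([:[:0, 1:], 1:] * p) f g t = bdf p (deriv f) g t + bdf p f (deriv g) t"
    by (simp only: bdf_add bdf_smult_eta bdf_pCons) simp
  ultimately show ?thesis by (simp add: bdf_def sum.distrib funpow_swap1 mult.commute)
qed

text \<open>The two-variable polynomial \<open>a(\<zeta>) b(\<eta>)\<close>.\<close>

definition tensor :: "real poly \<Rightarrow> real poly \<Rightarrow> real poly poly" where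
  "tensor a b = Polynomial.smult b (map_poly (\<lambda>c. [:c:]) a)"

lemma tensor_pCons: "tensor (pCons c a) b = pCons (Polynomial.smult c b) (tensor a b)"
proof -
  have "b * [:c:] = Polynomial.smult c b" by simp
  then show ?thesis unfolding tensor_def
    by (cases "c = 0 \<and> a = 0") (auto simp: map_poly_pCons simp del: mult_pCons_right)
qed

lemma bdf_tensor: "bdf (tensor a b) f g t = dop a f t * dop b g t"
proof (induction a arbitrary: f)
  case (pCons c a)
  have "tensor (pCons c a) b = pCons (Polynomial.smult c b) (tensor a b)"
    by (rule tensor_pCons)
  then show ?case using pCons.IH[of "deriv f"] by (simp add: bdf_pCons dop_pCons dop_smult algebra_simps)
qed (simp add: tensor_def)

text \<open>Evaluating the outer variable at an inner polynomial is a substitution for \<zeta>. With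
  \<open>q\<close> equal to \<open>-\<eta>\<close> it yields \<open>a(-\<eta>) b(\<eta>)\<close>,
  the quantity that decides divisibility by \<zeta> + \<eta>.\<close>

lemma poly_tensor: "poly (tensor a b) q = pcompose a q * b"
proof (induction a)
  case (pCons c a)
  have "tensor (pCons c a) b = pCons (Polynomial.smult c b) (tensor a b)"
    by (rule tensor_pCons)
  then show ?case using pCons.IH by (simp add: pcompose_pCons algebra_simps)
qed (simp add: tensor_def)

text \<open>Extending the sum from the support to a full square of exponents adds only zeros and
  lets the sums over exponents and over matrix entries be exchanged.\<close>

lemma qdf_bdf:
  assumes \<Psi>: "\<Psi> \<in> carrier_mat n n" and w: "\<And>t. w t \<in> carrier_vec n"
  shows "qdf \<Psi> w t = (\<Sum>a<n. \<Sum>b<n. bdf (\<Psi> $$ (a, b)) (\<lambda>s. w s $ a) (\<lambda>s. w s $ b) t)"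
proof -
  define D where "D a k = (deriv ^^ k) (\<lambda>s. w s $ a) t" for a k
  have nd: "nth_deriv k w t = vec n (\<lambda>a. D a k)" for k
    using w[of t] by (simp add: nth_deriv_def D_def)
  define c where "c a b j k = coeff (coeff (\<Psi> $$ (a, b)) j) k" for a b j k
  \<comment> \<open>A crude common bound: every outer or inner degree that occurs is one of the
    summands.\<close>
  define N where "N = (\<Sum>a<n. \<Sum>b<n. degree (\<Psi> $$ (a, b)) + (\<Sum>j\<le>degree (\<Psi> $$ (a, b)). degree (coeff (\<Psi> $$ (a, b)) j)))"
  have N: "degree (\<Psi> $$ (a, b)) + (\<Sum>j\<le>degree (\<Psi> $$ (a, b)). degree (coeff (\<Psi> $$ (a, b)) j)) \<le> N"
    if "a < n" "b < n" for a b
  proof -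
    have "degree (\<Psi> $$ (a, b)) + (\<Sum>j\<le>degree (\<Psi> $$ (a, b)). degree (coeff (\<Psi> $$ (a, b)) j)) \<le>
        (\<Sum>b<n. degree (\<Psi> $$ (a, b)) + (\<Sum>j\<le>degree (\<Psi> $$ (a, b)). degree (coeff (\<Psi> $$ (a, b)) j)))"
      using that by (intro member_le_sum) auto
    also have "\<dots> \<le> N" unfolding N_def using that by (intro member_le_sum[where f = "\<lambda>a. \<Sum>b<n. _ a b"]) auto
    finally show ?thesis .
  qed
  have N1: "degree (\<Psi> $$ (a, b)) \<le> N" if "a < n" "b < n" for a b using N[OF that] by simp
  have N2: "degree (coeff (\<Psi> $$ (a, b)) j) \<le> N" if "a < n" "b < n" for a b j
  proof (cases "j \<le> degree (\<Psi> $$ (a, b))")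
    case True
    then have "degree (coeff (\<Psi> $$ (a, b)) j) \<le> (\<Sum>j\<le>degree (\<Psi> $$ (a, b)). degree (coeff (\<Psi> $$ (a, b)) j))"
      by (intro member_le_sum) auto
    then show ?thesis using N[OF that] by simp
  qed (simp add: coeff_eq_0)
  define X where "X = {..N} \<times> {..N}"
  have tm: "nth_deriv j w t \<bullet> (coeff_mat \<Psi> j k *\<^sub>v nth_deriv k w t) =
      (\<Sum>a<n. \<Sum>b<n. D a j * (c a b j k * D b k))" for j k
    using \<Psi> by (simp add: nd coeff_mat_def scalar_prod_def c_def sum_distrib_left atLeast0LessThan)
  have sup: "coeff_support \<Psi> \<subseteq> X"
  proof
    fix x assume "x \<in> coeff_support \<Psi>"
    then obtain j k where x: "x = (j, k)" and nz: "coeff_mat \<Psi> j k \<noteq> 0\<^sub>m n n"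
      using \<Psi> by (auto simp: coeff_support_def)
    have "\<exists>a b. a < n \<and> b < n \<and> c a b j k \<noteq> 0"
    proof (rule ccontr)
      assume "\<not> ?thesis"
      then have "coeff_mat \<Psi> j k = 0\<^sub>m n n" using \<Psi> by (intro eq_matI) (auto simp: coeff_mat_def c_def)
      then show False using nz by simp
    qed
    then obtain a b where ab: "a < n" "b < n" "c a b j k \<noteq> 0" by blast
    have "k \<le> degree (coeff (\<Psi> $$ (a, b)) j)" using ab(3) unfolding c_def by (rule le_degree)
    moreover have "j \<le> degree (\<Psi> $$ (a, b))" using ab(3) unfolding c_def by (intro le_degree) auto
    ultimately show "x \<in> X" using N1[OF ab(1,2)] N2[OF ab(1,2), of j] by (auto simp: X_def x)
  qed
  have "qdf \<Psi> w t = (\<Sum>(j, k)\<in>coeff_support \<Psi>. \<Sum>a<n. \<Sum>b<n. D a j * (c a b j k * D b k))"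
    unfolding qdf_def by (simp add: tm)
  also have "\<dots> = (\<Sum>(j, k)\<in>X. \<Sum>a<n. \<Sum>b<n. D a j * (c a b j k * D b k))"
  proof (rule sum.mono_neutral_left)
    show "\<forall>x\<in>X - coeff_support \<Psi>. (case x of (j, k) \<Rightarrow> \<Sum>a<n. \<Sum>b<n. D a j * (c a b j k * D b k)) = 0"
    proof (clarify)
      fix j k assume "(j, k) \<notin> coeff_support \<Psi>"
      then have z: "coeff_mat \<Psi> j k = 0\<^sub>m n n" using \<Psi> by (auto simp: coeff_support_def)
      have "c a b j k = 0" if "a < n" "b < n" for a b
        using arg_cong[OF z, of "\<lambda>A. A $$ (a, b)"] \<Psi> that by (simp add: coeff_mat_def c_def)
      then show "(\<Sum>a<n. \<Sum>b<n. D a j * (c a b j k * D b k)) = 0" by simp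
    qed
  qed (use sup in \<open>auto simp: X_def\<close>)
  also have "\<dots> = (\<Sum>j\<le>N. \<Sum>k\<le>N. \<Sum>a<n. \<Sum>b<n. D a j * (c a b j k * D b k))"
    unfolding X_def by (rule sum.cartesian_product[symmetric])
  also have "\<dots> = (\<Sum>a<n. \<Sum>b<n. \<Sum>j\<le>N. \<Sum>k\<le>N. D a j * (c a b j k * D b k))"
    by (simp only: sum.swap[where A = "{..N}" and B = "{..<n}"])
  also have "\<dots> = (\<Sum>a<n. \<Sum>b<n. bdf (\<Psi> $$ (a, b)) (\<lambda>s. w s $ a) (\<lambda>s. w s $ b) t)"
  proof (intro sum.cong refl)
    fix a b assume "a \<in> {..<n}" "b \<in> {..<n}"
    then have ab: "a < n" "b < n" by auto
    show "(\<Sum>j\<le>N. \<Sum>k\<le>N. D a j * (c a b j k * D b k)) = bdf (\<Psi> $$ (a, b)) (\<lambda>s. w s $ a) (\<lambda>s. w s $ b) t"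
      unfolding bdf_bound[OF N1[OF ab]] dop_bound[OF N2[OF ab]]
      by (simp add: sum_distrib_left D_def c_def)
  qed
  finally show ?thesis .
qed

section \<open>Derivatives of quadratic differential forms along trajectories\<close>

lemma smooth_trajectoriesD:
  fixes w :: "real \<Rightarrow> real vec"
  assumes "w \<in> smooth_trajectories n"
  shows "w t \<in> carrier_vec n" "i < n \<Longrightarrow> smooth (\<lambda>s. w s $ i)"
  using assms by (auto simp: smooth_trajectories_def)

lemma qdf_DERIV:
  assumes \<Psi>: "\<Psi> \<in> carrier_mat n n" and w: "w \<in> smooth_trajectories n"
  shows "(qdf \<Psi> w has_real_derivative
     (\<Sum>a<n. \<Sum>b<n. bdf ([:[:0, 1:], 1:] * \<Psi> $$ (a, b)) (\<lambda>s. w s $ a) (\<lambda>s. w s $ b) t)) (at t)"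
proof -
  note w = smooth_trajectoriesD[OF w]
  have "qdf \<Psi> w = (\<lambda>t. \<Sum>a<n. \<Sum>b<n. bdf (\<Psi> $$ (a, b)) (\<lambda>s. w s $ a) (\<lambda>s. w s $ b) t)"
    using qdf_bdf[OF \<Psi> w(1)] by auto
  then show ?thesis by (simp only:) (intro DERIV_sum bdf_DERIV w(2); simp)
qed

lemma diff_op_index:
  fixes w :: "real \<Rightarrow> real vec"
  shows "i < dim_row R \<Longrightarrow> diff_op R w t $ i = (\<Sum>j<dim_col R. dop (R $$ (i, j)) (\<lambda>s. w s $ j) t)"
  by (simp add: diff_op_def dop_def)

lemma quadratic_form_index:
  fixes v :: "real vec"
  assumes "\<Sigma> \<in> carrier_mat n n" "v \<in> carrier_vec n"
  shows "v \<bullet> (\<Sigma> *\<^sub>v v) = (\<Sum>a<n. \<Sum>b<n. \<Sigma> $$ (a, b) * (v $ a * v $ b))"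
  using assms by (simp add: scalar_prod_def sum_distrib_left atLeast0LessThan mult_ac)

text \<open>Substituting \<open>\<zeta> = -\<eta>\<close> in the two-variable matrix of \<open>w\<^sup>T\<Sigma>w - |Lw|\<^sup>2 - 2(Vw)\<^sup>T(Rw)\<close> gives zero by
  hypothesis, so this matrix is divisible by \<open>\<zeta> + \<eta>\<close>; the quotient is a storage function.\<close>

lemma dissipative_kernel_behavior:
  assumes R: "R \<in> carrier_mat g n" and \<Sigma>: "\<Sigma> \<in> carrier_mat n n"
    and id: "\<And>a b. a < n \<Longrightarrow> b < n \<Longrightarrow> [:\<Sigma> $$ (a, b):] =
      (\<Sum>k<l. pcompose (L k a) [:0, -1:] * L k b) +
      (\<Sum>k<g. pcompose (V k a) [:0, -1:] * R $$ (k, b) + pcompose (R $$ (k, a)) [:0, -1:] * V k b)"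
  shows "dissipative n \<Sigma> (kernel_behavior R)"
proof -
  define \<Xi> where "\<Xi> a b = tensor [:\<Sigma> $$ (a, b):] 1 - (\<Sum>k<l. tensor (L k a) (L k b)) -
    (\<Sum>k<g. tensor (V k a) (R $$ (k, b)) + tensor (R $$ (k, a)) (V k b))" for a b
  have "[:[:0, 1:], 1:] dvd \<Xi> a b" if "a < n" "b < n" for a b
  proof -
    have "poly (\<Xi> a b) [:0, -1:] = [:\<Sigma> $$ (a, b):] - (\<Sum>k<l. pcompose (L k a) [:0, -1:] * L k b) -
      (\<Sum>k<g. pcompose (V k a) [:0, -1:] * R $$ (k, b) + pcompose (R $$ (k, a)) [:0, -1:] * V k b)"
      unfolding \<Xi>_def by (simp add: poly_sum poly_tensor pcompose_pCons)
    then have "poly (\<Xi> a b) [:0, -1:] = 0" unfolding id[OF that] by simp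
    then have "[:- [:0, -1:], 1:] dvd \<Xi> a b" by (simp only: poly_eq_0_iff_dvd)
    then show ?thesis by simp
  qed
  then have "\<forall>a b. \<exists>q. a < n \<longrightarrow> b < n \<longrightarrow> \<Xi> a b = [:[:0, 1:], 1:] * q" by (metis dvdE)
  then obtain q where q: "\<And>a b. a < n \<Longrightarrow> b < n \<Longrightarrow> \<Xi> a b = [:[:0, 1:], 1:] * q a b" by metis
  define \<Psi> where "\<Psi> = mat n n (\<lambda>(a, b). q a b)"
  have \<Psi>: "\<Psi> \<in> carrier_mat n n" by (simp add: \<Psi>_def)
  have "deriv (qdf \<Psi> w) t \<le> w t \<bullet> (\<Sigma> *\<^sub>v w t)" if w: "w \<in> kernel_behavior R" for w t
  proof -
    have ws: "w \<in> smooth_trajectories n" and ker: "diff_op R w t = 0\<^sub>v g"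
      using w R by (auto simp: kernel_behavior_def)
    define x where "x a = (\<lambda>s. w s $ a)" for a
    have Rw: "(\<Sum>b<n. dop (R $$ (k, b)) (x b) t) = 0" if "k < g" for k
      using diff_op_index[of k R w t] R that by (simp add: ker x_def)
    have "deriv (qdf \<Psi> w) t = (\<Sum>a<n. \<Sum>b<n. bdf (\<Xi> a b) (x a) (x b) t)"
      unfolding DERIV_imp_deriv[OF qdf_DERIV[OF \<Psi> ws]] x_def
      by (intro sum.cong refl) (simp add: \<Psi>_def q del: mult_pCons_left)
    also have "\<dots> = (\<Sum>a<n. \<Sum>b<n. \<Sigma> $$ (a, b) * (x a t * x b t)) -
        (\<Sum>a<n. \<Sum>b<n. \<Sum>k<l. dop (L k a) (x a) t * dop (L k b) (x b) t) -
        (\<Sum>a<n. \<Sum>b<n. \<Sum>k<g. dop (V k a) (x a) t * dop (R $$ (k, b)) (x b) t) -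
        (\<Sum>a<n. \<Sum>b<n. \<Sum>k<g. dop (R $$ (k, a)) (x a) t * dop (V k b) (x b) t)"
      unfolding \<Xi>_def bdf_diff bdf_sum bdf_add bdf_tensor
      by (simp add: sum_subtractf sum.distrib dop_pCons one_pCons algebra_simps)
    also have "(\<Sum>a<n. \<Sum>b<n. \<Sum>k<l. dop (L k a) (x a) t * dop (L k b) (x b) t) =
        (\<Sum>k<l. (\<Sum>a<n. dop (L k a) (x a) t)\<^sup>2)"
      unfolding power2_eq_square sum_product
      by (simp only: sum.swap[where A = "{..<n}" and B = "{..<l}"])
    also have "(\<Sum>a<n. \<Sum>b<n. \<Sum>k<g. dop (V k a) (x a) t * dop (R $$ (k, b)) (x b) t) =
        (\<Sum>k<g. (\<Sum>a<n. dop (V k a) (x a) t) * (\<Sum>b<n. dop (R $$ (k, b)) (x b) t))"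
      unfolding sum_product by (simp only: sum.swap[where A = "{..<n}" and B = "{..<g}"])
    also have "\<dots> = 0" by (simp add: Rw)
    also have "(\<Sum>a<n. \<Sum>b<n. \<Sum>k<g. dop (R $$ (k, a)) (x a) t * dop (V k b) (x b) t) =
        (\<Sum>k<g. (\<Sum>a<n. dop (R $$ (k, a)) (x a) t) * (\<Sum>b<n. dop (V k b) (x b) t))"
      unfolding sum_product by (simp only: sum.swap[where A = "{..<n}" and B = "{..<g}"])
    also have "\<dots> = 0" by (simp add: Rw)
    finally have "deriv (qdf \<Psi> w) t \<le> (\<Sum>a<n. \<Sum>b<n. \<Sigma> $$ (a, b) * (x a t * x b t))"
      by (simp add: sum_nonneg)
    then show ?thesis
      using quadratic_form_index[OF \<Sigma> smooth_trajectoriesD(1)[OF ws]] by (simp add: x_def)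
  qed
  then show ?thesis using \<Psi> unfolding dissipative_def by blast
qed

section \<open>Exponential trajectories\<close>

text \<open>Real trajectories are described by a complex amplitude, on which a real differential
  operator acts as multiplication by its value at \<open>\<mu>\<close>.\<close>

definition exp_traj :: "complex \<Rightarrow> complex \<Rightarrow> real \<Rightarrow> real" where
  "exp_traj \<mu> c t = Re (c * exp (\<mu> * of_real t))"

lemma exp_traj_DERIV: "(exp_traj \<mu> c has_real_derivative exp_traj \<mu> (c * \<mu>) t) (at t)"
proof -
  have "((\<lambda>z. c * exp (\<mu> * z)) has_field_derivative c * (exp (\<mu> * of_real t) * \<mu>)) (at (of_real t))"
    by (auto intro!: derivative_eq_intros)
  then have "((\<lambda>t. c * exp (\<mu> * of_real t)) has_vector_derivative c * (exp (\<mu> * of_real t) * \<mu>)) (at t)"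
    by (rule has_vector_derivative_real_field)
  then have "((\<lambda>t. Re (c * exp (\<mu> * of_real t))) has_vector_derivative Re (c * (exp (\<mu> * of_real t) * \<mu>))) (at t)"
    by (rule bounded_linear.has_vector_derivative[OF bounded_linear_Re])
  then show ?thesis
    by (simp only: has_real_derivative_iff_has_vector_derivative exp_traj_def[abs_def] mult_ac)
qed

lemma higher_deriv_exp_traj: "(deriv ^^ k) (exp_traj \<mu> c) = exp_traj \<mu> (c * \<mu> ^ k)"
proof (induction k)
  case (Suc k)
  have "(deriv ^^ Suc k) (exp_traj \<mu> c) = deriv (exp_traj \<mu> (c * \<mu> ^ k))" by (simp add: Suc)
  also have "\<dots> = exp_traj \<mu> (c * \<mu> ^ k * \<mu>)" by (rule ext, rule DERIV_imp_deriv, rule exp_traj_DERIV)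
  finally show ?case by (simp add: mult_ac)
qed simp

lemma smooth_exp_traj: "smooth (exp_traj \<mu> c)"
  unfolding smooth_def higher_deriv_exp_traj using exp_traj_DERIV real_differentiable_def by blast

lemma exp_traj_sum: "(\<Sum>k\<in>K. exp_traj \<mu> (c k) t) = exp_traj \<mu> (\<Sum>k\<in>K. c k) t"
  by (simp add: exp_traj_def sum_distrib_right)

abbreviation cpoly :: "real poly \<Rightarrow> complex poly" where "cpoly \<equiv> map_poly of_real"

lemma dop_exp_traj: "dop p (exp_traj \<mu> c) t = exp_traj \<mu> (poly (cpoly p) \<mu> * c) t"
proof -
  have "dop p (exp_traj \<mu> c) t = (\<Sum>k\<le>degree p. exp_traj \<mu> (of_real (coeff p k) * (c * \<mu> ^ k)) t)"
    unfolding dop_def higher_deriv_exp_traj by (intro sum.cong refl) (simp add: exp_traj_def mult.assoc)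
  also have "\<dots> = exp_traj \<mu> (poly (cpoly p) \<mu> * c) t"
    unfolding exp_traj_sum by (simp add: poly_altdef degree_map_poly coeff_map_poly sum_distrib_left mult_ac)
  finally show ?thesis .
qed

definition exp_traj_vec :: "nat \<Rightarrow> complex \<Rightarrow> (nat \<Rightarrow> complex) \<Rightarrow> real \<Rightarrow> real vec" where
  "exp_traj_vec m \<mu> c t = Matrix.vec m (\<lambda>k. exp_traj \<mu> (c k) t)"

lemma exp_traj_vec_index: "k < m \<Longrightarrow> (\<lambda>s. exp_traj_vec m \<mu> c s $ k) = exp_traj \<mu> (c k)"
  by (auto simp: exp_traj_vec_def)

lemma exp_traj_vec_smooth: "exp_traj_vec m \<mu> c \<in> smooth_trajectories m"
  by (auto simp: smooth_trajectories_def exp_traj_vec_index smooth_exp_traj) (simp add: exp_traj_vec_def)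

lemma diff_op_exp_traj_vec:
  assumes "M \<in> carrier_mat n m"
  shows "diff_op M (exp_traj_vec m \<mu> c) = exp_traj_vec n \<mu> (\<lambda>i. \<Sum>k<m. poly (cpoly (M $$ (i, k))) \<mu> * c k)"
proof
  fix t
  show "diff_op M (exp_traj_vec m \<mu> c) t = exp_traj_vec n \<mu> (\<lambda>i. \<Sum>k<m. poly (cpoly (M $$ (i, k))) \<mu> * c k) t"
  proof (rule eq_vecI)
    fix i assume "i < dim_vec (exp_traj_vec n \<mu> (\<lambda>i. \<Sum>k<m. poly (cpoly (M $$ (i, k))) \<mu> * c k) t)"
    then have i: "i < n" by (simp add: exp_traj_vec_def)
    have "diff_op M (exp_traj_vec m \<mu> c) t $ i = (\<Sum>k<m. exp_traj \<mu> (poly (cpoly (M $$ (i, k))) \<mu> * c k) t)"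
      using assms i by (subst diff_op_index) (auto simp: exp_traj_vec_index dop_exp_traj intro!: sum.cong)
    then show "diff_op M (exp_traj_vec m \<mu> c) t $ i =
        exp_traj_vec n \<mu> (\<lambda>i. \<Sum>k<m. poly (cpoly (M $$ (i, k))) \<mu> * c k) t $ i"
      using i by (simp add: exp_traj_sum exp_traj_vec_def)
  qed (use assms in \<open>auto simp: exp_traj_vec_def diff_op_def\<close>)
qed

lemma poly_cpoly_of_real: "poly (cpoly p) (of_real x) = of_real (poly p x)"
  by (induction p) (auto simp: map_poly_pCons)

text \<open>A real exponential with a unit vector as amplitude, sent through \<open>M\<close> and
  \<open>R\<close> and read off at time zero, gives an entry of \<open>R * M\<close> at an arbitrary
  real point.\<close>

lemma image_subset_kernel_mult:
  assumes R: "R \<in> carrier_mat g n" and M: "M \<in> carrier_mat n m"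
    and sub: "image_behavior M \<subseteq> kernel_behavior R"
  shows "R * M = 0\<^sub>m g m"
proof (rule eq_matI)
  fix k l assume "k < dim_row (0\<^sub>m g m)" "l < dim_col (0\<^sub>m g m)"
  then have kl: "k < g" "l < m" by auto
  have "poly ((R * M) $$ (k, l)) x = 0" for x
  proof -
    define c where "c k = (if k = l then 1 else 0 :: complex)" for k
    have "diff_op M (exp_traj_vec m (of_real x) c) \<in> kernel_behavior R"
      using sub M exp_traj_vec_smooth by (auto simp: image_behavior_def)
    then have z: "diff_op R (diff_op M (exp_traj_vec m (of_real x) c)) 0 = 0\<^sub>v g"
      using R by (auto simp: kernel_behavior_def)
    have "exp_traj (of_real x) (\<Sum>j<n. poly (cpoly (R $$ (k, j))) (of_real x) *
        (\<Sum>i<m. poly (cpoly (M $$ (j, i))) (of_real x) * c i)) 0 = 0"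
      using arg_cong[OF z[unfolded diff_op_exp_traj_vec[OF M] diff_op_exp_traj_vec[OF R]], of "\<lambda>v. vec_index v k"] kl
      by (simp add: exp_traj_vec_def)
    moreover have "(\<Sum>i<m. poly (cpoly (M $$ (j, i))) (of_real x) * c i) = of_real (poly (M $$ (j, l)) x)" for j
      using kl by (simp add: c_def poly_cpoly_of_real if_distrib[where f = "\<lambda>y. _ * y"] sum.delta cong: if_cong)
    ultimately have "exp_traj (of_real x) (\<Sum>j<n. poly (cpoly (R $$ (k, j))) (of_real x) *
        of_real (poly (M $$ (j, l)) x)) 0 = 0" by (simp only:)
    then have "(\<Sum>j<n. poly (R $$ (k, j)) x * poly (M $$ (j, l)) x) = 0"
      by (simp add: exp_traj_def poly_cpoly_of_real)
    then show ?thesis using R M kl by (simp add: scalar_prod_def poly_sum atLeast0LessThan)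
  qed
  then show "(R * M) $$ (k, l) = 0\<^sub>m g m $$ (k, l)" using kl by (simp add: poly_all_0_iff_0[symmetric])
qed (use R M in auto)

text \<open>All derivatives return to their initial values, so a storage function has no net change
  over a period.\<close>

lemma bdf_exp_traj_periodic:
  assumes "exp (\<mu> * of_real T) = 1"
  shows "bdf p (exp_traj \<mu> c) (exp_traj \<mu> d) T = bdf p (exp_traj \<mu> c) (exp_traj \<mu> d) 0"
  unfolding bdf_def dop_def higher_deriv_exp_traj by (simp add: exp_traj_def assms)

lemma Re_mult_Re: "Re x * Re y = Re (cnj x * y) / 2 + Re (x * y) / 2"
  by (simp add: field_simps)

text \<open>Integrating the dissipation inequality along \<open>Re (a exp (i\<omega>t))\<close> over one period removes the storage
  function and the second harmonic of the supply rate.\<close>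

lemma dissipative_frequency_nonneg:
  assumes dis: "dissipative n \<Sigma> (image_behavior M)" and M: "M \<in> carrier_mat n m"
    and \<Sigma>: "\<Sigma> \<in> carrier_mat n n" and \<omega>: "\<omega> \<noteq> 0"
    and a: "\<And>i. a i = (\<Sum>k<m. poly (cpoly (M $$ (i, k))) (\<i> * of_real \<omega>) * c k)"
  shows "0 \<le> Re (\<Sum>i<n. \<Sum>j<n. of_real (\<Sigma> $$ (i, j)) * (cnj (a i) * a j))"
proof -
  define \<mu> where "\<mu> = \<i> * of_real \<omega>"
  have \<mu>0: "\<mu> \<noteq> 0" using \<omega> by (simp add: \<mu>_def)
  obtain \<Psi> where \<Psi>: "\<Psi> \<in> carrier_mat n n" and
    di: "\<And>w t. w \<in> image_behavior M \<Longrightarrow> deriv (qdf \<Psi> w) t \<le> w t \<bullet> (\<Sigma> *\<^sub>v w t)"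
    using dis by (auto simp: dissipative_def)
  define w where "w = exp_traj_vec n \<mu> a"
  have ws: "w \<in> smooth_trajectories n" unfolding w_def by (rule exp_traj_vec_smooth)
  have "w = diff_op M (exp_traj_vec m \<mu> c)"
    unfolding w_def diff_op_exp_traj_vec[OF M] \<mu>_def by (intro arg_cong[where f = "exp_traj_vec n _"] ext a)
  then have "w \<in> image_behavior M" using M exp_traj_vec_smooth by (auto simp: image_behavior_def)
  note di = di[OF this]
  have wi: "w t $ i = Re (a i * exp (\<mu> * of_real t))" if "i < n" for i t
    using that by (simp add: w_def exp_traj_vec_def exp_traj_def)
  \<comment> \<open>Half of \<open>\<sigma>\<close> is the mean of the supply rate over a period;
    \<open>\<beta>\<close> is the complex amplitude of its second harmonic, up to the same
    factor.\<close>
  define \<sigma> where "\<sigma> = Re (\<Sum>i<n. \<Sum>j<n. of_real (\<Sigma> $$ (i, j)) * (cnj (a i) * a j))"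
  define \<beta> where "\<beta> = (\<Sum>i<n. \<Sum>j<n. of_real (\<Sigma> $$ (i, j)) * (a i * a j))"
  have e1: "cnj (exp (\<mu> * of_real t)) * exp (\<mu> * of_real t) = 1" for t
  proof -
    have "exp (\<mu> * of_real t) = cis (\<omega> * t)" by (simp add: cis_conv_exp \<mu>_def mult_ac)
    then show ?thesis by (simp add: cis_cnj cis_mult)
  qed
  have e2: "exp (\<mu> * of_real t) * exp (\<mu> * of_real t) = exp (2 * \<mu> * of_real t)" for t
    by (simp add: exp_add[symmetric] algebra_simps)
  have prod: "w t $ i * w t $ j = Re (cnj (a i) * a j) / 2 + Re (a i * a j * exp (2 * \<mu> * of_real t)) / 2"
    if "i < n" "j < n" for i j t
  proof -
    let ?e = "exp (\<mu> * of_real t)"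
    have "cnj (a i * ?e) * (a j * ?e) = cnj (a i) * a j * (cnj ?e * ?e)" by (simp add: mult_ac)
    moreover have "(a i * ?e) * (a j * ?e) = a i * a j * (?e * ?e)" by (simp add: mult_ac)
    ultimately show ?thesis unfolding wi[OF that(1)] wi[OF that(2)] Re_mult_Re
      by (simp only: e1 e2 mult_1_right)
  qed
  have sup: "w t \<bullet> (\<Sigma> *\<^sub>v w t) = \<sigma> / 2 + exp_traj (2 * \<mu>) (\<beta> / 2) t" for t
  proof -
    have "w t \<bullet> (\<Sigma> *\<^sub>v w t) = (\<Sum>i<n. \<Sum>j<n. \<Sigma> $$ (i, j) * (w t $ i * w t $ j))"
      by (rule quadratic_form_index[OF \<Sigma> smooth_trajectoriesD(1)[OF ws]])
    also have "\<dots> = (\<Sum>i<n. \<Sum>j<n. Re (of_real (\<Sigma> $$ (i, j)) * (cnj (a i) * a j)) / 2 +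
        Re (of_real (\<Sigma> $$ (i, j)) * (a i * a j) * exp (2 * \<mu> * of_real t)) / 2)"
      by (intro sum.cong refl) (simp add: prod algebra_simps add_divide_distrib diff_divide_distrib)
    also have "\<dots> = \<sigma> / 2 + Re (\<beta> * exp (2 * \<mu> * of_real t)) / 2"
      by (simp add: \<sigma>_def \<beta>_def sum.distrib sum_divide_distrib[symmetric] sum_distrib_right del: times_complex.sel)
    finally show ?thesis by (simp add: exp_traj_def)
  qed
  define q where "q = qdf \<Psi> w"
  have qD: "(q has_real_derivative deriv q t) (at t)" for t
    using qdf_DERIV[OF \<Psi> ws, of t] unfolding q_def DERIV_imp_deriv[OF qdf_DERIV[OF \<Psi> ws]] .
  \<comment> \<open>Storage minus an antiderivative of the supply rate, hence nonincreasing. The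
    division by \<open>4 * \<mu>\<close> integrates the second harmonic and is where a nonzero
    frequency enters.\<close>
  define F where "F t = q t - \<sigma> / 2 * t - exp_traj (2 * \<mu>) (\<beta> / (4 * \<mu>)) t" for t
  have half: "\<beta> / (4 * \<mu>) * (2 * \<mu>) = \<beta> / 2" using \<mu>0 by (simp add: field_simps)
  have FD: "(F has_real_derivative (deriv q t - \<sigma> / 2 - exp_traj (2 * \<mu>) (\<beta> / 2) t)) (at t)" for t
    unfolding F_def[abs_def]
    by (intro DERIV_diff qD DERIV_cmult_Id exp_traj_DERIV[of "2 * \<mu>" "\<beta> / (4 * \<mu>)", unfolded half])
  \<comment> \<open>The absolute value makes the period positive for negative frequencies as
    well.\<close>
  define T where "T = 2 * pi / \<bar>\<omega>\<bar>"
  have T: "T > 0" using \<omega> by (simp add: T_def)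
  have "F T \<le> F 0"
  proof (rule DERIV_nonpos_imp_nonincreasing[of 0 T F])
    fix t :: real
    show "\<exists>y. (F has_real_derivative y) (at t) \<and> y \<le> 0"
      using FD[of t] di[of t] sup[of t] unfolding q_def[symmetric] by (intro exI conjI) auto
  qed (use T in simp)
  moreover have expT: "exp (\<mu> * of_real T) = 1"
  proof (cases "\<omega> > 0")
    case True
    then have "\<mu> * of_real T = of_real (2 * pi) * \<i>" by (simp add: \<mu>_def T_def field_simps)
    then show ?thesis by (simp add: exp_two_pi_i mult.commute)
  next
    case False
    then have "\<mu> * of_real T = - (of_real (2 * pi) * \<i>)" using \<omega> by (simp add: \<mu>_def T_def field_simps)
    then show ?thesis by (simp add: exp_minus exp_two_pi_i mult.commute)
  qed
  have "q T = q 0"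
    unfolding q_def using qdf_bdf[OF \<Psi> smooth_trajectoriesD(1)[OF ws]]
    by (simp add: w_def exp_traj_vec_index bdf_exp_traj_periodic[OF expT] cong: sum.cong_simp)
  moreover have "exp_traj (2 * \<mu>) (\<beta> / (4 * \<mu>)) T = exp_traj (2 * \<mu>) (\<beta> / (4 * \<mu>)) 0"
    using e2[of T] expT by (simp add: exp_traj_def)
  ultimately have "0 \<le> \<sigma> * T" by (simp add: F_def)
  then show ?thesis using T by (simp add: \<sigma>_def zero_le_mult_iff)
qed

section \<open>The transfer matrix at infinity\<close>

interpretation cpoly_hom: map_poly_comm_ring_hom "of_real :: real \<Rightarrow> complex" ..

text \<open>\<open>eval_fract\<close> refers to lowest terms and so does not visibly respect sums.
  An unreduced numerator and denominator are carried along instead, with a denominator that stays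
  nonzero at \<open>z\<close>.\<close>

lemma sum_Fract_eval:
  assumes "finite K" "\<And>k. k \<in> K \<Longrightarrow> poly (cpoly (snd (quot_of_fract (x k)))) z \<noteq> 0"
  shows "\<exists>a b. (\<Sum>k\<in>K. x k * to_fract (w k)) = Fract a b \<and> poly (cpoly b) z \<noteq> 0 \<and>
    (\<Sum>k\<in>K. eval_fract (x k) z * poly (cpoly (w k)) z) = poly (cpoly a) z / poly (cpoly b) z"
  using assms
proof (induction K rule: finite_induct)
  case empty
  show ?case by (rule exI[of _ 0], rule exI[of _ 1]) (simp add: Zero_fract_def)
next
  case (insert j K)
  then obtain a b where ab: "(\<Sum>k\<in>K. x k * to_fract (w k)) = Fract a b" "poly (cpoly b) z \<noteq> 0"
    "(\<Sum>k\<in>K. eval_fract (x k) z * poly (cpoly (w k)) z) = poly (cpoly a) z / poly (cpoly b) z" by auto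
  define n d where "n = fst (quot_of_fract (x j))" "d = snd (quot_of_fract (x j))"
  have dz: "poly (cpoly d) z \<noteq> 0" using insert.prems by (simp add: n_d_def)
  have nz: "b \<noteq> 0" "d \<noteq> 0" using ab(2) dz by auto
  have "x j * to_fract (w j) = Fract (n * w j) d"
    by (metis Fract_quot_of_fract mult.right_neutral mult_fract n_d_def to_fract_def)
  then have "(\<Sum>k\<in>insert j K. x k * to_fract (w k)) = Fract (n * w j * b + a * d) (d * b)"
    using insert ab nz by (simp add: add_fract)
  moreover have "poly (cpoly (d * b)) z \<noteq> 0" using dz ab(2) by (simp add: cpoly_hom.hom_mult)
  moreover have "(\<Sum>k\<in>insert j K. eval_fract (x k) z * poly (cpoly (w k)) z) =
      poly (cpoly n) z / poly (cpoly d) z * poly (cpoly (w j)) z + poly (cpoly a) z / poly (cpoly b) z"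
    using insert.hyps ab(3) by (simp add: eval_fract_def n_d_def)
  then have "(\<Sum>k\<in>insert j K. eval_fract (x k) z * poly (cpoly (w k)) z) =
      poly (cpoly (n * w j * b + a * d)) z / poly (cpoly (d * b)) z"
    using ab(2) dz by (simp add: cpoly_hom.hom_mult cpoly_hom.hom_add add_frac_eq)
  ultimately show ?case by blast
qed

lemma eventually_nonzero_imaginary_axis:
  assumes "p \<noteq> 0"
  shows "eventually (\<lambda>\<omega>::real. poly (cpoly p) (\<i> * of_real \<omega>) \<noteq> 0) at_top"
proof -
  have "cpoly p \<noteq> 0" using assms by (metis of_real_eq_0_iff map_poly_eq_0_iff of_real_0)
  then have "finite {z. poly (cpoly p) z = 0}" by (rule poly_roots_finite)
  moreover have "inj (\<lambda>\<omega>::real. \<i> * of_real \<omega>)" by (rule injI) simp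
  ultimately have "finite ((\<lambda>\<omega>::real. \<i> * of_real \<omega>) -` {z. poly (cpoly p) z = 0})"
    by (rule finite_vimageI)
  then obtain b where b: "\<And>\<omega>::real. poly (cpoly p) (\<i> * of_real \<omega>) = 0 \<Longrightarrow> \<omega> \<le> b"
    using bdd_above_finite[of "(\<lambda>\<omega>::real. \<i> * of_real \<omega>) -` {z. poly (cpoly p) z = 0}"]
    by (auto simp: bdd_above_def)
  then show ?thesis by (intro eventually_mono[OF eventually_gt_at_top[of b]]) force
qed

lemma transfer_matrix_mult:
  assumes W1: "W1 \<in> carrier_mat m m" and W2: "W2 \<in> carrier_mat l m" and det: "Determinant.det W1 \<noteq> 0"
  shows "transfer_matrix W1 W2 \<in> carrier_mat l m"
    "transfer_matrix W1 W2 * map_mat to_fract W1 = map_mat to_fract W2"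
proof -
  let ?W = "map_mat to_fract W1"
  have W: "?W \<in> carrier_mat m m" using W1 by simp
  have "Determinant.det ?W = to_fract (Determinant.det W1)" 
    by (rule comm_ring_hom.hom_det) (unfold_locales, auto)
  then have "Determinant.det ?W \<noteq> 0" using det by simp
  then have "mat_inverse ?W \<noteq> None"
    using mat_inverse(1)[OF W, where b = "()"] det_non_zero_imp_unit[OF W, where b = "()"] by blast
  then obtain B where B: "mat_inverse ?W = Some B" by blast
  then have BW: "B * ?W = 1\<^sub>m m" "B \<in> carrier_mat m m" using mat_inverse(2)[OF W B] by auto
  have V: "map_mat to_fract W2 \<in> carrier_mat l m" using W2 by simp
  have T: "transfer_matrix W1 W2 = map_mat to_fract W2 * B" by (simp add: transfer_matrix_def B)
  show "transfer_matrix W1 W2 \<in> carrier_mat l m" unfolding T using V BW by simp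
  show "transfer_matrix W1 W2 * ?W = map_mat to_fract W2"
    unfolding T using assoc_mult_mat[OF V BW(2) W] BW(1) V by simp
qed

text \<open>Clearing denominators in an entry of \<open>G W1 = W2\<close> leaves a polynomial
  identity, which can be divided again at a point where no denominator vanishes.\<close>

lemma transfer_matrix_eval:
  assumes W1: "W1 \<in> carrier_mat m m" and W2: "W2 \<in> carrier_mat l m" and det: "Determinant.det W1 \<noteq> 0"
    and G: "G = transfer_matrix W1 W2" and ij: "i < l" "j < m"
    and den: "\<And>k. k < m \<Longrightarrow> poly (cpoly (snd (quot_of_fract (G $$ (i, k))))) z \<noteq> 0"
  shows "poly (cpoly (W2 $$ (i, j))) z = (\<Sum>k<m. eval_fract (G $$ (i, k)) z * poly (cpoly (W1 $$ (k, j))) z)"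
proof -
  note T = transfer_matrix_mult[OF W1 W2 det, folded G]
  obtain a b where ab: "(\<Sum>k<m. G $$ (i, k) * to_fract (W1 $$ (k, j))) = Fract a b" "poly (cpoly b) z \<noteq> 0"
    "(\<Sum>k<m. eval_fract (G $$ (i, k)) z * poly (cpoly (W1 $$ (k, j))) z) = poly (cpoly a) z / poly (cpoly b) z"
    using sum_Fract_eval[of "{..<m}" "\<lambda>k. G $$ (i, k)" z "\<lambda>k. W1 $$ (k, j)"] den by auto
  have "Fract (W2 $$ (i, j)) 1 = (G * map_mat to_fract W1) $$ (i, j)"
    using ij W2 unfolding T(2) by (simp add: to_fract_def)
  also have "\<dots> = Fract a b" unfolding ab(1)[symmetric]
    using ij W1 T(1) by (simp add: scalar_prod_def atLeast0LessThan)
  finally have "W2 $$ (i, j) * b = a"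
    using eq_fract(1)[of 1 b "W2 $$ (i, j)" a] ab(2) by fastforce
  then have "poly (cpoly (W2 $$ (i, j))) z * poly (cpoly b) z = poly (cpoly a) z"
    by (metis cpoly_hom.hom_mult poly_mult)
  then show ?thesis unfolding ab(3) using ab(2) by (simp add: field_simps)
qed

lemma positive_definite_det_nonzero:
  assumes "positive_definite A" "A \<in> carrier_mat m m"
  shows "Determinant.det A \<noteq> 0"
proof
  assume "Determinant.det A = 0"
  then obtain v where v: "v \<in> carrier_vec m" "v \<noteq> 0\<^sub>v m" "A *\<^sub>v v = 0\<^sub>v m"
    using det_0_iff_vec_prod_zero_field[OF assms(2)] by blast
  then have "0 < v \<bullet> (A *\<^sub>v v)" using assms by (auto simp: positive_definite_def)
  then show False using v by simp
qed

lemma tendsto_det: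
  fixes N :: "'b \<Rightarrow> 'a :: {real_normed_field} mat"
  assumes N: "\<And>x. N x \<in> carrier_mat m m" and L: "L \<in> carrier_mat m m"
    and lim: "\<And>i j. i < m \<Longrightarrow> j < m \<Longrightarrow> ((\<lambda>x. N x $$ (i, j)) \<longlongrightarrow> L $$ (i, j)) F"
  shows "((\<lambda>x. Determinant.det (N x)) \<longlongrightarrow> Determinant.det L) F"
  unfolding det_def'[OF N] det_def'[OF L]
proof (intro tendsto_sum tendsto_mult tendsto_const tendsto_prod)
  fix p i assume "p \<in> {p. p permutes {0..<m}}" "i \<in> {0..<m}"
  then have "i < m" "p i < m" using permutes_in_image[of p "{0..<m}" i] by auto
  then show "((\<lambda>x. N x $$ (i, p i)) \<longlongrightarrow> L $$ (i, p i)) F" by (rule lim)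
qed

text \<open>On the imaginary axis the matrix is \<open>W1\<^sup>* (I + G\<^sup>* J G) W1\<close>.
  For large frequencies the middle factor is close to \<open>I + D\<^sup>T J D\<close>, hence
  invertible, while \<open>det W1\<close> and the denominators of \<open>G\<close> have only
  finitely many zeros to avoid.\<close>

lemma supply_det_nonzero:
  fixes J :: "real mat"
  assumes W1: "W1 \<in> carrier_mat m m" and W2: "W2 \<in> carrier_mat l m" and det: "Determinant.det W1 \<noteq> 0"
    and G: "G = transfer_matrix W1 W2" and lim: "has_limit_on_imaginary_axis G D"
    and J: "J \<in> carrier_mat l l" "\<And>i j. i < l \<Longrightarrow> j < l \<Longrightarrow> J $$ (i, j) = (if i = j then s i else 0)"
    and pd: "positive_definite (1\<^sub>m m + transpose_mat D * J * D)"
  obtains \<omega> :: real where "Determinant.det (mat m m (\<lambda>(a, b).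
      (\<Sum>i<m. cnj (poly (cpoly (W1 $$ (i, a))) (\<i> * of_real \<omega>)) * poly (cpoly (W1 $$ (i, b))) (\<i> * of_real \<omega>)) +
      (\<Sum>i<l. of_real (s i) * (cnj (poly (cpoly (W2 $$ (i, a))) (\<i> * of_real \<omega>)) *
         poly (cpoly (W2 $$ (i, b))) (\<i> * of_real \<omega>))))) \<noteq> 0"
proof -
  have Gc: "G \<in> carrier_mat l m" using transfer_matrix_mult(1)[OF W1 W2 det] G by simp
  have D: "D \<in> carrier_mat l m" using lim Gc by (auto simp: has_limit_on_imaginary_axis_def)
  define e where "e i k \<omega> = eval_fract (G $$ (i, k)) (\<i> * of_real \<omega>)" for i k and \<omega> :: real
  have le: "(e i k \<longlongrightarrow> of_real (D $$ (i, k))) at_top" if "i < l" "k < m" for i k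
    using lim Gc that unfolding has_limit_on_imaginary_axis_def e_def by auto
  define N where "N \<omega> = mat m m (\<lambda>(a, b). (if a = b then 1 else 0) + (\<Sum>i<l. of_real (s i) * (cnj (e i a \<omega>) * e i b \<omega>)))" for \<omega>
  define L where "L = 1\<^sub>m m + transpose_mat D * J * D"
  have L: "L \<in> carrier_mat m m" unfolding L_def using D J(1) by auto
  have DJ: "(transpose_mat D * J) $$ (a, i) = D $$ (i, a) * s i" if "a < m" "i < l" for a i
  proof -
    have "(transpose_mat D * J) $$ (a, i) = (\<Sum>k<l. D $$ (k, a) * (if k = i then s k else 0))"
      using that D J by (simp add: scalar_prod_def atLeast0LessThan)
    also have "\<dots> = D $$ (i, a) * s i" using that
      by (simp add: if_distrib[where f = "\<lambda>x. _ * x"] sum.delta cong: if_cong)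
    finally show ?thesis .
  qed
  have Lab: "L $$ (a, b) = (if a = b then 1 else 0) + (\<Sum>i<l. s i * (D $$ (i, a) * D $$ (i, b)))" if "a < m" "b < m" for a b
  proof -
    have "(transpose_mat D * J * D) $$ (a, b) = (\<Sum>i<l. (transpose_mat D * J) $$ (a, i) * D $$ (i, b))"
      using that D J(1) by (simp add: scalar_prod_def atLeast0LessThan del: assoc_mult_mat)
    also have "\<dots> = (\<Sum>i<l. s i * (D $$ (i, a) * D $$ (i, b)))"
      using that by (intro sum.cong) (auto simp: DJ)
    finally show ?thesis unfolding L_def using that D J(1) by simp
  qed
  have "((\<lambda>\<omega>. Determinant.det (N \<omega>)) \<longlongrightarrow> Determinant.det (map_mat of_real L)) at_top"
  proof (rule tendsto_det)
    show "N \<omega> \<in> carrier_mat m m" for \<omega> by (simp add: N_def)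
    show "map_mat of_real L \<in> carrier_mat m m" using L by simp
    fix a b assume ab: "a < m" "b < m"
    have "((\<lambda>\<omega>. (if a = b then 1 else 0) + (\<Sum>i<l. of_real (s i) * (cnj (e i a \<omega>) * e i b \<omega>))) \<longlongrightarrow>
        (if a = b then 1 else 0) + (\<Sum>i<l. of_real (s i) * (cnj (of_real (D $$ (i, a))) * of_real (D $$ (i, b))))) at_top"
      by (intro tendsto_intros le) (use ab in auto)
    then show "((\<lambda>\<omega>. N \<omega> $$ (a, b)) \<longlongrightarrow> map_mat of_real L $$ (a, b)) at_top"
      using ab L by (simp add: N_def Lab if_distrib[of of_real] cong: if_cong)
  qed
  moreover have "Determinant.det (map_mat of_real L) \<noteq> (0 :: complex)"
    using positive_definite_det_nonzero[OF pd[folded L_def] L] by (simp add: comm_ring_hom.hom_det[OF of_real_hom.comm_ring_hom_axioms])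
  ultimately have "eventually (\<lambda>\<omega>. Determinant.det (N \<omega>) \<noteq> 0) at_top" by (rule tendsto_imp_eventually_ne)
  moreover have "eventually (\<lambda>\<omega>::real. poly (cpoly (Determinant.det W1)) (\<i> * of_real \<omega>) \<noteq> 0) at_top"
    by (rule eventually_nonzero_imaginary_axis[OF det])
  moreover have "eventually (\<lambda>\<omega>::real. \<forall>i\<in>{..<l}. \<forall>k\<in>{..<m}. poly (cpoly (snd (quot_of_fract (G $$ (i, k))))) (\<i> * of_real \<omega>) \<noteq> 0) at_top"
    by (intro eventually_ball_finite ballI eventually_nonzero_imaginary_axis) auto
  ultimately have "eventually (\<lambda>\<omega>. Determinant.det (N \<omega>) \<noteq> 0 \<and>
      poly (cpoly (Determinant.det W1)) (\<i> * of_real \<omega>) \<noteq> 0 \<and>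
      (\<forall>i\<in>{..<l}. \<forall>k\<in>{..<m}. poly (cpoly (snd (quot_of_fract (G $$ (i, k))))) (\<i> * of_real \<omega>) \<noteq> 0)) at_top"
    by (intro eventually_conj)
  then obtain \<omega> where \<omega>: "Determinant.det (N \<omega>) \<noteq> 0"
      "poly (cpoly (Determinant.det W1)) (\<i> * of_real \<omega>) \<noteq> 0"
      "\<And>i k. i < l \<Longrightarrow> k < m \<Longrightarrow> poly (cpoly (snd (quot_of_fract (G $$ (i, k))))) (\<i> * of_real \<omega>) \<noteq> 0"
    by (auto dest!: eventually_happens'[OF trivial_limit_at_top_linorder])
  define w1 where "w1 i a = poly (cpoly (W1 $$ (i, a))) (\<i> * of_real \<omega>)" for i a
  define w2 where "w2 i a = poly (cpoly (W2 $$ (i, a))) (\<i> * of_real \<omega>)" for i a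
  define E where "E i k = e i k \<omega>" for i k
  have w2: "w2 i a = (\<Sum>k<m. E i k * w1 k a)" if "i < l" "a < m" for i a
    unfolding w1_def w2_def E_def e_def by (rule transfer_matrix_eval[OF W1 W2 det G that]) (use \<omega>(3) that in auto)
  define C where "C = mat m m (\<lambda>(i, a). w1 i a)"
  define Ch where "Ch = mat m m (\<lambda>(a, i). cnj (w1 i a))"
  have C: "C \<in> carrier_mat m m" and Ch: "Ch \<in> carrier_mat m m" and Nc: "N \<omega> \<in> carrier_mat m m"
    by (auto simp: C_def Ch_def N_def)
  have "mat m m (\<lambda>(a, b). (\<Sum>i<m. cnj (w1 i a) * w1 i b) + (\<Sum>i<l. of_real (s i) * (cnj (w2 i a) * w2 i b))) =
      Ch * N \<omega> * C"
  proof (rule eq_matI)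
    fix a b assume "a < dim_row (Ch * N \<omega> * C)" "b < dim_col (Ch * N \<omega> * C)"
    then have ab: "a < m" "b < m" by (auto simp: Ch_def C_def)
    have "(Ch * N \<omega> * C) $$ (a, b) = (\<Sum>d<m. (\<Sum>c<m. cnj (w1 c a) * ((if c = d then 1 else 0) +
        (\<Sum>i<l. of_real (s i) * (cnj (E i c) * E i d)))) * w1 d b)"
      using ab C Ch Nc
      by (simp add: scalar_prod_def atLeast0LessThan del: assoc_mult_mat) (simp add: Ch_def C_def N_def E_def)
    also have "\<dots> = (\<Sum>d<m. (\<Sum>c<m. cnj (w1 c a) * (if c = d then 1 else 0)) * w1 d b) +
        (\<Sum>d<m. \<Sum>c<m. \<Sum>i<l. of_real (s i) * (cnj (E i c * w1 c a) * (E i d * w1 d b)))"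
      by (simp add: distrib_left distrib_right sum.distrib sum_distrib_left sum_distrib_right mult_ac)
    also have "(\<Sum>d<m. (\<Sum>c<m. cnj (w1 c a) * (if c = d then 1 else 0)) * w1 d b) = (\<Sum>i<m. cnj (w1 i a) * w1 i b)"
      by (simp add: if_distrib[where f = "\<lambda>x. _ * x"] sum.delta cong: if_cong)
    also have "(\<Sum>d<m. \<Sum>c<m. \<Sum>i<l. of_real (s i) * (cnj (E i c * w1 c a) * (E i d * w1 d b))) =
        (\<Sum>i<l. \<Sum>d<m. \<Sum>c<m. of_real (s i) * (cnj (E i c * w1 c a) * (E i d * w1 d b)))"
      by (simp only: sum.swap[where A = "{..<m}" and B = "{..<l}"])
    also have "\<dots> = (\<Sum>i<l. of_real (s i) * (cnj (w2 i a) * w2 i b))"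
    proof (intro sum.cong refl)
      fix i assume "i \<in> {..<l}"
      then have i: "i < l" by simp
      have "(\<Sum>d<m. \<Sum>c<m. of_real (s i) * (cnj (E i c * w1 c a) * (E i d * w1 d b))) =
          of_real (s i) * ((\<Sum>c<m. cnj (E i c * w1 c a)) * (\<Sum>d<m. E i d * w1 d b))"
        by (simp only: sum_product, simp only: sum_distrib_left, rule sum.swap)
      then show "(\<Sum>d<m. \<Sum>c<m. of_real (s i) * (cnj (E i c * w1 c a) * (E i d * w1 d b))) =
          of_real (s i) * (cnj (w2 i a) * w2 i b)"
        by (simp only: w2[OF i ab(1)] w2[OF i ab(2)] cnj_sum)
    qed
    finally show "mat m m (\<lambda>(a, b). (\<Sum>i<m. cnj (w1 i a) * w1 i b) + (\<Sum>i<l. of_real (s i) * (cnj (w2 i a) * w2 i b))) $$ (a, b) =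
      (Ch * N \<omega> * C) $$ (a, b)" using ab by simp
  qed (auto simp: Ch_def C_def)
  moreover have "Determinant.det (Ch * N \<omega> * C) \<noteq> 0"
  proof -
    have dC: "Determinant.det C = poly (cpoly (Determinant.det W1)) (\<i> * of_real \<omega>)"
    proof -
      have "C = map_mat (\<lambda>p. poly p (\<i> * of_real \<omega>)) (map_mat cpoly W1)"
        using W1 by (intro eq_matI) (auto simp: C_def w1_def)
      moreover have "Determinant.det (map_mat cpoly W1) = cpoly (Determinant.det W1)" by (rule cpoly_hom.hom_det)
      ultimately show ?thesis using comm_ring_hom.hom_det[OF poly_hom.comm_ring_hom_axioms] by metis
    qed
    have "Ch = map_mat cnj (transpose_mat C)" by (rule eq_matI) (auto simp: Ch_def C_def)
    then have "Determinant.det Ch = cnj (Determinant.det C)"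
      using cnj_hom.hom_det[of "transpose_mat C"] det_transpose[OF C] by simp
    then show ?thesis using \<omega>(1,2) dC det_mult[OF mult_carrier_mat[OF Ch Nc] C] det_mult[OF Ch Nc] by simp
  qed
  ultimately show ?thesis using that[of \<omega>] unfolding w1_def w2_def by simp
qed

section \<open>Columns, rank and kernels\<close>

text \<open>Translates rank into coordinates: a kernel vector supported on \<open>I\<close> is a
  linear relation among independent columns. Columns of \<open>A\<close> may coincide, so one index
  is chosen for each vector of a maximal independent set.\<close>

lemma independent_columns:
  fixes A :: "'a :: field mat"
  assumes A: "A \<in> carrier_mat k n"
  obtains I where "I \<subseteq> {..<n}" "card I = vec_space.rank k A"
    "\<And>v. v \<in> carrier_vec n \<Longrightarrow> (\<And>i. i < n \<Longrightarrow> i \<notin> I \<Longrightarrow> vec_index v i = 0) \<Longrightarrow> A *\<^sub>v v = 0\<^sub>v k \<Longrightarrow> v = 0\<^sub>v n"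
proof -
  interpret vec_space "TYPE('a)" k .
  have indE: "lin_indpt {}" by (rule finite_lin_indpt2) auto
  obtain S where S: "maximal S (\<lambda>T. T \<subseteq> set (cols A) \<and> lin_indpt T)"
    using maximal_exists_superset[of "set (cols A)" "\<lambda>T. T \<subseteq> set (cols A) \<and> lin_indpt T" "{}"] indE by auto
  then have Sc: "S \<subseteq> set (cols A)" and ind: "lin_indpt S" by (auto simp: maximal_def)
  have rk: "rank A = card S" by (rule rank_card_indpt[OF A S])
  have fin: "finite S" using Sc finite_subset by blast
  have "\<forall>s\<in>S. \<exists>i<n. col A i = s"
    using Sc A by (metis carrier_matD(2) cols_length cols_nth in_set_conv_nth subsetD)
  then obtain f where f: "\<And>s. s \<in> S \<Longrightarrow> f s < n" "\<And>s. s \<in> S \<Longrightarrow> col A (f s) = s" by metis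
  have inj: "inj_on f S" by (rule inj_onI) (metis f(2))
  obtain xs where xs: "set xs = S" "distinct xs" using finite_distinct_list[OF fin] by blast
  have Sk: "S \<subseteq> carrier_vec k" using Sc A cols_dim by blast
  define A' where "A' = mat_of_cols k xs"
  have A': "A' \<in> carrier_mat k (length xs)" by (simp add: A'_def)
  have cA': "cols A' = xs" unfolding A'_def using Sk xs by (intro cols_mat_of_cols) auto
  have bij: "bij_betw (\<lambda>j. f (xs ! j)) {..<length xs} (f ` S)"
  proof -
    have "bij_betw ((!) xs) {..<length xs} S" using xs bij_betw_nth by blast
    then show ?thesis using bij_betw_trans[of "(!) xs" "{..<length xs}" S f "f ` S"] inj
      by (auto simp: comp_def inj_on_imp_bij_betw)
  qed
  show ?thesis
  proof (rule that[of "f ` S"])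
    show "f ` S \<subseteq> {..<n}" using f by auto
    show "card (f ` S) = rank A" using rk inj by (simp add: card_image)
    fix v :: "'a vec"
    assume v: "v \<in> carrier_vec n" and sup: "\<And>i. i < n \<Longrightarrow> i \<notin> f ` S \<Longrightarrow> vec_index v i = 0"
      and Av: "A *\<^sub>v v = 0\<^sub>v k"
    define v' where "v' = Matrix.vec (length xs) (\<lambda>j. vec_index v (f (xs ! j)))"
    have v': "v' \<in> carrier_vec (length xs)" by (simp add: v'_def)
    have "A' *\<^sub>v v' = 0\<^sub>v k"
    proof (rule eq_vecI)
      fix r assume "r < dim_vec (0\<^sub>v k :: 'a vec)"
      then have r: "r < k" by simp
      have ent: "vec_index (xs ! j) r = A $$ (r, f (xs ! j))" if "j < length xs" for j
        using f[of "xs ! j"] that xs(1) A r by (metis carrier_matD index_col nth_mem)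
      have "vec_index (A' *\<^sub>v v') r = (\<Sum>j<length xs. A $$ (r, f (xs ! j)) * vec_index v (f (xs ! j)))"
        using A' r ent by (simp add: v'_def scalar_prod_def atLeast0LessThan A'_def mat_of_cols_index)
      also have "\<dots> = (\<Sum>i\<in>f ` S. A $$ (r, i) * vec_index v i)"
        by (rule sum.reindex_bij_betw[OF bij])
      also have "\<dots> = (\<Sum>i<n. A $$ (r, i) * vec_index v i)"
        by (rule sum.mono_neutral_left) (use f sup in auto)
      also have "\<dots> = vec_index (A *\<^sub>v v) r" using A v r by (simp add: scalar_prod_def atLeast0LessThan)
      finally show "vec_index (A' *\<^sub>v v') r = vec_index (0\<^sub>v k) r" using Av r by simp
    qed (use A' in simp)
    then have v'0: "v' = 0\<^sub>v (length xs)"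
      using lin_depI[OF A' v'] ind xs cA' by metis
    show "v = 0\<^sub>v n"
    proof (rule eq_vecI)
      fix i assume "i < dim_vec (0\<^sub>v n :: 'a vec)"
      then have i: "i < n" by simp
      show "vec_index v i = vec_index (0\<^sub>v n) i"
      proof (cases "i \<in> f ` S")
        case True
        then obtain j where j: "j < length xs" "i = f (xs ! j)" using xs(1) by (metis imageE in_set_conv_nth)
        have "vec_index v' j = 0" using v'0 j by simp
        then show ?thesis using j i by (simp add: v'_def)
      qed (use sup i in simp)
    qed (use v in simp)
  qed
qed

text \<open>Full rank makes the set of independent column indices all of \<open>{..<n}\<close>, so
  the support condition is empty.\<close>

lemma full_column_rank_injective:
  fixes A :: "'a :: field mat"
  assumes A: "A \<in> carrier_mat k n" and rk: "vec_space.rank k A = n"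
    and v: "v \<in> carrier_vec n" "A *\<^sub>v v = 0\<^sub>v k"
  shows "v = 0\<^sub>v n"
proof -
  obtain I where I: "I \<subseteq> {..<n}" "card I = vec_space.rank k A"
    "\<And>v. v \<in> carrier_vec n \<Longrightarrow> (\<And>i. i < n \<Longrightarrow> i \<notin> I \<Longrightarrow> vec_index v i = 0) \<Longrightarrow> A *\<^sub>v v = 0\<^sub>v k \<Longrightarrow> v = 0\<^sub>v n"
    using independent_columns[OF A] by blast
  have "I = {..<n}" using I(1,2) rk by (intro card_subset_eq) auto
  then show ?thesis using I(3) v by auto
qed

text \<open>The kernel vectors are determined by their coordinates outside a set of independent columns,
  and on these coordinates \<open>M\<close> restricts to an invertible square matrix.\<close>

lemma kernel_subset_image:
  fixes A M :: "'a :: field mat"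
  assumes A: "A \<in> carrier_mat k n" and M: "M \<in> carrier_mat n m" and AM: "A * M = 0\<^sub>m k m"
    and inj: "\<And>y. y \<in> carrier_vec m \<Longrightarrow> M *\<^sub>v y = 0\<^sub>v n \<Longrightarrow> y = 0\<^sub>v m"
    and mn: "m \<le> n" and rk: "n - m \<le> vec_space.rank k A"
    and x: "x \<in> carrier_vec n" "A *\<^sub>v x = 0\<^sub>v k"
  shows "\<exists>y\<in>carrier_vec m. x = M *\<^sub>v y"
proof -
  obtain I where I: "I \<subseteq> {..<n}" "card I = vec_space.rank k A"
    "\<And>v. v \<in> carrier_vec n \<Longrightarrow> (\<And>i. i < n \<Longrightarrow> i \<notin> I \<Longrightarrow> vec_index v i = 0) \<Longrightarrow> A *\<^sub>v v = 0\<^sub>v k \<Longrightarrow> v = 0\<^sub>v n"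
    using independent_columns[OF A] by blast
  \<comment> \<open>Shrinking \<open>I\<close> to exactly \<open>n - m\<close> indices gives the
    complement \<open>m\<close> elements, as a square block of \<open>M\<close> requires. Vanishing
    on this larger complement still forces a kernel vector to be zero.\<close>
  obtain I' where I': "I' \<subseteq> I" "card I' = n - m" "finite I'"
    using obtain_subset_with_card_n[of "n - m" I] rk I(2) by auto
  define C where "C = {..<n} - I'"
  have "card C = m" unfolding C_def using I' I(1) mn by (subst card_Diff_subset) auto
  moreover have "finite C" by (simp add: C_def)
  ultimately obtain e where e: "bij_betw e {0..<m} C" using ex_bij_betw_nat_finite by metis
  have en: "e r < n" if "r < m" for r using e that by (auto simp: bij_betw_def C_def)
  have eC: "\<exists>r<m. i = e r" if "i < n" "i \<notin> I" for i
  proof -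
    have "i \<in> e ` {0..<m}" using e that I'(1) by (auto simp: bij_betw_def C_def)
    then show ?thesis by auto
  qed
  define Mc where "Mc = mat m m (\<lambda>(r, c). M $$ (e r, c))"
  have Mc: "Mc \<in> carrier_mat m m" by (simp add: Mc_def)
  have Mcy: "vec_index (Mc *\<^sub>v y) r = vec_index (M *\<^sub>v y) (e r)" if "r < m" "y \<in> carrier_vec m" for r y
    using that en M by (simp add: Mc_def scalar_prod_def)
  have AMy: "A *\<^sub>v (M *\<^sub>v y) = 0\<^sub>v k" if "y \<in> carrier_vec m" for y
    
  proof -
    have "0\<^sub>m k m *\<^sub>v y = 0\<^sub>v k" using that by (intro eq_vecI) (auto simp: scalar_prod_def)
    then show ?thesis using assoc_mult_mat_vec[OF A M that] unfolding AM by simp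
  qed
  have zero: "v = 0\<^sub>v n" if v: "v \<in> carrier_vec n" "A *\<^sub>v v = 0\<^sub>v k" "\<And>r. r < m \<Longrightarrow> vec_index v (e r) = 0" for v
    by (rule I(3)[OF v(1) _ v(2)]) (use eC v(3) in blast)
  have det: "Determinant.det Mc \<noteq> 0"
  proof
    assume "Determinant.det Mc = 0"
    then obtain y where y: "y \<in> carrier_vec m" "y \<noteq> 0\<^sub>v m" "Mc *\<^sub>v y = 0\<^sub>v m"
      using det_0_iff_vec_prod_zero_field[OF Mc] by blast
    have "M *\<^sub>v y = 0\<^sub>v n"
    proof (rule zero)
      show "M *\<^sub>v y \<in> carrier_vec n" using M y by simp
      show "A *\<^sub>v (M *\<^sub>v y) = 0\<^sub>v k" using AMy y by blast
      show "vec_index (M *\<^sub>v y) (e r) = 0" if "r < m" for r using Mcy[OF that y(1)] y(3) that by simp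
    qed
    then show False using inj y by blast
  qed
  define xc where "xc = Matrix.vec m (\<lambda>r. vec_index x (e r))"
  have xc: "xc \<in> carrier_vec m" by (simp add: xc_def)
  note adj = adj_mat[OF Mc]
  \<comment> \<open>The solution of the square system, chosen so that \<open>M *\<^sub>v y\<close>
    and \<open>x\<close> agree on the selected coordinates; their difference is then a kernel vector
    that vanishes there.\<close>
  define y where "y = (1 / Determinant.det Mc) \<cdot>\<^sub>v (adj_mat Mc *\<^sub>v xc)"
  have y: "y \<in> carrier_vec m" using adj(1) xc by (simp add: y_def)
  have "Mc *\<^sub>v y = (1 / Determinant.det Mc) \<cdot>\<^sub>v ((Mc * adj_mat Mc) *\<^sub>v xc)"
    unfolding y_def using Mc adj(1) xc by (simp add: mult_mat_vec[of _ m m] assoc_mult_mat_vec[of _ m m _ m])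
  also have "\<dots> = xc"
    unfolding adj(2) using det xc by (intro eq_vecI) (auto simp: scalar_prod_def if_distrib[where f = "\<lambda>a. _ * a"] if_distrib[where f = "\<lambda>a. a * _"] sum.delta cong: if_cong)
  finally have Mcyx: "Mc *\<^sub>v y = xc" .
  have My: "M *\<^sub>v y \<in> carrier_vec n" using M y by simp
  have "x - M *\<^sub>v y = 0\<^sub>v n"
  proof (rule zero)
    show "x - M *\<^sub>v y \<in> carrier_vec n" using x My by simp
    show "A *\<^sub>v (x - M *\<^sub>v y) = 0\<^sub>v k" using mult_minus_distrib_mat_vec[OF A x(1) My] x(2) AMy[OF y] by simp
    show "vec_index (x - M *\<^sub>v y) (e r) = 0" if "r < m" for r
      using Mcy[OF that y] that en[OF that] x M by (simp add: Mcyx xc_def)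
  qed
  then have "x = M *\<^sub>v y" using x My
    by (metis carrier_vecD eq_vecI index_minus_vec(1) index_zero_vec(1) right_minus_eq)
  then show ?thesis using y by blast
qed

section \<open>From the imaginary axis to real differential operators\<close>

definition axis_poly :: "real poly \<Rightarrow> complex poly" where
  "axis_poly p = pcompose (cpoly p) [:0, \<i>:]"

interpretation axis_poly: comm_ring_hom axis_poly
  by unfold_locales (simp_all add: axis_poly_def pcompose_add pcompose_mult cpoly_hom.hom_mult cpoly_hom.hom_add)

lemma poly_axis_poly: "poly (axis_poly p) z = poly (cpoly p) (\<i> * z)"
  by (simp add: axis_poly_def poly_pcompose mult.commute)

lemma cnjp_pcompose: "cnjp (pcompose p q) = pcompose (cnjp p) (cnjp q)"
  by (induction p) (auto simp: pcompose_pCons map_poly_pCons cnjp.hom_add cnjp.hom_mult)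

lemma pcompose_axis_poly: "pcompose (axis_poly p) [:0, - \<i>:] = cpoly p"
  by (simp add: axis_poly_def pcompose_assoc[symmetric] pcompose_pCons)

text \<open>Back in the variable \<xi>, conjugating coefficients in \<open>x\<close> becomes
  conjugating coefficients together with the sign change of \<xi>.\<close>

lemma pcompose_cnjp:
  "pcompose (cnjp p) [:0, - \<i>:] = pcompose (cnjp (pcompose p [:0, - \<i>:])) [:0, -1:]"
  by (simp add: cnjp_pcompose pcompose_assoc[symmetric] map_poly_pCons pcompose_pCons)

lemma cpoly_const: "cpoly [:x:] = [:of_real x:]"
  by (rule poly_eqI) (simp add: coeff_map_poly coeff_pCons split: nat.split)

section \<open>Real and imaginary parts of coefficients\<close>

abbreviation re_poly :: "complex poly \<Rightarrow> real poly" where "re_poly \<equiv> map_poly Re"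
abbreviation im_poly :: "complex poly \<Rightarrow> real poly" where "im_poly \<equiv> map_poly Im"

lemma re_poly_add: "re_poly (p + q) = re_poly p + re_poly q"
  by (rule poly_eqI) (simp add: coeff_map_poly)

lemma re_poly_sum: "re_poly (\<Sum>k\<in>K. p k) = (\<Sum>k\<in>K. re_poly (p k))"
  by (induction K rule: infinite_finite_induct) (auto simp: re_poly_add)

lemma re_poly_cpoly [simp]: "re_poly (cpoly r) = r"
  and im_poly_cpoly [simp]: "im_poly (cpoly r) = 0"
  by (rule poly_eqI, simp add: coeff_map_poly)+

lemma re_poly_mult: "re_poly (p * q) = re_poly p * re_poly q - im_poly p * im_poly q"
  by (rule poly_eqI) (simp add: coeff_map_poly coeff_mult sum_subtractf)

lemma coeff_pcompose_neg: "coeff (pcompose p [:0, -1:]) k = (-1) ^ k * coeff (p :: 'a :: comm_ring_1 poly) k"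
proof (induction p arbitrary: k)
  case (pCons a p)
  then show ?case by (cases k) (auto simp: pcompose_pCons)
qed simp

lemma re_poly_pcompose: "re_poly (pcompose p [:0, -1:]) = pcompose (re_poly p) [:0, -1:]"
  and im_poly_pcompose: "im_poly (pcompose p [:0, -1:]) = pcompose (im_poly p) [:0, -1:]"
proof -
  show "re_poly (pcompose p [:0, -1:]) = pcompose (re_poly p) [:0, -1:]"
  proof (rule poly_eqI)
    fix k show "coeff (re_poly (pcompose p [:0, -1:])) k = coeff (pcompose (re_poly p) [:0, -1:]) k"
      by (cases "even k") (simp_all add: coeff_map_poly coeff_pcompose_neg)
  qed
  show "im_poly (pcompose p [:0, -1:]) = pcompose (im_poly p) [:0, -1:]"
  proof (rule poly_eqI)
    fix k show "coeff (im_poly (pcompose p [:0, -1:])) k = coeff (pcompose (im_poly p) [:0, -1:]) k"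
      by (cases "even k") (simp_all add: coeff_map_poly coeff_pcompose_neg)
  qed
qed

lemma re_poly_cnjp: "re_poly (cnjp p) = re_poly p"
  and im_poly_cnjp: "im_poly (cnjp p) = - im_poly p"
  by (rule poly_eqI, simp add: coeff_map_poly)+

text \<open>The mixed products of real and imaginary parts are purely imaginary and drop out, so a
  complex square becomes two real ones.\<close>

lemma re_poly_star_mult:
  "re_poly (pcompose (cnjp p) [:0, -1:] * q) =
     pcompose (re_poly p) [:0, -1:] * re_poly q + pcompose (im_poly p) [:0, -1:] * im_poly q"
  by (simp add: re_poly_mult re_poly_pcompose im_poly_pcompose re_poly_cnjp im_poly_cnjp pcompose_uminus)

lemma sum_lessThan_add: "(\<Sum>k<m + l. f k) = (\<Sum>k<m. f k) + (\<Sum>k<l. f (m + k) :: 'a :: comm_monoid_add)"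
  for m l :: nat
  by (induction l) (simp_all add: add.assoc)

text \<open>The substitution back to \<xi> makes the coefficients of \<open>R\<close> real again.
  Taking real parts then keeps only the real part of \<open>V\<close>, and the \<open>m\<close>
  complex squares of \<open>L\<close> become \<open>m + m\<close> real ones.\<close>

lemma dissipative_kernel_behavior_axis:
  assumes R: "R \<in> carrier_mat g n" and \<Sigma>: "\<Sigma> \<in> carrier_mat n n"
    and L: "L \<in> carrier_mat m n" and V: "V \<in> carrier_mat g n"
    and id: "map_mat (\<lambda>x. [:of_real x:]) \<Sigma> =
      cadj L * L + (cadj V * map_mat axis_poly R + cadj (map_mat axis_poly R) * V)"
  shows "dissipative n \<Sigma> (kernel_behavior R)"
proof -
  define sb where "sb p = pcompose p [:0, - \<i>:]" for p :: "complex poly"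
  define l where "l k a = sb (L $$ (k, a))" for k a
  define v where "v k a = sb (V $$ (k, a))" for k a
  define L' where "L' k a = (if k < m then re_poly (l k a) else im_poly (l (k - m) a))" for k a
  define V' where "V' k a = re_poly (v k a)" for k a
  show ?thesis
  proof (rule dissipative_kernel_behavior[OF R \<Sigma>, where l = "m + m" and L = L' and V = V'])
    fix a b assume ab: "a < n" "b < n"
    have "[:complex_of_real (\<Sigma> $$ (a, b)):] = map_mat (\<lambda>x. [:of_real x:]) \<Sigma> $$ (a, b)"
      using ab \<Sigma> by simp
    also have "\<dots> = (\<Sum>k<m. cnjp (L $$ (k, a)) * L $$ (k, b)) +
        ((\<Sum>k<g. cnjp (V $$ (k, a)) * axis_poly (R $$ (k, b))) +
         (\<Sum>k<g. cnjp (axis_poly (R $$ (k, a))) * V $$ (k, b)))"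
      unfolding id using ab L V R by (simp add: scalar_prod_def cadj_index atLeast0LessThan)
    finally have "sb [:complex_of_real (\<Sigma> $$ (a, b)):] = sb ((\<Sum>k<m. cnjp (L $$ (k, a)) * L $$ (k, b)) +
        ((\<Sum>k<g. cnjp (V $$ (k, a)) * axis_poly (R $$ (k, b))) +
         (\<Sum>k<g. cnjp (axis_poly (R $$ (k, a))) * V $$ (k, b))))" by simp
    then have "cpoly [:\<Sigma> $$ (a, b):] = (\<Sum>k<m. pcompose (cnjp (l k a)) [:0, -1:] * l k b) +
        ((\<Sum>k<g. pcompose (cnjp (v k a)) [:0, -1:] * cpoly (R $$ (k, b))) +
         (\<Sum>k<g. pcompose (cnjp (cpoly (R $$ (k, a)))) [:0, -1:] * v k b))"
      unfolding sb_def l_def v_def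
      by (simp add: pcompose_add pcompose_mult pcompose_sum pcompose_cnjp pcompose_axis_poly cpoly_const)
    then have "re_poly (cpoly [:\<Sigma> $$ (a, b):]) = re_poly ((\<Sum>k<m. pcompose (cnjp (l k a)) [:0, -1:] * l k b) +
        ((\<Sum>k<g. pcompose (cnjp (v k a)) [:0, -1:] * cpoly (R $$ (k, b))) +
         (\<Sum>k<g. pcompose (cnjp (cpoly (R $$ (k, a)))) [:0, -1:] * v k b)))" by (rule arg_cong)
    then have "[:\<Sigma> $$ (a, b):] =
        (\<Sum>k<m. pcompose (re_poly (l k a)) [:0, -1:] * re_poly (l k b) +
           pcompose (im_poly (l k a)) [:0, -1:] * im_poly (l k b)) +
        ((\<Sum>k<g. pcompose (V' k a) [:0, -1:] * R $$ (k, b)) + (\<Sum>k<g. pcompose (R $$ (k, a)) [:0, -1:] * V' k b))"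
      unfolding re_poly_cpoly re_poly_add re_poly_sum re_poly_star_mult im_poly_cpoly V'_def by simp
    then show "[:\<Sigma> $$ (a, b):] = (\<Sum>k<m + m. pcompose (L' k a) [:0, -1:] * L' k b) +
      (\<Sum>k<g. pcompose (V' k a) [:0, -1:] * R $$ (k, b) + pcompose (R $$ (k, a)) [:0, -1:] * V' k b)"
      by (simp add: sum_lessThan_add L'_def sum.distrib)
  qed
qed

section \<open>Positivity of the supply rate on the imaginary axis\<close>

lemma eval_at_axis_poly: "eval_at z (map_mat axis_poly R) = eval_mat R (\<i> * z)"
  by (rule eq_matI) (auto simp: eval_mat_def poly_axis_poly)

lemma supply_index:
  assumes \<Sigma>: "\<Sigma> \<in> carrier_mat n n" and M: "M \<in> carrier_mat n m" and ab: "a < m" "b < m"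
  shows "poly ((cadj (map_mat axis_poly M) * map_mat (\<lambda>x. [:of_real x:]) \<Sigma> * map_mat axis_poly M) $$ (a, b)) (of_real \<omega>) =
    (\<Sum>i<n. \<Sum>j<n. of_real (\<Sigma> $$ (i, j)) * (cnj (poly (cpoly (M $$ (i, a))) (\<i> * of_real \<omega>)) *
       poly (cpoly (M $$ (j, b))) (\<i> * of_real \<omega>)))"
proof -
  have "poly ((cadj (map_mat axis_poly M) * map_mat (\<lambda>x. [:of_real x:]) \<Sigma> * map_mat axis_poly M) $$ (a, b)) (of_real \<omega>) =
    (\<Sum>j<n. (\<Sum>i<n. cnj (poly (cpoly (M $$ (i, a))) (\<i> * of_real \<omega>)) * of_real (\<Sigma> $$ (i, j))) *
       poly (cpoly (M $$ (j, b))) (\<i> * of_real \<omega>))"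
    using assms by (simp add: scalar_prod_def cadj_index atLeast0LessThan poly_sum poly_cnjp poly_axis_poly mult.commute del: assoc_mult_mat)
  also have "\<dots> = (\<Sum>i<n. \<Sum>j<n. of_real (\<Sigma> $$ (i, j)) * (cnj (poly (cpoly (M $$ (i, a))) (\<i> * of_real \<omega>)) *
       poly (cpoly (M $$ (j, b))) (\<i> * of_real \<omega>)))"
    by (subst sum.swap) (simp add: sum_distrib_left sum_distrib_right mult_ac)
  finally show ?thesis .
qed

text \<open>At a real point the polynomial test vector is a constant amplitude, which
  \<open>M\<close> maps to the amplitude of a sinusoid in the image behavior. The value of the form
  is then twice the mean supply rate of that sinusoid.\<close>

lemma psd_supply:
  assumes dis: "dissipative n \<Sigma> (image_behavior M)" and M: "M \<in> carrier_mat n m"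
    and \<Sigma>: "\<Sigma> \<in> carrier_mat n n" "transpose_mat \<Sigma> = \<Sigma>"
  shows "psd_poly_mat m (cadj (map_mat axis_poly M) * map_mat (\<lambda>x. [:of_real x:]) \<Sigma> * map_mat axis_poly M)"
proof -
  define M' where "M' = map_mat axis_poly M"
  define \<Sigma>' where "\<Sigma>' = map_mat (\<lambda>x. [:complex_of_real x:]) \<Sigma>"
  have M': "M' \<in> carrier_mat n m" and \<Sigma>': "\<Sigma>' \<in> carrier_mat n n" using M \<Sigma> by (auto simp: M'_def \<Sigma>'_def)
  have sym: "\<Sigma> $$ (j, i) = \<Sigma> $$ (i, j)" if "i < n" "j < n" for i j
    using that \<Sigma> by (metis carrier_matD index_transpose_mat(1))
  have c\<Sigma>: "cadj \<Sigma>' = \<Sigma>'"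
    using \<Sigma>(1) by (intro eq_matI) (auto simp: cadj_index \<Sigma>'_def map_poly_pCons sym)
  have herm: "cadj (cadj M' * \<Sigma>' * M') = cadj M' * \<Sigma>' * M'"
    using M' \<Sigma>' by (simp add: cadj_mult c\<Sigma> mat_assoc del: assoc_mult_mat)
  have "nonneg_poly ((cadj u * (cadj M' * \<Sigma>' * M') * u) $$ (0, 0))" if u: "u \<in> carrier_mat m 1" for u
  proof -
    define y where "y i = (M' * u) $$ (i, 0)" for i
    have "M' * u = mat n 1 (\<lambda>(i, _). y i)" using M' u by (intro eq_matI) (auto simp: y_def)
    moreover have "cadj u * (cadj M' * \<Sigma>' * M') * u = cadj (M' * u) * \<Sigma>' * (M' * u)"
      using M' \<Sigma>' u by (simp add: cadj_mult mat_assoc del: assoc_mult_mat)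
    ultimately have q: "(cadj u * (cadj M' * \<Sigma>' * M') * u) $$ (0, 0) =
        (\<Sum>i<n. \<Sum>j<n. cnjp (y i) * \<Sigma>' $$ (i, j) * y j)" using qform_index[OF \<Sigma>', of y] by simp
    define z where "z \<omega> i = poly (y i) (complex_of_real \<omega>)" for \<omega> i
    have val: "poly ((cadj u * (cadj M' * \<Sigma>' * M') * u) $$ (0, 0)) (of_real \<omega>) =
        (\<Sum>i<n. \<Sum>j<n. of_real (\<Sigma> $$ (i, j)) * (cnj (z \<omega> i) * z \<omega> j))" for \<omega>
      unfolding q using \<Sigma>(1) by (simp add: poly_sum poly_cnjp \<Sigma>'_def z_def mult_ac)
    have re: "0 \<le> Re (\<Sum>i<n. \<Sum>j<n. of_real (\<Sigma> $$ (i, j)) * (cnj (z \<omega> i) * z \<omega> j))" if "\<omega> \<noteq> 0" for \<omega>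
    proof -
      \<comment> \<open>The required formula for the amplitude must hold at every index, whereas
        \<open>z \<omega>\<close> is known to satisfy it only below \<open>n\<close>.\<close>
      define a where "a i = (\<Sum>k<m. poly (cpoly (M $$ (i, k))) (\<i> * of_real \<omega>) * poly (u $$ (k, 0)) (of_real \<omega>))" for i
      have "z \<omega> i = a i" if "i < n" for i
        using that M M' u by (simp add: z_def y_def a_def M'_def scalar_prod_def poly_sum poly_axis_poly atLeast0LessThan)
      then show ?thesis
        using dissipative_frequency_nonneg[OF dis M \<Sigma>(1) that, of a] a_def by (simp cong: sum.cong_simp)
    qed
    have im: "Im (\<Sum>i<n. \<Sum>j<n. of_real (\<Sigma> $$ (i, j)) * (cnj (z \<omega> i) * z \<omega> j)) = 0" for \<omega>
    proof -
      let ?S = "\<Sum>i<n. \<Sum>j<n. of_real (\<Sigma> $$ (i, j)) * (cnj (z \<omega> i) * z \<omega> j)"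
      have "cnj ?S = (\<Sum>i<n. \<Sum>j<n. of_real (\<Sigma> $$ (j, i)) * (cnj (z \<omega> j) * z \<omega> i))"
        using sym by (simp add: mult_ac cong: sum.cong_simp)
      also have "\<dots> = ?S" by (rule sum.swap)
      finally show ?thesis using Reals_cnj_iff complex_is_Real_iff by blast
    qed
    show ?thesis unfolding nonneg_poly_def
    proof
      fix \<omega> :: real
      show "Im (poly ((cadj u * (cadj M' * \<Sigma>' * M') * u) $$ (0, 0)) (of_real \<omega>)) = 0 \<and>
          0 \<le> Re (poly ((cadj u * (cadj M' * \<Sigma>' * M') * u) $$ (0, 0)) (of_real \<omega>))"
      proof (cases "\<omega> = 0")
        \<comment> \<open>Averaging over a period needs a nonzero frequency; the value at zero
          frequency follows by continuity.\<close>
        case True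
        show ?thesis unfolding True by (rule nonneg_poly_at_right) (use re im val in auto)
      qed (use re im val in auto)
    qed
  qed
  then have "psd_poly_mat m (cadj M' * \<Sigma>' * M')"
    unfolding psd_poly_mat_def using herm mult_carrier_mat[OF mult_carrier_mat[of "cadj M'" m n \<Sigma>' n] M'] M' \<Sigma>' by simp
  then show ?thesis by (simp only: M'_def \<Sigma>'_def)
qed

text \<open>This condition implies that \<open>z\<close> is an uncontrollable mode. Unlike a statement about ranks, it is
  visibly invariant under complex conjugation of \<open>z\<close>.\<close>

definition kernel_exceeds_image :: "nat \<Rightarrow> nat \<Rightarrow> real poly mat \<Rightarrow> real poly mat \<Rightarrow> complex \<Rightarrow> bool" where
  "kernel_exceeds_image n m R M z \<longleftrightarrow> (\<exists>x\<in>carrier_vec n. eval_mat R z *\<^sub>v x = 0\<^sub>v (dim_row R) \<and>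
     (\<forall>y\<in>carrier_vec m. x \<noteq> eval_mat M z *\<^sub>v y))"

section \<open>Conjugation symmetry of the exceptional points\<close>

lemma poly_cpoly_cnj: "poly (cpoly p) (cnj z) = cnj (poly (cpoly p) z)"
  by (induction p) (auto simp: map_poly_pCons)

lemma eval_mat_cnj_mult:
  assumes "R \<in> carrier_mat g n" "x \<in> carrier_vec n"
  shows "eval_mat R (cnj z) *\<^sub>v map_vec cnj x = map_vec cnj (eval_mat R z *\<^sub>v x)"
  using assms by (intro eq_vecI) (auto simp: eval_mat_def scalar_prod_def poly_cpoly_cnj)

lemma kernel_exceeds_image_cnj:
  assumes R: "R \<in> carrier_mat g n" and M: "M \<in> carrier_mat n m" and k: "kernel_exceeds_image n m R M z"
  shows "kernel_exceeds_image n m R M (cnj z)"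
proof -
  obtain x where x: "x \<in> carrier_vec n" "eval_mat R z *\<^sub>v x = 0\<^sub>v g"
    and ni: "\<And>y. y \<in> carrier_vec m \<Longrightarrow> x \<noteq> eval_mat M z *\<^sub>v y"
    using k R by (auto simp: kernel_exceeds_image_def)
  have cc: "map_vec cnj (map_vec cnj v) = v" for v by (rule eq_vecI) auto
  have "eval_mat R (cnj z) *\<^sub>v map_vec cnj x = 0\<^sub>v g"
    unfolding eval_mat_cnj_mult[OF R x(1)] x(2) by (rule eq_vecI) auto
  moreover have "map_vec cnj x \<noteq> eval_mat M (cnj z) *\<^sub>v y" if y: "y \<in> carrier_vec m" for y
  proof
    assume e: "map_vec cnj x = eval_mat M (cnj z) *\<^sub>v y"
    have cy: "map_vec cnj y \<in> carrier_vec m" using y by simp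
    have "x = map_vec cnj (eval_mat M (cnj z) *\<^sub>v map_vec cnj (map_vec cnj y))" by (simp add: cc e[symmetric])
    also have "\<dots> = eval_mat M z *\<^sub>v map_vec cnj y" unfolding eval_mat_cnj_mult[OF M cy] by (simp add: cc)
    finally show False using ni[OF cy] by blast
  qed
  ultimately show ?thesis using x(1) R unfolding kernel_exceeds_image_def
    by (intro bexI[of _ "map_vec cnj x"]) auto
qed

lemma eval_mat_mult_zero:
  assumes R: "R \<in> carrier_mat g n" and M: "M \<in> carrier_mat n m" and RM: "R * M = 0\<^sub>m g m"
  shows "eval_mat R z * eval_mat M z = 0\<^sub>m g m"
proof (rule eq_matI)
  fix i j assume "i < dim_row (0\<^sub>m g m :: complex mat)" "j < dim_col (0\<^sub>m g m :: complex mat)"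
  then have ij: "i < g" "j < m" by auto
  have "(eval_mat R z * eval_mat M z) $$ (i, j) = poly (cpoly ((R * M) $$ (i, j))) z"
    using R M ij by (simp add: eval_mat_def scalar_prod_def cpoly_hom.hom_sum cpoly_hom.hom_mult poly_sum)
  then show "(eval_mat R z * eval_mat M z) $$ (i, j) = 0\<^sub>m g m $$ (i, j)" unfolding RM using ij by simp
qed (use R M in \<open>auto simp: eval_mat_def\<close>)

lemma dissipative_subset: "dissipative n \<Sigma> B \<Longrightarrow> C \<subseteq> B \<Longrightarrow> dissipative n \<Sigma> C"
  unfolding dissipative_def by (meson subsetD)

theorem theorem3p2:
  fixes n m q p g :: nat
    and R M W1 W2 :: "real poly mat"
    and B Bcont :: "(real \<Rightarrow> real vec) set"
    and \<Sigma> J D :: "real mat"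
    and G :: "real poly fract mat"
  assumes "R \<in> carrier_mat g n"
    and "B = kernel_behavior R"
    and "m = input_cardinality R"
    and "n = m + q + p"
    and "\<Sigma> \<in> carrier_mat n n"
    and "transpose_mat \<Sigma> = \<Sigma>"
    and "invertible_mat \<Sigma>"
    and "m \<le> num_pos_eigenvalues \<Sigma>"
    and "\<Sigma> = diag_block_mat [1\<^sub>m m, 1\<^sub>m q, - 1\<^sub>m p]"
    and "J = diag_block_mat [1\<^sub>m q, - 1\<^sub>m p]"
    and "uncontrollable_modes R \<inter> uminus ` uncontrollable_modes R = {}"
    and "is_controllable_part n B Bcont"
    and "M = W1 @\<^sub>r W2"
    and "Bcont = image_behavior M"
    and "observable_image M"
    and "W1 \<in> carrier_mat m m"
    and "W2 \<in> carrier_mat (p + q) m"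
    and "Determinant.det W1 \<noteq> 0"
    and "G = transfer_matrix W1 W2"
    and "proper_mat G"
    and "has_limit_on_imaginary_axis G D"
    and "positive_definite (1\<^sub>m m + transpose_mat D * J * D)"
  shows "dissipative n \<Sigma> B \<longleftrightarrow> dissipative n \<Sigma> Bcont"
proof
  have sub: "Bcont \<subseteq> B" using assms(12) by (simp add: is_controllable_part_def)
  show "dissipative n \<Sigma> Bcont" if "dissipative n \<Sigma> B"
    by (rule dissipative_subset[OF that sub])
next
  assume dis: "dissipative n \<Sigma> Bcont"
  note R = assms(1) and \<Sigma> = assms(5) and W1 = assms(16) and W2 = assms(17)
  have n: "n = m + (q + p)" using assms(4) by simp
  have M: "M \<in> carrier_mat n m"
    using carrier_append_rows[OF W1 W2] unfolding assms(13) n by (simp add: add.commute)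
  have M1: "M $$ (i, a) = W1 $$ (i, a)" if "i < m" "a < m" for i a
    using that W1 W2 by (simp add: assms(13) append_rows_def)
  have M2: "M $$ (m + i, a) = W2 $$ (i, a)" if "i < q + p" "a < m" for i a
    using that W1 W2 by (simp add: assms(13) append_rows_def)
  have "image_behavior M \<subseteq> kernel_behavior R"
    using assms(12) unfolding is_controllable_part_def assms(2,14) by (elim conjE)
  then have RM: "R * M = 0\<^sub>m g m" by (rule image_subset_kernel_mult[OF R M])
  define s where "s i = (if i < q then 1 else -1 :: real)" for i
  have J: "J \<in> carrier_mat (q + p) (q + p)"
    "\<And>i j. i < q + p \<Longrightarrow> j < q + p \<Longrightarrow> J $$ (i, j) = (if i = j then s i else 0)"
    unfolding assms(10) by (auto simp: s_def)
  have \<Sigma>1: "\<Sigma> $$ (i, j) = (if i = j then 1 else 0)" if "i < m" "j < n" for i j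
    using that by (auto simp: assms(9) n)
  have \<Sigma>2: "\<Sigma> $$ (m + i, j) = (if m + i = j then s i else 0)" if "i < q + p" "j < n" for i j
    using that by (auto simp: assms(9) n s_def)
  define M' where "M' = map_mat axis_poly M"
  define R' where "R' = map_mat axis_poly R"
  define \<Sigma>' where "\<Sigma>' = map_mat (\<lambda>x. [:complex_of_real x:]) \<Sigma>"
  have M': "M' \<in> carrier_mat n m" and R': "R' \<in> carrier_mat g n" and \<Sigma>': "\<Sigma>' \<in> carrier_mat n n"
    using M R \<Sigma> by (auto simp: M'_def R'_def \<Sigma>'_def)
  have sym: "\<Sigma> $$ (j, i) = \<Sigma> $$ (i, j)" if "i < n" "j < n" for i j
    using that \<Sigma> assms(6) by (metis carrier_matD index_transpose_mat(1))
  have herm: "cadj \<Sigma>' = \<Sigma>'"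
    using \<Sigma> by (intro eq_matI) (auto simp: cadj_index \<Sigma>'_def map_poly_pCons sym)
  have RM': "R' * M' = 0\<^sub>m g m"
  proof -
    have "R' * M' = map_mat axis_poly (R * M)"
      unfolding R'_def M'_def using R M
      by (intro eq_matI) (auto simp: scalar_prod_def axis_poly.hom_sum axis_poly.hom_mult)
    then show ?thesis unfolding RM by (simp only:) (rule eq_matI; simp)
  qed
  have inj0: "x = 0\<^sub>v m" if "x \<in> carrier_vec m" "eval_mat M z *\<^sub>v x = 0\<^sub>v n" for z x
  proof (rule full_column_rank_injective[OF _ _ that])
    show "eval_mat M z \<in> carrier_mat n m" using M by (simp add: eval_mat_def)
    show "vec_space.rank n (eval_mat M z) = m"
      using assms(15) M by (auto simp: observable_image_def rank_at_def)
  qed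
  have inj: "x = 0\<^sub>v m" if "x \<in> carrier_vec m" "eval_at z M' *\<^sub>v x = 0\<^sub>v n" for z x
    using inj0 that by (simp add: M'_def eval_at_axis_poly)
  \<comment> \<open>The bound by the number of columns rules out truncation in the subtraction that
    defines \<open>input_cardinality\<close>.\<close>
  have rk: "poly_rank R = n - m"
  proof -
    have "poly_rank R \<le> n" unfolding poly_rank_def using R by (intro vec_space.rank_le_nc) auto
    then show ?thesis using assms(3) R by (simp add: input_cardinality_def)
  qed
  \<comment> \<open>Where \<open>R(z)\<close> keeps the rank \<open>n - m\<close>, its kernel has no
    room beyond the image of the injective \<open>M(z)\<close>.\<close>
  have modes: "z \<in> uncontrollable_modes R" if k: "kernel_exceeds_image n m R M z" for z
  proof (rule ccontr)
    assume "z \<notin> uncontrollable_modes R"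
    then have le: "n - m \<le> vec_space.rank g (eval_mat R z)"
      using rk R by (simp add: uncontrollable_modes_def rank_at_def)
    obtain x where x: "x \<in> carrier_vec n" "eval_mat R z *\<^sub>v x = 0\<^sub>v g"
      and ni: "\<forall>y\<in>carrier_vec m. x \<noteq> eval_mat M z *\<^sub>v y"
      using k R by (auto simp: kernel_exceeds_image_def)
    have c: "eval_mat R z \<in> carrier_mat g n" "eval_mat M z \<in> carrier_mat n m" and mn: "m \<le> n"
      using R M n by (auto simp: eval_mat_def)
    have "\<exists>y\<in>carrier_vec m. x = eval_mat M z *\<^sub>v y"
      by (rule kernel_subset_image[OF c eval_mat_mult_zero[OF R M RM] inj0 mn le x])
    then show False using ni by blast
  qed
  define \<Omega> where "\<Omega> = {z. kernel_exceeds_image n m R M (\<i> * z)}"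
  have \<Omega>: "\<not> (z \<in> \<Omega> \<and> cnj z \<in> \<Omega>)" for z
  proof
    assume "z \<in> \<Omega> \<and> cnj z \<in> \<Omega>"
    then have k: "kernel_exceeds_image n m R M (\<i> * z)" "kernel_exceeds_image n m R M (\<i> * cnj z)"
      by (auto simp: \<Omega>_def)
    \<comment> \<open>The conjugate of \<open>\<i> * cnj z\<close> is \<open>- (\<i> * z)\<close>. A
      conjugate pair in \<open>\<Omega>\<close> would thus give a mode together with its
      negative.\<close>
    have "kernel_exceeds_image n m R M (- (\<i> * z))" using kernel_exceeds_image_cnj[OF R M k(2)] by simp
    then have "\<i> * z \<in> uncontrollable_modes R" "- (\<i> * z) \<in> uncontrollable_modes R"
      using modes k(1) by auto
    moreover have "\<i> * z = - (- (\<i> * z))" by simp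
    ultimately show False using assms(11) by (metis IntI empty_iff image_eqI)
  qed
  have ker: "\<exists>y\<in>carrier_vec m. x = eval_at z M' *\<^sub>v y"
    if "z \<notin> \<Omega>" "x \<in> carrier_vec n" "eval_at z R' *\<^sub>v x = 0\<^sub>v g" for z x
    using that R unfolding \<Omega>_def kernel_exceeds_image_def R'_def M'_def eval_at_axis_poly by auto
  have psd: "psd_poly_mat m (cadj M' * \<Sigma>' * M')"
    unfolding M'_def \<Sigma>'_def by (rule psd_supply[OF _ M \<Sigma> assms(6)]) (use dis assms(14) in simp)
  have W2': "W2 \<in> carrier_mat (q + p) m" using W2 by (simp add: add.commute)
  obtain \<omega> :: real where \<omega>: "Determinant.det (mat m m (\<lambda>(a, b).
      (\<Sum>i<m. cnj (poly (cpoly (W1 $$ (i, a))) (\<i> * of_real \<omega>)) * poly (cpoly (W1 $$ (i, b))) (\<i> * of_real \<omega>)) +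
      (\<Sum>i<q + p. of_real (s i) * (cnj (poly (cpoly (W2 $$ (i, a))) (\<i> * of_real \<omega>)) *
         poly (cpoly (W2 $$ (i, b))) (\<i> * of_real \<omega>))))) \<noteq> 0"
    using supply_det_nonzero[OF W1 W2' assms(18,19,21) J assms(22)] by blast
  \<comment> \<open>It suffices to find one point where the determinant is nonzero. At frequency
    \<open>\<omega>\<close> the diagonal form of \<open>\<Sigma>\<close> reduces the product to a
    signed sum over the rows of \<open>W1\<close> and \<open>W2\<close>.\<close>
  have det: "Determinant.det (cadj M' * \<Sigma>' * M') \<noteq> 0"
  proof
    assume "Determinant.det (cadj M' * \<Sigma>' * M') = 0"
    then have "Determinant.det (eval_at (of_real \<omega>) (cadj M' * \<Sigma>' * M')) = 0"
      using comm_ring_hom.hom_det[OF poly_hom.comm_ring_hom_axioms, of "of_real \<omega>"] by (metis poly_0)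
    moreover have "eval_at (of_real \<omega>) (cadj M' * \<Sigma>' * M') = mat m m (\<lambda>(a, b).
      (\<Sum>i<m. cnj (poly (cpoly (W1 $$ (i, a))) (\<i> * of_real \<omega>)) * poly (cpoly (W1 $$ (i, b))) (\<i> * of_real \<omega>)) +
      (\<Sum>i<q + p. of_real (s i) * (cnj (poly (cpoly (W2 $$ (i, a))) (\<i> * of_real \<omega>)) *
         poly (cpoly (W2 $$ (i, b))) (\<i> * of_real \<omega>))))" (is "_ = ?N")
    proof (rule eq_matI)
      fix a b assume "a < dim_row ?N" "b < dim_col ?N"
      then have ab: "a < m" "b < m" by auto
      define c where "c i a = poly (cpoly (M $$ (i, a))) (\<i> * complex_of_real \<omega>)" for i a
      have "eval_at (of_real \<omega>) (cadj M' * \<Sigma>' * M') $$ (a, b) =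
          poly ((cadj M' * \<Sigma>' * M') $$ (a, b)) (of_real \<omega>)"
        using ab M' by (simp del: index_mult_mat(1))
      also have "\<dots> = (\<Sum>i<n. \<Sum>j<n. of_real (\<Sigma> $$ (i, j)) * (cnj (c i a) * c j b))"
        unfolding M'_def \<Sigma>'_def c_def by (rule supply_index[OF \<Sigma> M ab])
      also have "\<dots> = (\<Sum>i<m. \<Sum>j<n. of_real (\<Sigma> $$ (i, j)) * (cnj (c i a) * c j b)) +
          (\<Sum>i<q + p. \<Sum>j<n. of_real (\<Sigma> $$ (m + i, j)) * (cnj (c (m + i) a) * c j b))"
        unfolding n by (rule sum_lessThan_add)
      also have "(\<Sum>i<m. \<Sum>j<n. of_real (\<Sigma> $$ (i, j)) * (cnj (c i a) * c j b)) =
          (\<Sum>i<m. cnj (c i a) * c i b)"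
      proof (intro sum.cong refl)
        fix i assume "i \<in> {..<m}"
        then have i: "i < m" "i < n" using n by auto
        have "(\<Sum>j<n. of_real (\<Sigma> $$ (i, j)) * (cnj (c i a) * c j b)) =
            (\<Sum>j<n. if j = i then cnj (c i a) * c i b else 0)"
          by (intro sum.cong refl) (use \<Sigma>1 i in auto)
        then show "(\<Sum>j<n. of_real (\<Sigma> $$ (i, j)) * (cnj (c i a) * c j b)) = cnj (c i a) * c i b"
          using i by simp
      qed
      also have "(\<Sum>i<q + p. \<Sum>j<n. of_real (\<Sigma> $$ (m + i, j)) * (cnj (c (m + i) a) * c j b)) =
          (\<Sum>i<q + p. of_real (s i) * (cnj (c (m + i) a) * c (m + i) b))"
      proof (intro sum.cong refl)
        fix i assume "i \<in> {..<q + p}"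
        then have i: "i < q + p" "m + i < n" using n by auto
        have "(\<Sum>j<n. of_real (\<Sigma> $$ (m + i, j)) * (cnj (c (m + i) a) * c j b)) =
            (\<Sum>j<n. if j = m + i then of_real (s i) * (cnj (c (m + i) a) * c (m + i) b) else 0)"
          by (intro sum.cong refl) (use \<Sigma>2 i in auto)
        then show "(\<Sum>j<n. of_real (\<Sigma> $$ (m + i, j)) * (cnj (c (m + i) a) * c j b)) =
            of_real (s i) * (cnj (c (m + i) a) * c (m + i) b)"
          using i by simp
      qed
      finally show "eval_at (of_real \<omega>) (cadj M' * \<Sigma>' * M') $$ (a, b) = ?N $$ (a, b)"
        using ab by (simp add: c_def M1 M2 cong: sum.cong_simp)
    qed (use M' in auto)
    ultimately show False using \<omega> by simp
  qed
  obtain L V where "L \<in> carrier_mat m n" "V \<in> carrier_mat g n"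
    "\<Sigma>' = cadj L * L + (cadj V * R' + cadj R' * V)"
    by (rule dissipation_identity[OF R' M' \<Sigma>' herm RM' inj ker \<Omega> psd det])
  then show "dissipative n \<Sigma> B"
    unfolding assms(2) \<Sigma>'_def R'_def by (intro dissipative_kernel_behavior_axis[OF R \<Sigma>])
qed

end
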